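(* Let $\mathcal T$ be a triangulation of a surface $S$ of topological type $(g,n)$ and let $\Theta:E\to[0,\pi)$ satisfy $\mathbf{(C1)}$. Let $K=(k_1,\dots,k_{|V|})$ be a hyperbolic (resp. Euclidean) curvature vector. Then for any $r(0)\in\mathbb R_+^{|V|}$ the flow $$\frac{dr_i}{dt}=(k_i-K_i)\sinh r_i\qquad\Big(\text{resp. }\frac{dr_i}{dt}=(k_i-K_i)r_i\Big),\quad i=1,\dots,|V|,$$ with $K_i$ computed in hyperbolic (resp. Euclidean) background geometry, has a unique solution $r(t)$ existing for all $t\ge0$, and $r(t)$ converges if and only if $K$ is attainable. Moreover, if $r(t)$ converges, it converges exponentially fast to a radius vector producing a hyperbolic (resp. Euclidean) cone metric $\mu$ on $S$ whose vertex curvatures are given by $K$, and $(S,\mu)$ supports a $\mathcal T$-type circle pattern with exterior intersection angles given by $\Theta$.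
   Context: $S$: compact oriented surface of genus $g$ with $n\ge0$ boundary circles, $\chi(S)=2-2g-n$. $\mathcal T$: vertices $V=\{v_1,\dots,v_{|V|}\}$, edges $E$, triangles $F$, boundary vertices $V_\partial$. $\mathbf{(C1)}$: whenever $e_1,e_2,e_3$ bound a triangle, $I(e_1)+I(e_2)I(e_3)\ge0$ and cyclic analogues, $I=\cos\Theta$. For $r\in\mathbb R_+^{|V|}$, each triangle $v_iv_jv_k$ is realized as the hyperbolic triangle with sides $l_{ij}=\cosh^{-1}(\cosh r_i\cosh r_j+\sinh r_i\sinh r_j\cos\Theta([v_i,v_j]))$ etc. (resp. the Euclidean triangle with sides $l_{ij}=\sqrt{r_i^2+r_j^2+2r_ir_j\cos\Theta([v_i,v_j])}$ etc.), glued into a cone metric; $\sigma(v_i)$ is the total angle at $v_i$; $K_i=2\pi-\sigma(v_i)$ for interior and $\pi-\sigma(v_i)$ for boundary vertices. A vector $K\in\mathbb R^{|V|}$ is hyperbolic (resp. Euclidean) if $k_i<2\pi$ for interior $v_i$, $k_i<\pi$ for $v_i\in V_\partial$, and $\sum_i k_i>2\pi\chi(S)$ (resp. $\sum_ik_i=2\pi\chi(S)$). $K$ is attainable if for every proper non-empty $A\subsetneq V$, $\sum_{v_i\in A}k_i>-\sum_{(e,v)\in Lk(A)}(\pi-\Theta(e))+2\pi\chi(G(A)\setminus\partial S)+\pi\chi(G(A)\cap\partial S)$, where $G(A)$ is the union of open cells of $\mathcal T$ having a vertex in $A$, $\chi$ of a union of open cells is #0-cells − #1-cells + #2-cells, and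 $Lk(A)$ is the set of pairs $(e,v)$, $v\in A$, $e\in E$ with no endpoint in $A$, forming a triangle with $v$. A $\mathcal T$-type circle pattern: circles centered at the vertices with radii $r_i$, intersecting along each edge $e$ at exterior angle $\Theta(e)$. *)

theory Defs
  imports "HOL-Analysis.Analysis"
begin

text \<open>A triangulation is modelled as a finite pure 2-dimensional simplicial complex,
given by its set of faces (3-element vertex sets).\<close>

datatype geom = Hyp | Euc

definition verts :: "'v set set \<Rightarrow> 'v set" where
  "verts T = \<Union>T"

definition edges :: "'v set set \<Rightarrow> 'v set set" where
  "edges T = {e. card e = 2 \<and> (\<exists>f\<in>T. e \<subseteq> f)}"

definition bedges :: "'v set set \<Rightarrow> 'v set set" where
  "bedges T = {e \<in> edges T. card {f \<in> T. e \<subseteq> f} = 1}"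

definition bverts :: "'v set set \<Rightarrow> 'v set" where
  "bverts T = \<Union>(bedges T)"

definition euler_char :: "'v set set \<Rightarrow> int" where
  "euler_char T = int (card (verts T)) - int (card (edges T)) + int (card T)"

text \<open>Link of a vertex v: graph with edges f - {v} for faces f containing v.\<close>
definition link_adj :: "'v set set \<Rightarrow> 'v \<Rightarrow> ('v \<times> 'v) set" where
  "link_adj T v = {(a, b). a \<noteq> b \<and> insert v {a, b} \<in> T \<and> v \<notin> {a,b}}"

definition link_verts :: "'v set set \<Rightarrow> 'v \<Rightarrow> 'v set" where
  "link_verts T v = \<Union>{f - {v} | f. f \<in> T \<and> v \<in> f}"

definition skel_adj :: "'v set set \<Rightarrow> ('v \<times> 'v) set" where
  "skel_adj T = {(a, b). {a, b} \<in> edges T}"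

definition dir_edges :: "'v \<times> 'v \<times> 'v \<Rightarrow> ('v \<times> 'v) set" where
  "dir_edges t = (case t of (a, b, c) \<Rightarrow> {(a, b), (b, c), (c, a)})"

text \<open>Coherent orientation: every face is given a cyclic ordering of its vertices such
that two distinct faces never traverse a common edge in the same direction.\<close>
definition orientable :: "'v set set \<Rightarrow> bool" where
  "orientable T \<longleftrightarrow> (\<exists>ori :: 'v set \<Rightarrow> 'v \<times> 'v \<times> 'v.
     (\<forall>f\<in>T. case ori f of (a, b, c) \<Rightarrow> f = {a, b, c}) \<and>
     (\<forall>f\<in>T. \<forall>g\<in>T. f \<noteq> g \<longrightarrow> dir_edges (ori f) \<inter> dir_edges (ori g) = {}))"

text \<open>Triangulation of a compact connected oriented surface (possibly with boundary).\<close>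
definition surface_triangulation :: "'v set set \<Rightarrow> bool" where
  "surface_triangulation T \<longleftrightarrow>
     finite T \<and> T \<noteq> {} \<and> (\<forall>f\<in>T. card f = 3) \<and>
     (\<forall>e\<in>edges T. card {f \<in> T. e \<subseteq> f} \<le> 2) \<and>
     (\<forall>v\<in>verts T. \<forall>a\<in>link_verts T v. \<forall>b\<in>link_verts T v. (a, b) \<in> (link_adj T v)\<^sup>*) \<and>
     (\<forall>a\<in>verts T. \<forall>b\<in>verts T. (a, b) \<in> (skel_adj T)\<^sup>*) \<and>
     orientable T"

text \<open>Condition (C1), with I = cos \<Theta>.\<close>
definition C1 :: "'v set set \<Rightarrow> ('v set \<Rightarrow> real) \<Rightarrow> bool" where
  "C1 T \<Theta> \<longleftrightarrow> (\<forall>a b c. {a, b, c} \<in> T \<and> card {a, b, c} = 3 \<longrightarrow>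
      cos (\<Theta> {a, b}) + cos (\<Theta> {b, c}) * cos (\<Theta> {c, a}) \<ge> 0)"

text \<open>Edge length of the edge [v_a, v_b] in the given background geometry.\<close>
definition edge_len :: "geom \<Rightarrow> ('v set \<Rightarrow> real) \<Rightarrow> ('v \<Rightarrow> real) \<Rightarrow> 'v \<Rightarrow> 'v \<Rightarrow> real" where
  "edge_len G \<Theta> r a b = (case G of
     Hyp \<Rightarrow> arcosh (cosh (r a) * cosh (r b) + sinh (r a) * sinh (r b) * cos (\<Theta> {a, b}))
   | Euc \<Rightarrow> sqrt ((r a)\<^sup>2 + (r b)\<^sup>2 + 2 * r a * r b * cos (\<Theta> {a, b})))"

text \<open>Inner angle at v of the triangle v a b with side lengths given by edge_len
(law of cosines in the respective geometry).\<close>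
definition corner_angle :: "geom \<Rightarrow> ('v set \<Rightarrow> real) \<Rightarrow> ('v \<Rightarrow> real) \<Rightarrow> 'v \<Rightarrow> 'v \<Rightarrow> 'v \<Rightarrow> real" where
  "corner_angle G \<Theta> r v a b = (let x = edge_len G \<Theta> r v a; y = edge_len G \<Theta> r v b;
       z = edge_len G \<Theta> r a b in
     case G of
       Hyp \<Rightarrow> arccos ((cosh x * cosh y - cosh z) / (sinh x * sinh y))
     | Euc \<Rightarrow> arccos ((x\<^sup>2 + y\<^sup>2 - z\<^sup>2) / (2 * x * y)))"

text \<open>Cone angle at v: sum over the faces containing v of the inner angle at v
(each face counted once: the double sum runs over both orderings of the other two vertices).\<close>
definition cone_angle :: "geom \<Rightarrow> 'v set set \<Rightarrow> ('v set \<Rightarrow> real) \<Rightarrow> ('v \<Rightarrow> real) \<Rightarrow> 'v \<Rightarrow> real" where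
  "cone_angle G T \<Theta> r v = (\<Sum>f\<in>{f\<in>T. v \<in> f}.
      (\<Sum>a\<in>f - {v}. \<Sum>b\<in>f - {v, a}. corner_angle G \<Theta> r v a b) / 2)"

definition curv :: "geom \<Rightarrow> 'v set set \<Rightarrow> ('v set \<Rightarrow> real) \<Rightarrow> ('v \<Rightarrow> real) \<Rightarrow> 'v \<Rightarrow> real" where
  "curv G T \<Theta> r v = (if v \<in> bverts T then pi else 2 * pi) - cone_angle G T \<Theta> r v"

definition curvature_vector :: "geom \<Rightarrow> 'v set set \<Rightarrow> ('v \<Rightarrow> real) \<Rightarrow> bool" where
  "curvature_vector G T k \<longleftrightarrow>
     (\<forall>v\<in>verts T - bverts T. k v < 2 * pi) \<and> (\<forall>v\<in>bverts T. k v < pi) \<and>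
     (case G of Hyp \<Rightarrow> (\<Sum>v\<in>verts T. k v) > 2 * pi * euler_char T
              | Euc \<Rightarrow> (\<Sum>v\<in>verts T. k v) = 2 * pi * euler_char T)"

text \<open>Attainability. Cells of G(A): vertices in A, edges meeting A, faces meeting A.
Faces are interior; vertices/edges split into interior/boundary ones.\<close>
definition Lk :: "'v set set \<Rightarrow> 'v set \<Rightarrow> ('v set \<times> 'v) set" where
  "Lk T A = {(e, v). v \<in> A \<and> e \<in> edges T \<and> e \<inter> A = {} \<and> insert v e \<in> T}"

definition chi_int :: "'v set set \<Rightarrow> 'v set \<Rightarrow> int" where
  "chi_int T A = int (card (A - bverts T)) - int (card {e \<in> edges T - bedges T. e \<inter> A \<noteq> {}})
      + int (card {f \<in> T. f \<inter> A \<noteq> {}})"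

definition chi_bdry :: "'v set set \<Rightarrow> 'v set \<Rightarrow> int" where
  "chi_bdry T A = int (card (A \<inter> bverts T)) - int (card {e \<in> bedges T. e \<inter> A \<noteq> {}})"

definition attainable :: "'v set set \<Rightarrow> ('v set \<Rightarrow> real) \<Rightarrow> ('v \<Rightarrow> real) \<Rightarrow> bool" where
  "attainable T \<Theta> k \<longleftrightarrow> (\<forall>A. A \<subset> verts T \<and> A \<noteq> {} \<longrightarrow>
     (\<Sum>v\<in>A. k v) > - (\<Sum>p\<in>Lk T A. pi - \<Theta> (fst p))
        + 2 * pi * chi_int T A + pi * chi_bdry T A)"

definition flow_factor :: "geom \<Rightarrow> real \<Rightarrow> real" where
  "flow_factor G x = (case G of Hyp \<Rightarrow> sinh x | Euc \<Rightarrow> x)"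

text \<open>r solves the curvature flow on [0,\<infinity>) with initial value r0, staying in R_+^|V|.\<close>
definition flow_solution :: "geom \<Rightarrow> 'v set set \<Rightarrow> ('v set \<Rightarrow> real) \<Rightarrow> ('v \<Rightarrow> real)
    \<Rightarrow> ('v \<Rightarrow> real) \<Rightarrow> (real \<Rightarrow> 'v \<Rightarrow> real) \<Rightarrow> bool" where
  "flow_solution G T \<Theta> k r0 r \<longleftrightarrow>
     (\<forall>v\<in>verts T. r 0 v = r0 v) \<and>
     (\<forall>t\<ge>0. \<forall>v\<in>verts T. r t v > 0 \<and>
        ((\<lambda>s. r s v) has_real_derivative ((k v - curv G T \<Theta> (r t) v) * flow_factor G (r t v)))
          (at t within {0..}))"

definition flow_converges :: "'v set set \<Rightarrow> (real \<Rightarrow> 'v \<Rightarrow> real) \<Rightarrow> bool" where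
  "flow_converges T r \<longleftrightarrow> (\<exists>rs. (\<forall>v\<in>verts T. rs v > 0 \<and> ((\<lambda>t. r t v) \<longlongrightarrow> rs v) at_top))"

text \<open>The radii give a genuine cone metric: every face is realized by a nondegenerate
triangle of the background geometry (strict triangle inequalities for the side lengths).\<close>
definition realizable :: "geom \<Rightarrow> 'v set set \<Rightarrow> ('v set \<Rightarrow> real) \<Rightarrow> ('v \<Rightarrow> real) \<Rightarrow> bool" where
  "realizable G T \<Theta> r \<longleftrightarrow> (\<forall>a b c. {a, b, c} \<in> T \<and> card {a, b, c} = 3 \<longrightarrow>
      edge_len G \<Theta> r a b < edge_len G \<Theta> r a c + edge_len G \<Theta> r b c)"

text \<open>Circle pattern: circles centered at a, b of radii r a, r b, at distance edge_len,
meet with exterior intersection angle \<Theta>{a,b} (law of cosines in the geometry).\<close>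
definition circle_pattern :: "geom \<Rightarrow> 'v set set \<Rightarrow> ('v set \<Rightarrow> real) \<Rightarrow> ('v \<Rightarrow> real) \<Rightarrow> bool" where
  "circle_pattern G T \<Theta> r \<longleftrightarrow> (\<forall>e\<in>edges T. \<forall>a b. e = {a, b} \<longrightarrow>
     (let l = edge_len G \<Theta> r a b in case G of
        Hyp \<Rightarrow> cosh l = cosh (r a) * cosh (r b) + sinh (r a) * sinh (r b) * cos (\<Theta> e)
      | Euc \<Rightarrow> l\<^sup>2 = (r a)\<^sup>2 + (r b)\<^sup>2 + 2 * r a * r b * cos (\<Theta> e)))"

end

theory Submission
  imports Defs "HOL-Probability.Discrete_Topology"
begin

text \<open>In the coordinates \<open>u = ln r\<close> (Euclidean) or \<open>u = ln (tanh (r / 2))\<close> (hyperbolic) the flow reads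
  \<open>u' = F u\<close> with \<open>F = k - K\<close>. Condition (C1) makes the angle derivatives \<open>\<partial>\<theta>\<^sub>i / \<partial>u\<^sub>j\<close> of a triangle symmetric
  and nonnegative for \<open>i \<noteq> j\<close>, with
  \<open>\<partial>\<theta>\<^sub>i / \<partial>u\<^sub>i = - cosh l\<^sub>i\<^sub>j \<partial>\<theta>\<^sub>i / \<partial>u\<^sub>j - cosh l\<^sub>i\<^sub>k \<partial>\<theta>\<^sub>i / \<partial>u\<^sub>k\<close> (\<open>cosh l\<close> being replaced by \<open>1\<close> in
  the Euclidean case). Hence \<open>F\<close> is dissipative for the Euclidean scalar product, strictly so on compact
  sets of hyperbolic radii and modulo constants for Euclidean radii. Two solutions therefore never move
  apart, which gives uniqueness, and a bounded solution approaches its own time translates at an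
  exponential rate, hence converges to a zero of \<open>F\<close>.

  As the radii of the vertices in \<open>A\<close> shrink relative to the others, the total angle at \<open>A\<close> tends to the
  combinatorial bound in the definition of attainability, and it stays below that bound for positive
  radii. The second statement shows that attainability is necessary. By the first one
  \<open>\<Sum>v\<in>A. u v\<close> grows whenever the values of \<open>u\<close> on \<open>A\<close> are much smaller than the other ones, and this
  keeps \<open>u\<close> bounded from below. From above \<open>u\<close> is bounded because the angle at the center of a large
  hyperbolic circle is small, respectively because \<open>\<Sum>v. u v\<close> is constant.\<close>


section \<open>Angles in the Klein model\<close>

text \<open>No potential for \<open>F\<close> is formed. The symmetry of the angle derivatives
  enters only through the sign of a quadratic form along segments, so mean value arguments in one
  variable replace convexity. Hyperbolic tangents of the radii are used because the law of cosines,
  with hyperbolic cosines factored out, becomes polynomial in them; \<open>\<kappa>\<close> then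
  covers both geometries with one set of identities, and \<open>X = 0\<close> and
  \<open>X = 1\<close> become points up to which the angle is continuous. (C1) lets a single edge
  weight vanish, namely at an edge with \<Theta> = 0 whose two neighbours in the triangle have
  supplementary values. Compactness can therefore bound only the sum of the two weights meeting at a
  corner, and coercivity is built on such sums. A further obstacle is that the field is controlled
  only on compact boxes inside its domain: existence clamps it to a box and shows that the clamp is
  inactive up to a prescribed time. For the lower bound no single coordinate can be followed, since
  only sums over vertex sets are known to grow; all subsets are watched at once, with weights
  depending on their cardinality.\<close>

text \<open>The numbers \<open>X\<close>, \<open>Y\<close>, \<open>Z\<close> stand for the hyperbolic tangents of the radii at the three vertices
  (\<open>\<kappa> = 1\<close>) or for the radii themselves (\<open>\<kappa> = 0\<close>), and \<open>a\<close>, \<open>b\<close>, \<open>c\<close> for the cosines of the exterior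
  intersection angles along the opposite edges. For \<open>X = tanh x\<close>, \<open>Y = tanh y\<close>, \<open>Z = tanh z\<close> the law of
  cosines at the first vertex has numerator \<open>cosh x\<^sup>2 cosh y cosh z qnum\<close>, the first edge satisfies
  \<open>sinh l\<^sup>2 = cosh x\<^sup>2 cosh y\<^sup>2 qlen\<close>, and \<open>(1 - \<kappa> X\<^sup>2) disc\<close> is the resulting discriminant. All these
  are polynomials, and (C1) makes the coefficients of \<open>wt\<close> and \<open>disc\<close> nonnegative.\<close>

definition qlen :: "real \<Rightarrow> real \<Rightarrow> real \<Rightarrow> real \<Rightarrow> real" where
  "qlen \<kappa> c X Y = X\<^sup>2 + Y\<^sup>2 + 2 * X * Y * c - \<kappa> * X\<^sup>2 * Y\<^sup>2 * (1 - c\<^sup>2)"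

definition qnum :: "real \<Rightarrow> real \<Rightarrow> real \<Rightarrow> real \<Rightarrow> real \<Rightarrow> real \<Rightarrow> real \<Rightarrow> real" where
  "qnum \<kappa> a b c X Y Z = X\<^sup>2 + X * Z * b + X * Y * c - Y * Z * a + \<kappa> * X\<^sup>2 * Y * Z * (a + b * c)"

definition wt :: "real \<Rightarrow> real \<Rightarrow> real \<Rightarrow> real \<Rightarrow> real \<Rightarrow> real \<Rightarrow> real" where
  "wt a b c X Y Z = X * Y * (X * Y * (1 - c\<^sup>2) + X * Z * (a + b * c) + Y * Z * (b + a * c))"

definition disc :: "real \<Rightarrow> real \<Rightarrow> real \<Rightarrow> real \<Rightarrow> real \<Rightarrow> real \<Rightarrow> real \<Rightarrow> real" where
  "disc \<kappa> a b c X Y Z = X\<^sup>2 * Y\<^sup>2 * (1 - c\<^sup>2) + X\<^sup>2 * Z\<^sup>2 * (1 - b\<^sup>2) + Y\<^sup>2 * Z\<^sup>2 * (1 - a\<^sup>2)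
     + 2 * X * Y * Z * (X * (a + b * c) + Y * (b + a * c) + Z * (c + a * b))
     - \<kappa> * X\<^sup>2 * Y\<^sup>2 * Z\<^sup>2 * (1 - a\<^sup>2 - b\<^sup>2 - c\<^sup>2 - 2 * a * b * c)"

definition ang :: "real \<Rightarrow> real \<Rightarrow> real \<Rightarrow> real \<Rightarrow> real \<Rightarrow> real \<Rightarrow> real \<Rightarrow> real" where
  "ang \<kappa> a b c X Y Z = arccos (qnum \<kappa> a b c X Y Z / sqrt (qlen \<kappa> c X Y * qlen \<kappa> b X Z))"

text \<open>The strict \<open>-1 < a\<close> encodes \<open>\<Theta> < pi\<close>; the value
  \<open>a = 1\<close> is tangency of the two circles and stays allowed.\<close>

definition C1t :: "real \<Rightarrow> real \<Rightarrow> real \<Rightarrow> bool" where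
  "C1t a b c \<longleftrightarrow> -1 < a \<and> a \<le> 1 \<and> -1 < b \<and> b \<le> 1 \<and> -1 < c \<and> c \<le> 1
     \<and> 0 \<le> a + b * c \<and> 0 \<le> b + a * c \<and> 0 \<le> c + a * b"

definition kdom :: "real \<Rightarrow> real \<Rightarrow> bool" where
  "kdom \<kappa> X \<longleftrightarrow> 0 < X \<and> 0 \<le> \<kappa> \<and> \<kappa> * X\<^sup>2 < 1"

section \<open>Signs of the polynomials under (C1)\<close>

lemma C1t_perms: "C1t a b c \<Longrightarrow> C1t a c b" "C1t a b c \<Longrightarrow> C1t b a c" "C1t a b c \<Longrightarrow> C1t c a b"
  by (auto simp: C1t_def mult.commute)

lemma qlen_commute: "qlen \<kappa> c X Y = qlen \<kappa> c Y X"
  by (simp add: qlen_def algebra_simps)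

lemma wt_commute: "wt a b c X Y Z = wt b a c Y X Z"
  by (simp add: wt_def algebra_simps)

lemma disc_perms: "disc \<kappa> a b c X Y Z = disc \<kappa> a c b X Z Y"
  "disc \<kappa> b a c Y X Z = disc \<kappa> a b c X Y Z" "disc \<kappa> c a b Z X Y = disc \<kappa> a b c X Y Z"
  by (simp_all add: disc_def algebra_simps)

lemma ang_commute: "ang \<kappa> a b c X Y Z = ang \<kappa> a c b X Z Y"
proof -
  have "qnum \<kappa> a b c X Y Z = qnum \<kappa> a c b X Z Y" by (simp add: qnum_def algebra_simps)
  then show ?thesis by (simp add: ang_def mult.commute)
qed

text \<open>This is \<open>1 - cos^2 = sin^2\<close> for the angle with cosine
  \<open>qnum / sqrt (qlen * qlen)\<close>: up to positive factors \<open>disc\<close> is its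
  squared sine. Nonnegativity of \<open>disc\<close> thus plays the role of the triangle
  inequality.\<close>

lemma qlen_qnum_disc:
  "qlen \<kappa> c X Y * qlen \<kappa> b X Z - (qnum \<kappa> a b c X Y Z)\<^sup>2 = (1 - \<kappa> * X\<^sup>2) * disc \<kappa> a b c X Y Z"
  unfolding qlen_def qnum_def disc_def by algebra

text \<open>For positive \<open>Y\<close>, completing the square leaves a second summand that is
  positive when \<open>c < 1\<close>, and the square itself is positive when \<open>c = 1\<close>.
  One variable may be 0 because the angle is later followed down to a vanishing radius.\<close>

lemma qlen_pos:
  assumes "0 \<le> X" "0 \<le> Y" "0 < X \<or> 0 < Y" "\<kappa> * X\<^sup>2 < 1" "-1 < c" "c \<le> 1"
  shows "0 < qlen \<kappa> c X Y"
proof (cases "0 < Y")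
  case True
  have eq: "qlen \<kappa> c X Y = (X + Y * c)\<^sup>2 + Y\<^sup>2 * (1 - c\<^sup>2) * (1 - \<kappa> * X\<^sup>2)"
    unfolding qlen_def by algebra
  show ?thesis
  proof (cases "c = 1")
    case True
    then have "0 < X + Y * c" using \<open>0 < Y\<close> assms by simp
    with True show ?thesis unfolding eq by simp
  next
    case False
    then have "c\<^sup>2 < 1" using assms by (simp add: abs_square_less_1 abs_less_iff)
    then have "0 < Y\<^sup>2 * (1 - c\<^sup>2) * (1 - \<kappa> * X\<^sup>2)" using assms \<open>0 < Y\<close> by simp
    then show ?thesis unfolding eq by (smt (verit) zero_le_power2)
  qed
next
  case False
  then show ?thesis using assms by (simp add: qlen_def)
qed

text \<open>The summand of \<open>disc\<close> with \<open>\<kappa>\<close> has no definite sign.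
  Absorbing parts of it into the three squares leaves the coefficient
  \<open>2 + 2 * (a * b * c)\<close>, so that under (C1) every summand is nonnegative.\<close>

lemma disc_expand:
  "disc \<kappa> a b c X Y Z = X\<^sup>2 * Y\<^sup>2 * (1 - c\<^sup>2) * (1 - \<kappa> * Z\<^sup>2)
     + X\<^sup>2 * Z\<^sup>2 * (1 - b\<^sup>2) * (1 - \<kappa> * Y\<^sup>2) + Y\<^sup>2 * Z\<^sup>2 * (1 - a\<^sup>2) * (1 - \<kappa> * X\<^sup>2)
     + 2 * X * Y * Z * (X * (a + b * c) + Y * (b + a * c) + Z * (c + a * b))
     + \<kappa> * X\<^sup>2 * Y\<^sup>2 * Z\<^sup>2 * (2 + 2 * (a * b * c))"
  unfolding disc_def by algebra

lemma C1t_sq_le: assumes "C1t a b c" shows "a\<^sup>2 \<le> 1" "b\<^sup>2 \<le> 1" "c\<^sup>2 \<le> 1"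
  using assms unfolding C1t_def by (simp_all add: abs_square_le_1 abs_le_iff)

lemma disc_terms_nonneg:
  assumes "C1t a b c" "0 \<le> \<kappa>" "0 \<le> X" "0 \<le> Y" "0 \<le> Z" "\<kappa> * X\<^sup>2 \<le> 1" "\<kappa> * Y\<^sup>2 \<le> 1" "\<kappa> * Z\<^sup>2 \<le> 1"
  shows "0 \<le> X\<^sup>2 * Y\<^sup>2 * (1 - c\<^sup>2) * (1 - \<kappa> * Z\<^sup>2)"
    "0 \<le> X\<^sup>2 * Z\<^sup>2 * (1 - b\<^sup>2) * (1 - \<kappa> * Y\<^sup>2)" "0 \<le> Y\<^sup>2 * Z\<^sup>2 * (1 - a\<^sup>2) * (1 - \<kappa> * X\<^sup>2)"
    "0 \<le> 2 * X * Y * Z * (X * (a + b * c) + Y * (b + a * c) + Z * (c + a * b))"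
    "0 \<le> \<kappa> * X\<^sup>2 * Y\<^sup>2 * Z\<^sup>2 * (2 + 2 * (a * b * c))"
proof -
  have C1': "0 \<le> a + b * c" "0 \<le> b + a * c" "0 \<le> c + a * b"
    using assms(1) by (auto simp: C1t_def)
  note sq = C1t_sq_le[OF assms(1)]
  have "\<bar>a * b * c\<bar> \<le> 1" using sq by (simp add: abs_mult mult_le_one abs_square_le_1)
  then show "0 \<le> \<kappa> * X\<^sup>2 * Y\<^sup>2 * Z\<^sup>2 * (2 + 2 * (a * b * c))"
    using assms(2) by (intro mult_nonneg_nonneg) auto
  show "0 \<le> X\<^sup>2 * Y\<^sup>2 * (1 - c\<^sup>2) * (1 - \<kappa> * Z\<^sup>2)"
    "0 \<le> X\<^sup>2 * Z\<^sup>2 * (1 - b\<^sup>2) * (1 - \<kappa> * Y\<^sup>2)" "0 \<le> Y\<^sup>2 * Z\<^sup>2 * (1 - a\<^sup>2) * (1 - \<kappa> * X\<^sup>2)"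
    using assms sq by auto
  show "0 \<le> 2 * X * Y * Z * (X * (a + b * c) + Y * (b + a * c) + Z * (c + a * b))"
    using assms C1' by simp
qed

lemma disc_nonneg:
  assumes "C1t a b c" "0 \<le> \<kappa>" "0 \<le> X" "0 \<le> Y" "0 \<le> Z" "\<kappa> * X\<^sup>2 \<le> 1" "\<kappa> * Y\<^sup>2 \<le> 1" "\<kappa> * Z\<^sup>2 \<le> 1"
  shows "0 \<le> disc \<kappa> a b c X Y Z"
  unfolding disc_expand using disc_terms_nonneg[OF assms] by linarith

text \<open>A cosine \<open>b\<close> or \<open>c\<close> below 1 makes one of the square summands
  positive; if both are 1, the coefficient \<open>c + a * b = 1 + a\<close> is positive.\<close>

lemma disc_pos:
  assumes "C1t a b c" "kdom \<kappa> X" "kdom \<kappa> Y" "kdom \<kappa> Z"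
  shows "0 < disc \<kappa> a b c X Y Z"
proof -
  have pos: "0 < X" "0 < Y" "0 < Z" using assms by (auto simp: kdom_def)
  have C1': "0 \<le> a + b * c" "0 \<le> b + a * c" "0 \<le> c + a * b"
    using assms(1) by (auto simp: C1t_def)
  have "0 \<le> \<kappa>" "0 \<le> X" "0 \<le> Y" "0 \<le> Z" "\<kappa> * X\<^sup>2 \<le> 1" "\<kappa> * Y\<^sup>2 \<le> 1" "\<kappa> * Z\<^sup>2 \<le> 1"
    using assms by (auto simp: kdom_def)
  note t = disc_terms_nonneg[OF assms(1) this]
  show ?thesis
  proof (cases "c = 1")
    case False
    then have "c\<^sup>2 < 1" using assms(1) by (simp add: C1t_def abs_square_less_1 abs_less_iff)
    then have "0 < X\<^sup>2 * Y\<^sup>2 * (1 - c\<^sup>2) * (1 - \<kappa> * Z\<^sup>2)" using assms pos by (simp add: kdom_def)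
    then show ?thesis unfolding disc_expand using t by linarith
  next
    case c: True
    show ?thesis
    proof (cases "b = 1")
      case False
      then have "b\<^sup>2 < 1" using assms(1) by (simp add: C1t_def abs_square_less_1 abs_less_iff)
      then have "0 < X\<^sup>2 * Z\<^sup>2 * (1 - b\<^sup>2) * (1 - \<kappa> * Y\<^sup>2)" using assms pos by (simp add: kdom_def)
      then show ?thesis unfolding disc_expand using t by linarith
    next
      case True
      then have ab: "0 < c + a * b" using c assms(1) by (simp add: C1t_def)
      have "0 \<le> X * (a + b * c)" "0 \<le> Y * (b + a * c)" "0 < Z * (c + a * b)" using pos C1' ab by auto
      then have "0 < X * (a + b * c) + Y * (b + a * c) + Z * (c + a * b)" by linarith
      then have "0 < 2 * X * Y * Z * (X * (a + b * c) + Y * (b + a * c) + Z * (c + a * b))"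
        using pos by simp
      then show ?thesis unfolding disc_expand using t by linarith
    qed
  qed
qed

lemma wt_nonneg:
  assumes "C1t a b c" "0 \<le> X" "0 \<le> Y" "0 \<le> Z"
  shows "0 \<le> wt a b c X Y Z"
proof -
  have "c\<^sup>2 \<le> 1" using assms(1) unfolding C1t_def by (simp add: abs_square_le_1 abs_le_iff)
  moreover have "0 \<le> a + b * c" "0 \<le> b + a * c" using assms(1) by (auto simp: C1t_def)
  ultimately show ?thesis unfolding wt_def using assms(2-4) by simp
qed

text \<open>\<open>wt a b c X Y Z = 0\<close> forces \<open>c = 1\<close> and \<open>a = - b\<close>, which cannot happen at two edges at once.\<close>

lemma wt_pos_or:
  assumes "C1t a b c" "0 < X" "0 < Y" "0 < Z"
  shows "0 < wt a b c X Y Z \<or> 0 < wt a c b X Z Y"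
proof -
  have key: "c = 1 \<and> a + b = 0" if "\<not> 0 < wt a b c X Y Z" "C1t a b c" "0 < X" "0 < Y" "0 < Z"
    for a b c X Y Z
  proof -
    have sq: "c\<^sup>2 \<le> 1" using that(2) unfolding C1t_def by (simp add: abs_square_le_1 abs_le_iff)
    have n: "0 \<le> X * Y * (1 - c\<^sup>2)" "0 \<le> X * Z * (a + b * c)" "0 \<le> Y * Z * (b + a * c)"
      using that sq by (auto simp: C1t_def)
    have "X * Y * (1 - c\<^sup>2) + X * Z * (a + b * c) + Y * Z * (b + a * c) \<le> 0"
      using that unfolding wt_def by (smt (verit) mult_pos_pos)
    then have z: "X * Y * (1 - c\<^sup>2) = 0" "X * Z * (a + b * c) = 0" using n by linarith+
    then have "c\<^sup>2 = 1" using that by simp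
    then have "c = 1" using that by (auto simp: C1t_def power2_eq_1_iff)
    then show ?thesis using z that by auto
  qed
  show ?thesis
  proof (rule ccontr)
    assume "\<not> ?thesis"
    then have "c = 1 \<and> a + b = 0" "b = 1 \<and> a + c = 0"
      using key[of a b c X Y Z] key[of a c b X Z Y] assms C1t_perms(1)[OF assms(1)] by auto
    then show False using assms(1) by (auto simp: C1t_def)
  qed
qed

section \<open>Derivatives of the angles\<close>

text \<open>This is the hyperbolic cosine of the edge length: the law of cosines with
  \<open>cosh x * cosh y\<close> factored out, where \<open>wx\<close> and \<open>wy\<close> stand
  for \<open>1 / cosh x\<close> and \<open>1 / cosh y\<close>. With \<open>\<kappa> = 0\<close> and
  both factors 1 it is the constant 1.\<close>

definition hlen :: "real \<Rightarrow> real \<Rightarrow> real \<Rightarrow> real \<Rightarrow> real \<Rightarrow> real \<Rightarrow> real" where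
  "hlen \<kappa> c X Y wx wy = (1 + \<kappa> * X * Y * c) / (wx * wy)"

text \<open>By \<open>ang_deriv\<close> this is the derivative of the angle at the first vertex in
  the logarithmic coordinate of the second one. Exchanging the two vertices preserves every factor,
  which is the symmetry of the derivative matrix.\<close>

definition mwt :: "real \<Rightarrow> real \<Rightarrow> real \<Rightarrow> real \<Rightarrow> real \<Rightarrow> real \<Rightarrow> real \<Rightarrow> real \<Rightarrow> real \<Rightarrow> real" where
  "mwt \<kappa> a b c X Y Z wx wy = wx * wy * wt a b c X Y Z / (qlen \<kappa> c X Y * sqrt (disc \<kappa> a b c X Y Z))"

text \<open>The factors under the root enter only through their logarithmic derivatives
  \<open>l1 / l s\<close> and \<open>l2 / l' s\<close>, so the contribution of each radius can be
  collected separately.\<close>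

lemma arccos_quot_deriv:
  fixes n l l' :: "real \<Rightarrow> real"
  assumes "(n has_real_derivative n') (at s)" "(l has_real_derivative l1) (at s)"
    "(l' has_real_derivative l2) (at s)" "0 < l s" "0 < l' s" "0 < l s * l' s - (n s)\<^sup>2"
  shows "((\<lambda>s. arccos (n s / sqrt (l s * l' s))) has_real_derivative
    - (n' - n s / 2 * (l1 / l s + l2 / l' s)) / sqrt (l s * l' s - (n s)\<^sup>2)) (at s)"
proof -
  define R where "R = sqrt (l s * l' s)"
  have R: "R > 0" "R\<^sup>2 = l s * l' s" using assms by (auto simp: R_def)
  have nR: "\<bar>n s\<bar> < R" using assms(6) real_sqrt_less_mono[of "(n s)\<^sup>2" "l s * l' s"] by (simp add: R_def)
  have q: "-1 < n s / R" "n s / R < 1" using nR R by (auto simp: field_simps)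
  have "((\<lambda>s. l s * l' s) has_real_derivative (l1 * l' s + l2 * l s)) (at s)"
    using DERIV_mult[OF assms(2,3)] by simp
  from DERIV_chain2[OF DERIV_real_sqrt this]
  have dR: "((\<lambda>s. sqrt (l s * l' s)) has_real_derivative inverse R / 2 * (l1 * l' s + l2 * l s)) (at s)"
    using assms by (simp add: R_def)
  have "((\<lambda>s. n s / sqrt (l s * l' s)) has_real_derivative
      (n' * R - n s * (inverse R / 2 * (l1 * l' s + l2 * l s))) / (R * R)) (at s)"
    using DERIV_divide[OF assms(1) dR] R(1) unfolding R_def by (metis less_irrefl)
  also have "(n' * R - n s * (inverse R / 2 * (l1 * l' s + l2 * l s))) / (R * R)
      = (n' - n s / 2 * ((l1 * l' s + l2 * l s) / R\<^sup>2)) / R"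
    using R(1) by (simp add: field_simps power2_eq_square)
  also have "(l1 * l' s + l2 * l s) / R\<^sup>2 = l1 / l s + l2 / l' s"
    unfolding R(2) using assms(4,5) by (simp add: field_simps)
  finally have dq: "((\<lambda>s. n s / sqrt (l s * l' s)) has_real_derivative
      (n' - n s / 2 * (l1 / l s + l2 / l' s)) / R) (at s)" .
  have "sqrt (1 - (n s / R)\<^sup>2) = sqrt (l s * l' s - (n s)\<^sup>2) / R"
  proof -
    have "1 - (n s / R)\<^sup>2 = (l s * l' s - (n s)\<^sup>2) / R\<^sup>2"
      using assms(4,5) by (simp add: power_divide R(2) diff_divide_distrib)
    then show ?thesis using R(1) by (simp add: real_sqrt_divide)
  qed
  moreover have "((\<lambda>s. arccos (n s / sqrt (l s * l' s))) has_real_derivative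
     inverse (- sqrt (1 - (n s / R)\<^sup>2)) * ((n' - n s / 2 * (l1 / l s + l2 / l' s)) / R)) (at s)"
    by (rule DERIV_chain2[OF _ dq]) (use DERIV_arccos[OF q] in \<open>simp add: R_def\<close>)
  moreover have "inverse (- (W / R)) * (K / R) = - K / W" for W K
    using R(1) by (cases "W = 0") (simp_all add: field_simps)
  ultimately show ?thesis by (simp only:)
qed

text \<open>The left side is the numerator of the derivative of the cosine in \<open>Y\<close>, with
  the length cleared and a factor \<open>Y\<close> from the logarithmic scale. The factor
  \<open>1 - \<kappa> * X\<^sup>2\<close> on the right also occurs in the squared sine by
  \<open>qlen_qnum_disc\<close>; the quotient by the sine leaves its square root.\<close>

lemma ang_deriv_identity_off:
  "qlen \<kappa> c X Y * (X * c - Z * a + \<kappa> * X\<^sup>2 * Z * (a + b * c)) * Y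
     - qnum \<kappa> a b c X Y Z * (Y + X * c - \<kappa> * X\<^sup>2 * Y * (1 - c\<^sup>2)) * Y
   = - (1 - \<kappa> * X\<^sup>2) * wt a b c X Y Z"
  unfolding qlen_def qnum_def wt_def by algebra

text \<open>Not expanded but deduced from the two off-diagonal identities: the angle is constant
  along the vector field \<open>k X d/dX + hc Y d/dY + hb Z d/dZ\<close>, which takes the place of
  scaling. This determines the derivative in \<open>X\<close> from the other two.\<close>

lemma ang_deriv_identity_diag:
  assumes "\<kappa> * X\<^sup>2 \<noteq> 1"
  shows "X * (2 * X + Z * b + Y * c + 2 * \<kappa> * X * Y * Z * (a + b * c)) * (qlen \<kappa> c X Y * qlen \<kappa> b X Z)
     - qnum \<kappa> a b c X Y Z * (X * (X + Y * c - \<kappa> * X * Y\<^sup>2 * (1 - c\<^sup>2)) * qlen \<kappa> b X Z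
        + X * (X + Z * b - \<kappa> * X * Z\<^sup>2 * (1 - b\<^sup>2)) * qlen \<kappa> c X Y)
   = (1 + \<kappa> * X * Y * c) * wt a b c X Y Z * qlen \<kappa> b X Z
     + (1 + \<kappa> * X * Z * b) * wt a c b X Z Y * qlen \<kappa> c X Y"
proof -
  define n Lc Lb k where defs: "n = qnum \<kappa> a b c X Y Z" "Lc = qlen \<kappa> c X Y" "Lb = qlen \<kappa> b X Z"
    "k = 1 - \<kappa> * X\<^sup>2"
  define hc hb where h: "hc = 1 + \<kappa> * X * Y * c" "hb = 1 + \<kappa> * X * Z * b"
  define nX mY mZ where m: "nX = X * (2 * X + Z * b + Y * c + 2 * \<kappa> * X * Y * Z * (a + b * c))"
    "mY = (X * c - Z * a + \<kappa> * X\<^sup>2 * Z * (a + b * c)) * Y"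
    "mZ = (X * b - Y * a + \<kappa> * X\<^sup>2 * Y * (a + c * b)) * Z"
  define pY pZ pXc pXb where p: "pY = (Y + X * c - \<kappa> * X\<^sup>2 * Y * (1 - c\<^sup>2)) * Y"
    "pZ = (Z + X * b - \<kappa> * X\<^sup>2 * Z * (1 - b\<^sup>2)) * Z"
    "pXc = X * (X + Y * c - \<kappa> * X * Y\<^sup>2 * (1 - c\<^sup>2))"
    "pXb = X * (X + Z * b - \<kappa> * X * Z\<^sup>2 * (1 - b\<^sup>2))"
  define wc wb where w: "wc = wt a b c X Y Z" "wb = wt a c b X Z Y"
  have offc: "Lc * mY - n * pY = - k * wc"
    using ang_deriv_identity_off[of \<kappa> c X Y Z a b] by (simp add: defs m p w mult.assoc)
  have n': "n = qnum \<kappa> a c b X Z Y" by (simp add: defs qnum_def algebra_simps)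
  have offb: "Lb * mZ - n * pZ = - k * wb"
    using ang_deriv_identity_off[of \<kappa> b X Z Y a c] by (simp add: n' defs(2,3,4) m p w mult.assoc)
  \<comment> \<open>\<open>gc\<close>, \<open>gb\<close> and \<open>e\<close> say that the field
    multiplies the two lengths and the numerator by factors that cancel in the cosine. For
    \<open>\<kappa> = 0\<close> they are Euler's identities for homogeneous quadratics.\<close>
  have gc: "hc * pY + k * pXc = Lc * (1 + \<kappa> * (X * Y * c - X\<^sup>2))"
    unfolding defs h p qlen_def by algebra
  have gb: "hb * pZ + k * pXb = Lb * (1 + \<kappa> * (X * Z * b - X\<^sup>2))"
    unfolding defs h p qlen_def by algebra
  have e: "k * nX + hc * mY + hb * mZ = n * (2 + \<kappa> * (X * Y * c - X\<^sup>2) + \<kappa> * (X * Z * b - X\<^sup>2))"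
    unfolding defs h m qnum_def by algebra
  define tc tb where t: "tc = \<kappa> * (X * Y * c - X\<^sup>2)" "tb = \<kappa> * (X * Z * b - X\<^sup>2)"
  have "k * (nX * (Lc * Lb) - n * (pXc * Lb + pXb * Lc)) = k * (hc * wc * Lb + hb * wb * Lc)"
    using offc offb gc gb e unfolding t[symmetric] by algebra
  moreover have "k \<noteq> 0" using assms by (simp add: defs)
  ultimately show ?thesis by (simp add: defs h m p w)
qed

text \<open>The velocities have the form \<open>X s * wx * p\<close> because \<open>X * wx\<close>
  is the derivative of \<open>X\<close> in its logarithmic coordinate. So \<open>p\<close>,
  \<open>q\<close>, \<open>r\<close> are the velocities of the logarithmic coordinates, and this
  normalization is what makes the coefficients \<open>mwt\<close> symmetric.\<close>

lemma ang_deriv: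
  fixes X Y Z :: "real \<Rightarrow> real"
  assumes C: "C1t a b c" and dom: "kdom \<kappa> (X s)" "kdom \<kappa> (Y s)" "kdom \<kappa> (Z s)"
    and w: "0 < wx" "wx\<^sup>2 = 1 - \<kappa> * (X s)\<^sup>2" "0 < wy" "0 < wz"
    and dX: "(X has_real_derivative X s * wx * p) (at s)"
    and dY: "(Y has_real_derivative Y s * wy * q) (at s)"
    and dZ: "(Z has_real_derivative Z s * wz * r) (at s)"
  shows "((\<lambda>s. ang \<kappa> a b c (X s) (Y s) (Z s)) has_real_derivative
     mwt \<kappa> a b c (X s) (Y s) (Z s) wx wy * (q - hlen \<kappa> c (X s) (Y s) wx wy * p)
     + mwt \<kappa> a c b (X s) (Z s) (Y s) wx wz * (r - hlen \<kappa> b (X s) (Z s) wx wz * p)) (at s)"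
proof -
  define x y z where xyz: "x = X s" "y = Y s" "z = Z s"
  have pos: "0 < x" "0 < y" "0 < z" "\<kappa> * x\<^sup>2 < 1" "\<kappa> * y\<^sup>2 < 1" "\<kappa> * z\<^sup>2 < 1"
    using dom by (auto simp: kdom_def xyz)
  define Lc Lb n d where defs: "Lc = qlen \<kappa> c x y" "Lb = qlen \<kappa> b x z" "n = qnum \<kappa> a b c x y z"
    "d = disc \<kappa> a b c x y z"
  define wc wb where wcb: "wc = wt a b c x y z" "wb = wt a c b x z y"
  have Lpos: "0 < Lc" "0 < Lb" unfolding defs using pos C by (auto simp: C1t_def intro!: qlen_pos)
  have dpos: "0 < d" using disc_pos[OF C dom] by (simp add: defs xyz)
  have DD: "Lc * Lb - n\<^sup>2 = wx\<^sup>2 * d" unfolding defs w(2) using qlen_qnum_disc by (simp add: xyz)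
  define nX nY nZ where nxyz: "nX = 2 * x + z * b + y * c + 2 * \<kappa> * x * y * z * (a + b * c)"
    "nY = x * c - z * a + \<kappa> * x\<^sup>2 * z * (a + b * c)"
    "nZ = x * b - y * a + \<kappa> * x\<^sup>2 * y * (a + c * b)"
  define pX pY qX qZ where pq: "pX = x + y * c - \<kappa> * x * y\<^sup>2 * (1 - c\<^sup>2)" "pY = y + x * c - \<kappa> * x\<^sup>2 * y * (1 - c\<^sup>2)"
    "qX = x + z * b - \<kappa> * x * z\<^sup>2 * (1 - b\<^sup>2)" "qZ = z + x * b - \<kappa> * x\<^sup>2 * z * (1 - b\<^sup>2)"
  have dn: "((\<lambda>s. qnum \<kappa> a b c (X s) (Y s) (Z s)) has_real_derivative
      nX * (x * wx * p) + nY * (y * wy * q) + nZ * (z * wz * r)) (at s)"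
    unfolding qnum_def
    by (rule derivative_eq_intros dX dY dZ refl)+ (simp add: nxyz xyz algebra_simps power2_eq_square)
  have dLc: "((\<lambda>s. qlen \<kappa> c (X s) (Y s)) has_real_derivative 2 * (pX * (x * wx * p) + pY * (y * wy * q))) (at s)"
    unfolding qlen_def
    by (rule derivative_eq_intros dX dY dZ refl)+ (simp add: pq xyz algebra_simps power2_eq_square)
  have dLb: "((\<lambda>s. qlen \<kappa> b (X s) (Z s)) has_real_derivative 2 * (qX * (x * wx * p) + qZ * (z * wz * r))) (at s)"
    unfolding qlen_def
    by (rule derivative_eq_intros dX dY dZ refl)+ (simp add: pq xyz algebra_simps power2_eq_square)
  have base: "((\<lambda>s. ang \<kappa> a b c (X s) (Y s) (Z s)) has_real_derivative
    - ((nX * (x * wx * p) + nY * (y * wy * q) + nZ * (z * wz * r)) - n / 2 *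
       (2 * (pX * (x * wx * p) + pY * (y * wy * q)) / Lc + 2 * (qX * (x * wx * p) + qZ * (z * wz * r)) / Lb))
      / sqrt (Lc * Lb - n\<^sup>2)) (at s)"
    unfolding ang_def defs xyz
    by (rule arccos_quot_deriv[OF dn[unfolded xyz] dLc[unfolded xyz] dLb[unfolded xyz]])
      (use Lpos dpos DD w pos in \<open>auto simp: defs xyz\<close>)
  have sq: "sqrt (Lc * Lb - n\<^sup>2) = wx * sqrt d" unfolding DD using w(1) by (simp add: real_sqrt_mult)
  have offc: "Lc * (nY * y) - n * (pY * y) = - wx\<^sup>2 * wc"
    using ang_deriv_identity_off[of \<kappa> c x y z a b] by (simp add: defs nxyz pq wcb w(2) xyz mult.assoc)
  have n': "n = qnum \<kappa> a c b x z y" by (simp add: defs qnum_def algebra_simps)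
  have offb: "Lb * (nZ * z) - n * (qZ * z) = - wx\<^sup>2 * wb"
    using ang_deriv_identity_off[of \<kappa> b x z y a c] by (simp add: n' defs(2) nxyz pq wcb w(2) xyz mult.assoc)
  have diag: "(x * nX) * (Lc * Lb) - n * (x * pX * Lb + x * qX * Lc)
     = (1 + \<kappa> * x * y * c) * wc * Lb + (1 + \<kappa> * x * z * b) * wb * Lc"
    unfolding defs nxyz pq wcb by (rule ang_deriv_identity_diag) (use pos in simp)
  have offc': "y * nY - n * y * pY / Lc = - wx\<^sup>2 * wc / Lc"
  proof -
    have "y * nY = (n * (pY * y) - wx\<^sup>2 * wc) / Lc" using offc Lpos by (simp add: eq_divide_eq algebra_simps)
    then show ?thesis by (simp add: diff_divide_distrib mult_ac)
  qed
  have offb': "z * nZ - n * z * qZ / Lb = - wx\<^sup>2 * wb / Lb"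
  proof -
    have "z * nZ = (n * (qZ * z) - wx\<^sup>2 * wb) / Lb" using offb Lpos by (simp add: eq_divide_eq algebra_simps)
    then show ?thesis by (simp add: diff_divide_distrib mult_ac)
  qed
  have diag': "x * nX - n * x * pX / Lc - n * x * qX / Lb
     = (1 + \<kappa> * x * y * c) * wc / Lc + (1 + \<kappa> * x * z * b) * wb / Lb"
    using diag Lpos by (simp add: field_simps)
  have "(nX * (x * wx * p) + nY * (y * wy * q) + nZ * (z * wz * r)) - n / 2 *
       (2 * (pX * (x * wx * p) + pY * (y * wy * q)) / Lc + 2 * (qX * (x * wx * p) + qZ * (z * wz * r)) / Lb)
     = wx * p * (x * nX - n * x * pX / Lc - n * x * qX / Lb)
      + wy * q * (y * nY - n * y * pY / Lc) + wz * r * (z * nZ - n * z * qZ / Lb)"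
    by (simp add: algebra_simps add_divide_distrib)
  also have "\<dots> = wx * (p * ((1 + \<kappa> * x * y * c) * wc / Lc + (1 + \<kappa> * x * z * b) * wb / Lb)
      - wx * wy * q * wc / Lc - wx * wz * r * wb / Lb)"
    unfolding offc' offb' diag' by (simp add: algebra_simps power2_eq_square)
  finally have num: "(nX * (x * wx * p) + nY * (y * wy * q) + nZ * (z * wz * r)) - n / 2 *
       (2 * (pX * (x * wx * p) + pY * (y * wy * q)) / Lc + 2 * (qX * (x * wx * p) + qZ * (z * wz * r)) / Lb)
     = wx * (p * ((1 + \<kappa> * x * y * c) * wc / Lc + (1 + \<kappa> * x * z * b) * wb / Lb)
      - wx * wy * q * wc / Lc - wx * wz * r * wb / Lb)" .
  have cancel: "- (wx * e) / (wx * sqrt d) = - e / sqrt d" for e using w(1) by simp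
  have "- ((nX * (x * wx * p) + nY * (y * wy * q) + nZ * (z * wz * r)) - n / 2 *
       (2 * (pX * (x * wx * p) + pY * (y * wy * q)) / Lc + 2 * (qX * (x * wx * p) + qZ * (z * wz * r)) / Lb))
      / sqrt (Lc * Lb - n\<^sup>2)
     = (wx * wy * q * wc / Lc + wx * wz * r * wb / Lb
        - p * ((1 + \<kappa> * x * y * c) * wc / Lc + (1 + \<kappa> * x * z * b) * wb / Lb)) / sqrt d"
    unfolding num sq cancel by (rule arg_cong[where f = "\<lambda>e. e / sqrt d"]) simp
  also have "\<dots> = wx * wy * wc / (Lc * sqrt d) * (q - hlen \<kappa> c x y wx wy * p)
     + wx * wz * wb / (Lb * sqrt d) * (r - hlen \<kappa> b x z wx wz * p)"
  proof -
    define A B where AB: "A = wc / (Lc * sqrt d)" "B = wb / (Lb * sqrt d)"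
    have h: "wx * wy * hlen \<kappa> c x y wx wy = 1 + \<kappa> * x * y * c" "wx * wz * hlen \<kappa> b x z wx wz = 1 + \<kappa> * x * z * b"
      using w by (simp_all add: hlen_def)
    have "(wx * wy * q * wc / Lc + wx * wz * r * wb / Lb
        - p * ((1 + \<kappa> * x * y * c) * wc / Lc + (1 + \<kappa> * x * z * b) * wb / Lb)) / sqrt d
       = A * (wx * wy * q - (1 + \<kappa> * x * y * c) * p) + B * (wx * wz * r - (1 + \<kappa> * x * z * b) * p)"
      unfolding AB by (simp add: algebra_simps diff_divide_distrib add_divide_distrib)
    also have "\<dots> = A * (wx * wy) * (q - hlen \<kappa> c x y wx wy * p) + B * (wx * wz) * (r - hlen \<kappa> b x z wx wz * p)"
      unfolding h[symmetric] by (simp add: algebra_simps)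
    finally show ?thesis by (simp add: AB mult_ac)
  qed
  finally show ?thesis using base
    by (simp add: mwt_def defs wcb xyz disc_perms(1)[of \<kappa> a c b])
qed

lemma continuous_on_qlen [continuous_intros]:
  "continuous_on S f \<Longrightarrow> continuous_on S g \<Longrightarrow> continuous_on S (\<lambda>x. qlen \<kappa> c (f x) (g x))"
  unfolding qlen_def by (intro continuous_intros)

lemma continuous_on_qnum [continuous_intros]:
  "continuous_on S f \<Longrightarrow> continuous_on S g \<Longrightarrow> continuous_on S h
    \<Longrightarrow> continuous_on S (\<lambda>x. qnum \<kappa> a b c (f x) (g x) (h x))"
  unfolding qnum_def by (intro continuous_intros)

lemma continuous_on_disc [continuous_intros]:
  "continuous_on S f \<Longrightarrow> continuous_on S g \<Longrightarrow> continuous_on S h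
    \<Longrightarrow> continuous_on S (\<lambda>x. disc \<kappa> a b c (f x) (g x) (h x))"
  unfolding disc_def by (intro continuous_intros)

lemma continuous_on_wt [continuous_intros]:
  "continuous_on S f \<Longrightarrow> continuous_on S g \<Longrightarrow> continuous_on S h
    \<Longrightarrow> continuous_on S (\<lambda>x. wt a b c (f x) (g x) (h x))"
  unfolding wt_def by (intro continuous_intros)

text \<open>The square of \<open>1 + \<kappa> * X * Y * c\<close> exceeds that of
  \<open>wx * wy\<close> by \<open>\<kappa> * qlen \<kappa> c X Y\<close>; this is
  \<open>cosh^2 - 1 = sinh^2\<close> for the edge length.\<close>

lemma hlen_ge_1:
  assumes "kdom \<kappa> X" "kdom \<kappa> Y" "0 < wx" "wx\<^sup>2 = 1 - \<kappa> * X\<^sup>2" "0 < wy" "wy\<^sup>2 = 1 - \<kappa> * Y\<^sup>2" "-1 < c" "c \<le> 1"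
  shows "1 \<le> hlen \<kappa> c X Y wx wy" "0 < \<kappa> \<Longrightarrow> 1 < hlen \<kappa> c X Y wx wy" "\<kappa> = 0 \<Longrightarrow> hlen \<kappa> c X Y wx wy = 1"
proof -
  have X: "0 < X" "0 < Y" "0 \<le> \<kappa>" "\<kappa> * X\<^sup>2 < 1" "\<kappa> * Y\<^sup>2 < 1" using assms by (auto simp: kdom_def)
  have "\<bar>\<kappa> * X * Y * c\<bar> \<le> \<kappa> * X * Y" using X assms(7,8)
    by (simp add: abs_mult mult_left_le abs_le_iff)
  moreover have "\<kappa> * X * Y < 1"
  proof -
    have "(\<kappa> * X * Y)\<^sup>2 = (\<kappa> * X\<^sup>2) * (\<kappa> * Y\<^sup>2)" by (simp add: power2_eq_square)
    also have "\<dots> < 1" using X mult_strict_mono[of "\<kappa> * X\<^sup>2" 1 "\<kappa> * Y\<^sup>2" 1] by simp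
    finally show ?thesis by (simp add: abs_square_less_1)
  qed
  ultimately have p: "0 < 1 + \<kappa> * X * Y * c" by linarith
  have id: "(1 + \<kappa> * X * Y * c)\<^sup>2 = (wx * wy)\<^sup>2 + \<kappa> * qlen \<kappa> c X Y"
    unfolding power_mult_distrib assms(4,6) qlen_def by algebra
  have q: "0 < qlen \<kappa> c X Y" using X assms by (intro qlen_pos) auto
  have "(wx * wy)\<^sup>2 \<le> (1 + \<kappa> * X * Y * c)\<^sup>2" unfolding id using q X by simp
  then have "wx * wy \<le> 1 + \<kappa> * X * Y * c" using p by (simp add: power2_le_iff_abs_le)
  then show "1 \<le> hlen \<kappa> c X Y wx wy" using assms(3,5) by (simp add: hlen_def)
  show "1 < hlen \<kappa> c X Y wx wy" if "0 < \<kappa>"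
  proof -
    have "(wx * wy)\<^sup>2 < (1 + \<kappa> * X * Y * c)\<^sup>2" unfolding id using q that by simp
    then have "wx * wy < 1 + \<kappa> * X * Y * c" using p by (simp add: power2_less_imp_less)
    then show ?thesis using assms(3,5) by (simp add: hlen_def)
  qed
  show "hlen \<kappa> c X Y wx wy = 1" if "\<kappa> = 0"
    using assms(3-6) that by (simp add: hlen_def power2_eq_1_iff)
qed

text \<open>The weak inequalities admit \<open>X = 0\<close> and
  \<open>\<kappa> * X\<^sup>2 = 1\<close>, the two ends up to which the angle is extended by
  continuity.\<close>

lemma ang_arg_bounds:
  assumes "C1t a b c" "0 \<le> \<kappa>" "0 \<le> X" "0 \<le> Y" "0 \<le> Z" "\<kappa> * X\<^sup>2 \<le> 1" "\<kappa> * Y\<^sup>2 \<le> 1" "\<kappa> * Z\<^sup>2 \<le> 1"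
    "0 < qlen \<kappa> c X Y" "0 < qlen \<kappa> b X Z"
  shows "-1 \<le> qnum \<kappa> a b c X Y Z / sqrt (qlen \<kappa> c X Y * qlen \<kappa> b X Z)"
    "qnum \<kappa> a b c X Y Z / sqrt (qlen \<kappa> c X Y * qlen \<kappa> b X Z) \<le> 1"
proof -
  have "0 \<le> (1 - \<kappa> * X\<^sup>2) * disc \<kappa> a b c X Y Z" using disc_nonneg[OF assms(1-8)] assms(6) by simp
  then have "(qnum \<kappa> a b c X Y Z)\<^sup>2 \<le> qlen \<kappa> c X Y * qlen \<kappa> b X Z"
    using qlen_qnum_disc[of \<kappa> c X Y b Z a] by linarith
  then have "\<bar>qnum \<kappa> a b c X Y Z\<bar> \<le> sqrt (qlen \<kappa> c X Y * qlen \<kappa> b X Z)"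
    by (rule real_le_rsqrt[of "\<bar>_\<bar>", simplified])
  moreover have "0 < sqrt (qlen \<kappa> c X Y * qlen \<kappa> b X Z)" using assms by simp
  ultimately show "-1 \<le> qnum \<kappa> a b c X Y Z / sqrt (qlen \<kappa> c X Y * qlen \<kappa> b X Z)"
    "qnum \<kappa> a b c X Y Z / sqrt (qlen \<kappa> c X Y * qlen \<kappa> b X Z) \<le> 1"
    by (auto simp: abs_le_iff pos_le_divide_eq)
qed

section \<open>Dual law of cosines, angle sums and the upper bound for one angle\<close>

lemma ang_cos_sin:
  assumes "C1t a b c" "kdom \<kappa> X" "kdom \<kappa> Y" "kdom \<kappa> Z" "0 < wx" "wx\<^sup>2 = 1 - \<kappa> * X\<^sup>2"
  shows "cos (ang \<kappa> a b c X Y Z) = qnum \<kappa> a b c X Y Z / sqrt (qlen \<kappa> c X Y * qlen \<kappa> b X Z)"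
    "sin (ang \<kappa> a b c X Y Z) = wx * sqrt (disc \<kappa> a b c X Y Z) / sqrt (qlen \<kappa> c X Y * qlen \<kappa> b X Z)"
    "0 < ang \<kappa> a b c X Y Z" "ang \<kappa> a b c X Y Z < pi"
proof -
  let ?q = "qnum \<kappa> a b c X Y Z / sqrt (qlen \<kappa> c X Y * qlen \<kappa> b X Z)"
  have L: "0 < qlen \<kappa> c X Y" "0 < qlen \<kappa> b X Z"
    using assms by (auto simp: kdom_def C1t_def intro!: qlen_pos)
  have b: "-1 \<le> ?q" "?q \<le> 1"
    using L assms by (intro ang_arg_bounds; simp add: kdom_def)+
  show "cos (ang \<kappa> a b c X Y Z) = ?q" unfolding ang_def using b by (rule cos_arccos)
  have "1 - ?q\<^sup>2 = (qlen \<kappa> c X Y * qlen \<kappa> b X Z - (qnum \<kappa> a b c X Y Z)\<^sup>2) / (qlen \<kappa> c X Y * qlen \<kappa> b X Z)"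
    using L by (simp add: power_divide diff_divide_distrib)
  then have e: "1 - ?q\<^sup>2 = wx\<^sup>2 * disc \<kappa> a b c X Y Z / (qlen \<kappa> c X Y * qlen \<kappa> b X Z)"
    unfolding assms(6) by (simp add: qlen_qnum_disc)
  have "sin (ang \<kappa> a b c X Y Z) = sqrt (1 - ?q\<^sup>2)" unfolding ang_def by (rule sin_arccos[OF b])
  also have "\<dots> = wx * sqrt (disc \<kappa> a b c X Y Z) / sqrt (qlen \<kappa> c X Y * qlen \<kappa> b X Z)"
    unfolding e using assms(5) by (simp add: real_sqrt_divide real_sqrt_mult)
  finally show s: "sin (ang \<kappa> a b c X Y Z) = wx * sqrt (disc \<kappa> a b c X Y Z) / sqrt (qlen \<kappa> c X Y * qlen \<kappa> b X Z)" .
  have "0 < sin (ang \<kappa> a b c X Y Z)" unfolding s using L disc_pos[OF assms(1-4)] assms(5) by simp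
  moreover have "0 \<le> ang \<kappa> a b c X Y Z" "ang \<kappa> a b c X Y Z \<le> pi"
    using b by (auto simp: ang_def intro: arccos_lbound arccos_ubound)
  ultimately show "0 < ang \<kappa> a b c X Y Z" "ang \<kappa> a b c X Y Z < pi"
    by (metis less_eq_real_def sin_zero less_irrefl, metis less_eq_real_def sin_pi less_irrefl)
qed

text \<open>The dual law of cosines, which computes a side from the angles. For
  \<open>\<kappa> = 0\<close> the factor \<open>hlen\<close> is 1 and the law says
  \<open>cos (A + B) = - cos D\<close>. Once the common denominator is removed, only the polynomial
  identity \<open>id\<close> remains.\<close>

lemma ang_dual_cos:
  assumes C: "C1t a b c" and d: "kdom \<kappa> X" "kdom \<kappa> Y" "kdom \<kappa> Z"
    and w: "0 < wx" "wx\<^sup>2 = 1 - \<kappa> * X\<^sup>2" "0 < wy" "wy\<^sup>2 = 1 - \<kappa> * Y\<^sup>2" "0 < wz" "wz\<^sup>2 = 1 - \<kappa> * Z\<^sup>2"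
  shows "cos (ang \<kappa> a b c X Y Z) * cos (ang \<kappa> b a c Y X Z) + cos (ang \<kappa> c a b Z X Y)
    = hlen \<kappa> c X Y wx wy * sin (ang \<kappa> a b c X Y Z) * sin (ang \<kappa> b a c Y X Z)"
proof -
  note C' = C1t_perms[OF C]
  define A B D where L: "A = qlen \<kappa> a Y Z" "B = qlen \<kappa> b X Z" "D = qlen \<kappa> c X Y"
  have pos: "0 < A" "0 < B" "0 < D" unfolding L using assms by (auto simp: kdom_def C1t_def intro!: qlen_pos)
  have sym: "qlen \<kappa> c Y X = D" "qlen \<kappa> a Z Y = A" "qlen \<kappa> b Z X = B"
    by (simp_all add: L qlen_commute)
  define S where "S = sqrt (A * B)"
  have S: "S > 0" using pos by (simp add: S_def)
  have s1: "sqrt (D * B) * sqrt (D * A) = D * S"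
    using pos by (simp add: S_def real_sqrt_mult)
  have s2: "sqrt (B * A) = S" by (simp add: S_def mult.commute)
  define e where "e = disc \<kappa> a b c X Y Z"
  have e: "0 < e" "disc \<kappa> b a c Y X Z = e" using disc_pos[OF C d] disc_perms by (auto simp: e_def)
  have id: "qnum \<kappa> a b c X Y Z * qnum \<kappa> b a c Y X Z + qnum \<kappa> c a b Z X Y * D = (1 + \<kappa> * X * Y * c) * e"
    unfolding L e_def qnum_def qlen_def disc_def by algebra
  have h: "hlen \<kappa> c X Y wx wy * (wx * wy) = 1 + \<kappa> * X * Y * c" using w by (simp add: hlen_def)
  have "cos (ang \<kappa> a b c X Y Z) * cos (ang \<kappa> b a c Y X Z) + cos (ang \<kappa> c a b Z X Y)
     = qnum \<kappa> a b c X Y Z * qnum \<kappa> b a c Y X Z / (D * S) + qnum \<kappa> c a b Z X Y / S"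
    using ang_cos_sin(1)[OF C d w(1,2)] ang_cos_sin(1)[OF C'(2) d(2,1,3) w(3,4)]
      ang_cos_sin(1)[OF C'(3) d(3,1,2) w(5,6)] by (simp add: L(1,2)[symmetric] L(3)[symmetric] sym s1[symmetric] s2)
  also have "\<dots> = (1 + \<kappa> * X * Y * c) * e / (D * S)"
    unfolding id[symmetric] using pos S by (simp add: field_simps)
  also have "\<dots> = hlen \<kappa> c X Y wx wy * ((wx * sqrt e) * (wy * sqrt e)) / (D * S)"
    unfolding h[symmetric] using e by simp
  also have "\<dots> = hlen \<kappa> c X Y wx wy * sin (ang \<kappa> a b c X Y Z) * sin (ang \<kappa> b a c Y X Z)"
    using ang_cos_sin(2)[OF C d w(1,2)] ang_cos_sin(2)[OF C'(2) d(2,1,3) w(3,4)]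
    by (simp add: L(1,2)[symmetric] L(3)[symmetric] sym s1[symmetric] e e_def[symmetric])
  finally show ?thesis .
qed

text \<open>One inequality gives \<open>cos (A + B) \<ge> cos (pi - D)\<close>, which leaves the
  alternative \<open>A + B \<ge> pi + D\<close>. The two alternatives together would force
  \<open>B \<ge> pi\<close>, so two sides suffice.\<close>

lemma trig_sum_le_pi:
  assumes "0 < A" "A < pi" "0 < B" "B < pi" "0 < D" "D < pi"
    and "sin A * sin B \<le> cos A * cos B + cos D" "sin B * sin D \<le> cos B * cos D + cos A"
  shows "A + B + D \<le> pi"
proof -
  have key: "x + y + z \<le> pi \<or> x + y \<ge> pi + z" if "0 < x" "x < pi" "0 < y" "y < pi" "0 < z" "z < pi"
    "sin x * sin y \<le> cos x * cos y + cos z" for x y z :: real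
  proof -
    have c: "cos (pi - z) \<le> cos (x + y)" using that by (simp add: cos_add)
    show ?thesis
    proof (cases "x + y \<le> pi")
      case True
      then have "x + y \<le> pi - z" using c that cos_mono_le_eq[of "pi - z" "x + y"] by linarith
      then show ?thesis by simp
    next
      case False
      have "cos (x + y) = cos (2 * pi - (x + y))" by (simp add: cos_diff)
      then have "2 * pi - (x + y) \<le> pi - z"
        using c that False cos_mono_le_eq[of "pi - z" "2 * pi - (x + y)"] by linarith
      then show ?thesis by simp
    qed
  qed
  show ?thesis using key[of A B D] key[of B D A] assms by linarith
qed

text \<open>\<open>hlen \<ge> 1\<close> at two sides turns the dual law of cosines into the
  hypotheses of \<open>trig_sum_le_pi\<close>. In the flat case \<open>hlen = 1\<close>, and
  injectivity of the cosine on \<open>{0..pi}\<close> gives equality.\<close>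

lemma ang_sum:
  assumes C: "C1t a b c" and d: "kdom \<kappa> X" "kdom \<kappa> Y" "kdom \<kappa> Z"
  shows "ang \<kappa> a b c X Y Z + ang \<kappa> b a c Y X Z + ang \<kappa> c a b Z X Y \<le> pi"
    "\<kappa> = 0 \<Longrightarrow> ang \<kappa> a b c X Y Z + ang \<kappa> b a c Y X Z + ang \<kappa> c a b Z X Y = pi"
proof -
  define wx wy wz where w: "wx = sqrt (1 - \<kappa> * X\<^sup>2)" "wy = sqrt (1 - \<kappa> * Y\<^sup>2)" "wz = sqrt (1 - \<kappa> * Z\<^sup>2)"
  have wp: "0 < wx" "wx\<^sup>2 = 1 - \<kappa> * X\<^sup>2" "0 < wy" "wy\<^sup>2 = 1 - \<kappa> * Y\<^sup>2" "0 < wz" "wz\<^sup>2 = 1 - \<kappa> * Z\<^sup>2"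
    using d by (auto simp: kdom_def w)
  note C' = C1t_perms[OF C]
  let ?A = "ang \<kappa> a b c X Y Z" and ?B = "ang \<kappa> b a c Y X Z" and ?D = "ang \<kappa> c a b Z X Y"
  have r: "0 < ?A" "?A < pi" "0 < ?B" "?B < pi" "0 < ?D" "?D < pi"
    using ang_cos_sin(3,4)[OF C d wp(1,2)] ang_cos_sin(3,4)[OF C'(2) d(2,1,3) wp(3,4)]
      ang_cos_sin(3,4)[OF C'(3) d(3,1,2) wp(5,6)] by auto
  have s: "0 < sin ?A * sin ?B" "0 < sin ?B * sin ?D" using r by (simp_all add: sin_gt_zero)
  have bnd: "-1 < a" "a \<le> 1" "-1 < c" "c \<le> 1" using C by (auto simp: C1t_def)
  have e1: "cos ?A * cos ?B + cos ?D = hlen \<kappa> c X Y wx wy * (sin ?A * sin ?B)"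
    using ang_dual_cos[OF C d wp] by (simp only: mult.assoc)
  have e2: "cos ?B * cos ?D + cos ?A = hlen \<kappa> a Y Z wy wz * (sin ?B * sin ?D)"
    using ang_dual_cos[OF C1t_perms(1)[OF C'(2)] d(2,3,1) wp(3-6,1,2)]
    by (simp only: ang_commute[of \<kappa> b c a Y Z X] ang_commute[of \<kappa> c b a Z Y X] mult.assoc)
  have "1 * (sin ?A * sin ?B) \<le> hlen \<kappa> c X Y wx wy * (sin ?A * sin ?B)"
    using hlen_ge_1(1)[OF d(1,2) wp(1-4) bnd(3,4)] s by (intro mult_right_mono) auto
  moreover have "1 * (sin ?B * sin ?D) \<le> hlen \<kappa> a Y Z wy wz * (sin ?B * sin ?D)"
    using hlen_ge_1(1)[OF d(2,3) wp(3-6) bnd(1,2)] s by (intro mult_right_mono) auto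
  ultimately show le: "?A + ?B + ?D \<le> pi" using trig_sum_le_pi[OF r] e1 e2 by (simp only: mult_1)
  assume "\<kappa> = 0"
  then have h: "hlen \<kappa> c X Y wx wy = 1" by (rule hlen_ge_1(3)[OF d(1,2) wp(1-4) bnd(3,4)])
  have "cos ?A * cos ?B + cos ?D = sin ?A * sin ?B" using e1 unfolding h mult_1 .
  moreover have "cos (pi - ?D) = - cos ?D" by simp
  ultimately have "cos (?A + ?B) = cos (pi - ?D)" using cos_add[of ?A ?B] by linarith
  moreover have "0 \<le> ?A + ?B" "?A + ?B \<le> pi" "0 \<le> pi - ?D" "pi - ?D \<le> pi"
    using le r by linarith+
  ultimately have "?A + ?B = pi - ?D" using cos_inj_pi[of "?A + ?B" "pi - ?D"] by blast
  then show "?A + ?B + ?D = pi" by linarith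
qed

text \<open>At \<open>X = 0\<close> the vertex is an intersection point of the other two circles and
  sees their centers under the angle \<open>arccos (- a)\<close>. Enlarging \<open>X\<close>
  strictly decreases the angle, since by \<open>wt_pos_or\<close> one of the two weights is
  positive.\<close>

lemma ang_less:
  assumes C: "C1t a b c" and d: "kdom \<kappa> X" "kdom \<kappa> Y" "kdom \<kappa> Z"
  shows "ang \<kappa> a b c X Y Z < arccos (- a)"
proof -
  have pos: "0 < X" "0 < Y" "0 < Z" "0 \<le> \<kappa>" "\<kappa> * X\<^sup>2 < 1" "\<kappa> * Y\<^sup>2 < 1" "\<kappa> * Z\<^sup>2 < 1" using d by (auto simp: kdom_def)
  have le: "\<kappa> * t\<^sup>2 < 1" if "0 \<le> t" "t \<le> X" for t
  proof -
    have "\<kappa> * t\<^sup>2 \<le> \<kappa> * X\<^sup>2" using that pos by (intro mult_left_mono power_mono) auto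
    then show ?thesis using pos by simp
  qed
  have Lp: "0 < qlen \<kappa> c t Y" "0 < qlen \<kappa> b t Z" if "0 \<le> t" "t \<le> X" for t
    using that pos C le[OF that] by (auto simp: C1t_def intro!: qlen_pos)
  have "ang \<kappa> a b c X Y Z < ang \<kappa> a b c 0 Y Z"
  proof (rule DERIV_neg_imp_decreasing_open[OF pos(1)])
    show "continuous_on {0..X} (\<lambda>X. ang \<kappa> a b c X Y Z)" unfolding ang_def
    proof (rule continuous_on_arccos)
      show "continuous_on {0..X} (\<lambda>X. qnum \<kappa> a b c X Y Z / sqrt (qlen \<kappa> c X Y * qlen \<kappa> b X Z))"
      proof (intro continuous_intros ballI)
        fix t assume "t \<in> {0..X}"
        then show "sqrt (qlen \<kappa> c t Y * qlen \<kappa> b t Z) \<noteq> 0" using Lp[of t] by auto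
      qed
      show "\<forall>X\<in>{0..X}. - 1 \<le> qnum \<kappa> a b c X Y Z / sqrt (qlen \<kappa> c X Y * qlen \<kappa> b X Z) \<and>
          qnum \<kappa> a b c X Y Z / sqrt (qlen \<kappa> c X Y * qlen \<kappa> b X Z) \<le> 1"
      proof (intro ballI conjI)
        fix t assume "t \<in> {0..X}"
        then have "0 < qlen \<kappa> c t Y" "0 < qlen \<kappa> b t Z" "0 \<le> t" "\<kappa> * t\<^sup>2 \<le> 1"
          using Lp[of t] le[of t] by auto
        then show "- 1 \<le> qnum \<kappa> a b c t Y Z / sqrt (qlen \<kappa> c t Y * qlen \<kappa> b t Z)"
          "qnum \<kappa> a b c t Y Z / sqrt (qlen \<kappa> c t Y * qlen \<kappa> b t Z) \<le> 1"
          using ang_arg_bounds[OF C, of \<kappa> t Y Z] pos by (simp_all del: divide_le_eq_1)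
      qed
    qed
    fix t assume t: "0 < t" "t < X"
    have dt: "kdom \<kappa> t" using t le[of t] pos by (auto simp: kdom_def)
    define wx wy wz where w: "wx = sqrt (1 - \<kappa> * t\<^sup>2)" "wy = sqrt (1 - \<kappa> * Y\<^sup>2)" "wz = sqrt (1 - \<kappa> * Z\<^sup>2)"
    have wp: "0 < wx" "wx\<^sup>2 = 1 - \<kappa> * t\<^sup>2" "0 < wy" "wy\<^sup>2 = 1 - \<kappa> * Y\<^sup>2" "0 < wz" "wz\<^sup>2 = 1 - \<kappa> * Z\<^sup>2"
      using d dt by (auto simp: kdom_def w)
    \<comment> \<open>With this logarithmic velocity \<open>X\<close> itself moves at unit speed, so
      \<open>ang_deriv\<close> yields the plain derivative in \<open>X\<close>.\<close>
    define p where "p = 1 / (t * wx)"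
    have p: "p > 0" using t wp by (simp add: p_def)
    define m1 m2 h1 h2 where m: "m1 = mwt \<kappa> a b c t Y Z wx wy" "m2 = mwt \<kappa> a c b t Z Y wx wz"
      "h1 = hlen \<kappa> c t Y wx wy" "h2 = hlen \<kappa> b t Z wx wz"
    have "((\<lambda>X. ang \<kappa> a b c X Y Z) has_real_derivative m1 * (0 - h1 * p) + m2 * (0 - h2 * p)) (at t)"
      unfolding m by (rule ang_deriv[OF C]) (use dt d wp t in \<open>auto simp: p_def\<close>)
    moreover have "m1 * (0 - h1 * p) + m2 * (0 - h2 * p) < 0"
    proof -
      have h: "h1 > 0" "h2 > 0"
        using hlen_ge_1(1)[OF dt d(2) wp(1-4), of c] hlen_ge_1(1)[OF dt d(3) wp(1,2,5,6), of b] C by (auto simp: m C1t_def)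
      have dp: "0 < disc \<kappa> a b c t Y Z" "0 < disc \<kappa> a c b t Z Y"
        using disc_pos[OF C dt d(2,3)] disc_perms(1) by metis+
      have "0 \<le> wt a b c t Y Z" "0 \<le> wt a c b t Z Y"
        using C C1t_perms(1)[OF C] t pos by (auto intro!: wt_nonneg)
      then have "0 \<le> m1" "0 \<le> m2" unfolding m mwt_def using dp Lp[of t] t wp by auto
      moreover have "0 < m1 \<or> 0 < m2" using wt_pos_or[OF C t(1) pos(2,3)] dp Lp[of t] t wp
        unfolding m mwt_def by auto
      ultimately have "0 < m1 * (h1 * p) + m2 * (h2 * p)" using h p
        by (smt (verit) mult_pos_pos mult_nonneg_nonneg)
      then show ?thesis by simp
    qed
    ultimately show "\<exists>y. ((\<lambda>X. ang \<kappa> a b c X Y Z) has_real_derivative y) (at t) \<and> y < 0" by blast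
  qed
  also have "ang \<kappa> a b c 0 Y Z = arccos (- a)" using pos by (simp add: ang_def qnum_def qlen_def real_sqrt_mult)
  finally show ?thesis .
qed

section \<open>Limits of the angles for degenerating radii\<close>

lemma tendsto_arccos_compose:
  assumes "(f \<longlongrightarrow> l) F" "\<forall>\<^sub>F x in F. -1 \<le> f x \<and> f x \<le> 1" "-1 \<le> l" "l \<le> 1"
  shows "((\<lambda>x. arccos (f x)) \<longlongrightarrow> arccos l) F"
  by (rule continuous_on_tendsto_compose[OF continuous_on_arccos', of f l])
     (use assms in auto)

lemma sqrt_quot_scale:
  fixes n :: real
  assumes "0 < S" "0 < U"
  shows "n / sqrt (l * m) = (n / (S * U)) / sqrt ((l / S\<^sup>2) * (m / U\<^sup>2))"
proof -
  have "sqrt ((l / S\<^sup>2) * (m / U\<^sup>2)) = sqrt (l * m) / (S * U)"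
    using assms by (simp add: real_sqrt_divide real_sqrt_mult)
  then show ?thesis using assms by simp
qed

lemma ang_arg_bounds_kdom:
  assumes "C1t a b c" "kdom \<kappa> X" "kdom \<kappa> Y" "kdom \<kappa> Z"
  shows "-1 \<le> qnum \<kappa> a b c X Y Z / sqrt (qlen \<kappa> c X Y * qlen \<kappa> b X Z)
    \<and> qnum \<kappa> a b c X Y Z / sqrt (qlen \<kappa> c X Y * qlen \<kappa> b X Z) \<le> 1"
proof -
  have L: "0 < qlen \<kappa> c X Y" "0 < qlen \<kappa> b X Z"
    using assms by (auto simp: kdom_def C1t_def intro!: qlen_pos)
  show ?thesis
    using L assms ang_arg_bounds[OF assms(1), of \<kappa> X Y Z] by (simp add: kdom_def del: divide_le_eq_1)
qed

text \<open>Numerator and lengths are divided by the powers of \<open>Y\<close> and \<open>Z\<close>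
  that they carry at \<open>X = 0\<close>; the normalized lengths tend to 1 and only
  \<open>- a\<close> survives in the numerator.\<close>

lemma ang_tendsto_link:
  fixes X Y Z :: "nat \<Rightarrow> real"
  assumes C: "C1t a b c" and d: "\<And>n. kdom \<kappa> (X n)" "\<And>n. kdom \<kappa> (Y n)" "\<And>n. kdom \<kappa> (Z n)"
    and l: "(\<lambda>n. X n / Y n) \<longlonglongrightarrow> 0" "(\<lambda>n. X n / Z n) \<longlonglongrightarrow> 0" "(\<lambda>n. \<kappa> * (X n)\<^sup>2) \<longlonglongrightarrow> 0"
  shows "(\<lambda>n. ang \<kappa> a b c (X n) (Y n) (Z n)) \<longlonglongrightarrow> arccos (- a)"
proof -
  have pos: "0 < X n" "0 < Y n" "0 < Z n" for n using d[of n] by (auto simp: kdom_def)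
  have "qnum \<kappa> a b c (X n) (Y n) (Z n) / (Y n * Z n) = (X n / Y n) * (X n / Z n) + (X n / Y n) * b
      + (X n / Z n) * c - a + (\<kappa> * (X n)\<^sup>2) * (a + b * c)" for n
    using pos[of n] by (simp add: qnum_def field_simps power2_eq_square)
  moreover have "(\<lambda>n. (X n / Y n) * (X n / Z n) + (X n / Y n) * b
      + (X n / Z n) * c - a + (\<kappa> * (X n)\<^sup>2) * (a + b * c)) \<longlonglongrightarrow> 0 * 0 + 0 * b + 0 * c - a + 0 * (a + b * c)"
    by (intro tendsto_intros l)
  ultimately have n: "(\<lambda>n. qnum \<kappa> a b c (X n) (Y n) (Z n) / (Y n * Z n)) \<longlonglongrightarrow> - a" by simp
  have L: "(\<lambda>n. qlen \<kappa> c (X n) (Y n) / (Y n)\<^sup>2) \<longlonglongrightarrow> 1"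
    if "\<And>n. 0 < Y n" "(\<lambda>n. X n / Y n) \<longlonglongrightarrow> 0" for Y c
  proof -
    have "qlen \<kappa> c (X n) (Y n) / (Y n)\<^sup>2 = (X n / Y n)\<^sup>2 + 1 + 2 * (X n / Y n) * c - (\<kappa> * (X n)\<^sup>2) * (1 - c\<^sup>2)" for n
      using that(1)[of n] by (simp add: qlen_def field_simps power2_eq_square)
    moreover have "(\<lambda>n. (X n / Y n)\<^sup>2 + 1 + 2 * (X n / Y n) * c - (\<kappa> * (X n)\<^sup>2) * (1 - c\<^sup>2))
       \<longlonglongrightarrow> 0\<^sup>2 + 1 + 2 * 0 * c - 0 * (1 - c\<^sup>2)"
      by (intro tendsto_intros l that)
    ultimately show ?thesis by simp
  qed
  have "(\<lambda>n. (qnum \<kappa> a b c (X n) (Y n) (Z n) / (Y n * Z n)) /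
     sqrt (qlen \<kappa> c (X n) (Y n) / (Y n)\<^sup>2 * (qlen \<kappa> b (X n) (Z n) / (Z n)\<^sup>2))) \<longlonglongrightarrow> - a / sqrt (1 * 1)"
    by (intro tendsto_intros n L l pos) simp
  then have "(\<lambda>n. qnum \<kappa> a b c (X n) (Y n) (Z n) / sqrt (qlen \<kappa> c (X n) (Y n) * qlen \<kappa> b (X n) (Z n))) \<longlonglongrightarrow> - a"
    unfolding sqrt_quot_scale[OF pos(2) pos(3), symmetric] by simp
  then show ?thesis unfolding ang_def
    using ang_arg_bounds_kdom[OF C d] C
    by (intro tendsto_arccos_compose always_eventually allI) (simp_all add: C1t_def del: divide_le_eq_1)
qed

text \<open>Everything is divided by powers of \<open>X\<close>. The product
  \<open>\<kappa> * Y * Z\<close> has to vanish by itself, because the corresponding term of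
  \<open>qnum\<close> already contains the full power \<open>X\<^sup>2\<close>.\<close>

lemma ang_tendsto_0:
  fixes X Y Z :: "nat \<Rightarrow> real"
  assumes C: "C1t a b c" and d: "\<And>n. kdom \<kappa> (X n)" "\<And>n. kdom \<kappa> (Y n)" "\<And>n. kdom \<kappa> (Z n)"
    and l: "(\<lambda>n. Y n / X n) \<longlonglongrightarrow> 0" "(\<lambda>n. Z n / X n) \<longlonglongrightarrow> 0"
      "(\<lambda>n. \<kappa> * (Y n)\<^sup>2) \<longlonglongrightarrow> 0" "(\<lambda>n. \<kappa> * (Z n)\<^sup>2) \<longlonglongrightarrow> 0"
      "(\<lambda>n. \<kappa> * Y n * Z n) \<longlonglongrightarrow> 0"
  shows "(\<lambda>n. ang \<kappa> a b c (X n) (Y n) (Z n)) \<longlonglongrightarrow> 0"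
proof -
  have pos: "0 < X n" "0 < Y n" "0 < Z n" for n using d[of n] by (auto simp: kdom_def)
  have "qnum \<kappa> a b c (X n) (Y n) (Z n) / (X n * X n) = 1 + (Z n / X n) * b + (Y n / X n) * c
      - (Y n / X n) * (Z n / X n) * a + (\<kappa> * Y n * Z n) * (a + b * c)" for n
    using pos[of n] by (simp add: qnum_def field_simps power2_eq_square)
  moreover have "(\<lambda>n. 1 + (Z n / X n) * b + (Y n / X n) * c
      - (Y n / X n) * (Z n / X n) * a + (\<kappa> * Y n * Z n) * (a + b * c))
      \<longlonglongrightarrow> 1 + 0 * b + 0 * c - 0 * 0 * a + 0 * (a + b * c)"
    by (intro tendsto_intros l)
  ultimately have n: "(\<lambda>n. qnum \<kappa> a b c (X n) (Y n) (Z n) / (X n * X n)) \<longlonglongrightarrow> 1" by simp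
  have L: "(\<lambda>n. qlen \<kappa> c (X n) (Y n) / (X n)\<^sup>2) \<longlonglongrightarrow> 1"
    if "(\<lambda>n. Y n / X n) \<longlonglongrightarrow> 0" "(\<lambda>n. \<kappa> * (Y n)\<^sup>2) \<longlonglongrightarrow> 0" for Y c
  proof -
    have "qlen \<kappa> c (X n) (Y n) / (X n)\<^sup>2 = 1 + (Y n / X n)\<^sup>2 + 2 * (Y n / X n) * c - (\<kappa> * (Y n)\<^sup>2) * (1 - c\<^sup>2)" for n
      using pos(1)[of n] by (simp add: qlen_def field_simps power2_eq_square)
    moreover have "(\<lambda>n. 1 + (Y n / X n)\<^sup>2 + 2 * (Y n / X n) * c - (\<kappa> * (Y n)\<^sup>2) * (1 - c\<^sup>2))
       \<longlonglongrightarrow> 1 + 0\<^sup>2 + 2 * 0 * c - 0 * (1 - c\<^sup>2)"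
      by (intro tendsto_intros that)
    ultimately show ?thesis by simp
  qed
  have "(\<lambda>n. (qnum \<kappa> a b c (X n) (Y n) (Z n) / (X n * X n)) /
     sqrt (qlen \<kappa> c (X n) (Y n) / (X n)\<^sup>2 * (qlen \<kappa> b (X n) (Z n) / (X n)\<^sup>2))) \<longlonglongrightarrow> 1 / sqrt (1 * 1)"
    by (intro tendsto_intros n L l pos) simp
  then have "(\<lambda>n. qnum \<kappa> a b c (X n) (Y n) (Z n) / sqrt (qlen \<kappa> c (X n) (Y n) * qlen \<kappa> b (X n) (Z n))) \<longlonglongrightarrow> 1"
    unfolding sqrt_quot_scale[OF pos(1) pos(1), symmetric] by simp
  then have "(\<lambda>n. ang \<kappa> a b c (X n) (Y n) (Z n)) \<longlonglongrightarrow> arccos 1" unfolding ang_def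
    using ang_arg_bounds_kdom[OF C d]
    by (intro tendsto_arccos_compose always_eventually allI) (simp_all del: divide_le_eq_1)
  then show ?thesis by simp
qed

text \<open>The dual law of cosines controls the angle defect by \<open>cosh l - 1\<close> for a single side \<open>l\<close>.\<close>

lemma ang_sum_tendsto:
  fixes X Y Z :: "nat \<Rightarrow> real"
  assumes C: "C1t a b c" and d: "\<And>n. kdom \<kappa> (X n)" "\<And>n. kdom \<kappa> (Y n)" "\<And>n. kdom \<kappa> (Z n)"
    and l: "(\<lambda>n. \<kappa> * (X n)\<^sup>2) \<longlonglongrightarrow> 0" "(\<lambda>n. \<kappa> * (Y n)\<^sup>2) \<longlonglongrightarrow> 0" "(\<lambda>n. \<kappa> * X n * Y n) \<longlonglongrightarrow> 0"
  shows "(\<lambda>n. ang \<kappa> a b c (X n) (Y n) (Z n) + ang \<kappa> b a c (Y n) (X n) (Z n)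
     + ang \<kappa> c a b (Z n) (X n) (Y n)) \<longlonglongrightarrow> pi"
proof -
  define wx wy wz where w: "wx = (\<lambda>n. sqrt (1 - \<kappa> * (X n)\<^sup>2))" "wy = (\<lambda>n. sqrt (1 - \<kappa> * (Y n)\<^sup>2))"
    "wz = (\<lambda>n. sqrt (1 - \<kappa> * (Z n)\<^sup>2))"
  have wp: "0 < wx n" "(wx n)\<^sup>2 = 1 - \<kappa> * (X n)\<^sup>2" "0 < wy n" "(wy n)\<^sup>2 = 1 - \<kappa> * (Y n)\<^sup>2"
    "0 < wz n" "(wz n)\<^sup>2 = 1 - \<kappa> * (Z n)\<^sup>2" for n
    using d[of n] by (auto simp: kdom_def w)
  note C' = C1t_perms[OF C]
  define A B D where ABD: "A = (\<lambda>n. ang \<kappa> a b c (X n) (Y n) (Z n))"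
    "B = (\<lambda>n. ang \<kappa> b a c (Y n) (X n) (Z n))" "D = (\<lambda>n. ang \<kappa> c a b (Z n) (X n) (Y n))"
  have r: "0 < A n" "A n < pi" "0 < B n" "B n < pi" "0 < D n" "D n < pi" for n
    unfolding ABD
    using ang_cos_sin(3,4)[OF C d wp(1,2), of n n n] ang_cos_sin(3,4)[OF C'(2) d(2) d(1) d(3) wp(3,4), of n n n]
      ang_cos_sin(3,4)[OF C'(3) d(3) d(1) d(2) wp(5,6), of n n n] by auto
  have s: "A n + B n + D n \<le> pi" for n
    unfolding ABD using ang_sum(1)[OF C d] by auto
  define h where "h = (\<lambda>n. hlen \<kappa> c (X n) (Y n) (wx n) (wy n))"
  have "(\<lambda>n. (1 + (\<kappa> * X n * Y n) * c) / (sqrt (1 - \<kappa> * (X n)\<^sup>2) * sqrt (1 - \<kappa> * (Y n)\<^sup>2)))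
     \<longlonglongrightarrow> (1 + 0 * c) / (sqrt (1 - 0) * sqrt (1 - 0))"
    by (intro tendsto_intros l) auto
  then have h: "h \<longlonglongrightarrow> 1" by (simp add: h_def hlen_def w)
  have e: "cos (A n) * cos (B n) + cos (D n) = h n * (sin (A n) * sin (B n))" for n
    using ang_dual_cos[OF C d wp, of n n n] unfolding ABD h_def by (simp only: mult.assoc)
  have e': "cos (A n + B n) - cos (pi - D n) = (h n - 1) * (sin (A n) * sin (B n))" for n
  proof -
    have "cos (pi - D n) = - cos (D n)" by simp
    then show ?thesis using e[of n] cos_add[of "A n" "B n"] by (simp only: left_diff_distrib mult_1)
  qed
  have "(\<lambda>n. cos (A n + B n) - cos (pi - D n)) \<longlonglongrightarrow> 0"
  proof (rule Lim_null_comparison[where g = "\<lambda>n. \<bar>h n - 1\<bar>"])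
    show "\<forall>\<^sub>F n in sequentially. norm (cos (A n + B n) - cos (pi - D n)) \<le> \<bar>h n - 1\<bar>"
    proof (rule always_eventually, rule allI)
      fix n
      have "\<bar>sin (A n) * sin (B n)\<bar> \<le> 1" by (simp add: abs_mult mult_le_one)
      then have "\<bar>h n - 1\<bar> * \<bar>sin (A n) * sin (B n)\<bar> \<le> \<bar>h n - 1\<bar> * 1" by (intro mult_left_mono) auto
      then show "norm (cos (A n + B n) - cos (pi - D n)) \<le> \<bar>h n - 1\<bar>"
        unfolding e' real_norm_def abs_mult[of "h n - 1"] by simp
    qed
    show "(\<lambda>n. \<bar>h n - 1\<bar>) \<longlonglongrightarrow> 0" using tendsto_rabs[OF tendsto_diff[OF h tendsto_const[of 1]]] by simp
  qed
  then have dist: "(\<lambda>n. dist (cos (A n + B n)) (cos (pi - D n))) \<longlonglongrightarrow> 0"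
    unfolding dist_real_def by (rule tendsto_rabs_zero)
  \<comment> \<open>Close cosines give close angles, uniformly on \<open>{-1..1}\<close>. Both
    \<open>A n + B n\<close> and \<open>pi - D n\<close> lie in \<open>{0..pi}\<close> by the angle
    sum bound, so \<open>arccos\<close> recovers them.\<close>
  have "uniformly_continuous_on {-1..1} arccos"
    by (intro compact_uniformly_continuous continuous_on_arccos' compact_Icc)
  then have "(\<lambda>n. dist (arccos (cos (A n + B n))) (arccos (cos (pi - D n)))) \<longlonglongrightarrow> 0"
    unfolding uniformly_continuous_on_sequentially using dist
    by (elim allE[where x = "\<lambda>n. cos (A n + B n)"] allE[where x = "\<lambda>n. cos (pi - D n)"] impE)
      (simp_all del: cos_pi_minus)
  moreover have "arccos (cos (A n + B n)) = A n + B n" for n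
    by (rule arccos_cos) (use r[of n] s[of n] in linarith)+
  moreover have "arccos (cos (pi - D n)) = pi - D n" for n
    by (rule arccos_cos) (use r[of n] s[of n] in linarith)+
  ultimately have "(\<lambda>n. \<bar>A n + B n - (pi - D n)\<bar>) \<longlonglongrightarrow> 0"
    by (simp only: dist_real_def)
  then have "(\<lambda>n. A n + B n - (pi - D n)) \<longlonglongrightarrow> 0" by (rule tendsto_rabs_zero_cancel)
  from tendsto_add[OF this tendsto_const[of pi]] show ?thesis unfolding ABD by (simp add: algebra_simps)
qed

lemma mult_gt_minus_1:
  fixes Y c :: real
  assumes "0 \<le> Y" "Y \<le> 1" "-1 < c"
  shows "- 1 < Y * c"
proof (cases "0 \<le> c")
  case True
  then have "0 \<le> Y * c" using assms by simp
  then show ?thesis by linarith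
next
  case False
  then have "c \<le> Y * c" using assms mult_right_mono_neg[of Y 1 c] by simp
  then show ?thesis using assms by linarith
qed

text \<open>The angle extends continuously to \<open>X = 1\<close>, where it vanishes.\<close>

lemma ang_small_if_large:
  assumes C: "C1t a b c" and e: "0 < e"
  obtains x0 where "0 < x0" "x0 < 1"
    "\<And>X Y Z. x0 \<le> X \<Longrightarrow> X < 1 \<Longrightarrow> 0 < Y \<Longrightarrow> Y < 1 \<Longrightarrow> 0 < Z \<Longrightarrow> Z < 1 \<Longrightarrow> ang 1 a b c X Y Z < e"
proof -
  \<comment> \<open>Starting at \<open>1/2\<close> keeps both lengths positive even for
    \<open>Y = 0\<close> or \<open>Z = 0\<close>; the values \<open>X = 1\<close>,
    \<open>Y = 0\<close>, \<open>Z = 0\<close> are included to make the domain compact.\<close>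
  let ?K = "{1/2..1::real} \<times> {0..1::real} \<times> {0..1::real}"
  have bnd: "-1 < a" "a \<le> 1" "-1 < b" "b \<le> 1" "-1 < c" "c \<le> 1" using C by (auto simp: C1t_def)
  have Lp: "0 < qlen 1 c X Y" if "-1 < c" "c \<le> 1" "1/2 \<le> X" "X \<le> 1" "0 \<le> Y" "Y \<le> 1" for X Y c :: real
  proof (cases "X = 1")
    case True
    have "- 1 < Y * c" using that by (intro mult_gt_minus_1)
    then have "0 < (1 + Y * c)\<^sup>2" by simp
    also have "(1 + Y * c)\<^sup>2 = qlen 1 c X Y" using True by (simp add: qlen_def power2_eq_square algebra_simps)
    finally show ?thesis .
  next
    case False
    then have "1 * X\<^sup>2 < 1" using that by (simp add: abs_square_less_1)
    then show ?thesis using that by (intro qlen_pos) auto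
  qed
  have cont: "continuous_on ?K (\<lambda>p. ang 1 a b c (fst p) (fst (snd p)) (snd (snd p)))"
    unfolding ang_def
  proof (rule continuous_on_arccos)
    show "continuous_on ?K (\<lambda>p. qnum 1 a b c (fst p) (fst (snd p)) (snd (snd p)) /
       sqrt (qlen 1 c (fst p) (fst (snd p)) * qlen 1 b (fst p) (snd (snd p))))"
    proof (intro continuous_intros ballI)
      fix p assume "p \<in> ?K"
      then have "0 < qlen 1 c (fst p) (fst (snd p))" "0 < qlen 1 b (fst p) (snd (snd p))"
        using bnd by (auto intro!: Lp)
      then show "sqrt (qlen 1 c (fst p) (fst (snd p)) * qlen 1 b (fst p) (snd (snd p))) \<noteq> 0" by simp
    qed
    show "\<forall>p\<in>?K. - 1 \<le> qnum 1 a b c (fst p) (fst (snd p)) (snd (snd p)) /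
       sqrt (qlen 1 c (fst p) (fst (snd p)) * qlen 1 b (fst p) (snd (snd p)))
       \<and> qnum 1 a b c (fst p) (fst (snd p)) (snd (snd p)) /
       sqrt (qlen 1 c (fst p) (fst (snd p)) * qlen 1 b (fst p) (snd (snd p))) \<le> 1"
    proof
      fix p assume p: "p \<in> ?K"
      then have "0 < qlen 1 c (fst p) (fst (snd p))" "0 < qlen 1 b (fst p) (snd (snd p))"
        using bnd by (auto intro!: Lp)
      moreover have "0 \<le> fst p" "0 \<le> fst (snd p)" "0 \<le> snd (snd p)"
        "1 * (fst p)\<^sup>2 \<le> 1" "1 * (fst (snd p))\<^sup>2 \<le> 1" "1 * (snd (snd p))\<^sup>2 \<le> 1"
        using p by (auto simp: abs_square_le_1)
      ultimately show "- 1 \<le> qnum 1 a b c (fst p) (fst (snd p)) (snd (snd p)) /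
       sqrt (qlen 1 c (fst p) (fst (snd p)) * qlen 1 b (fst p) (snd (snd p)))
       \<and> qnum 1 a b c (fst p) (fst (snd p)) (snd (snd p)) /
       sqrt (qlen 1 c (fst p) (fst (snd p)) * qlen 1 b (fst p) (snd (snd p))) \<le> 1"
        using ang_arg_bounds[OF C zero_le_one] by blast
    qed
  qed
  have "compact ?K" by (intro compact_Times compact_Icc)
  then have "uniformly_continuous_on ?K (\<lambda>p. ang 1 a b c (fst p) (fst (snd p)) (snd (snd p)))"
    using compact_uniformly_continuous cont by blast
  then obtain \<delta> where \<delta>: "\<delta> > 0" and u: "\<And>p q. p \<in> ?K \<Longrightarrow> q \<in> ?K \<Longrightarrow> dist q p < \<delta> \<Longrightarrow>
     dist (ang 1 a b c (fst q) (fst (snd q)) (snd (snd q))) (ang 1 a b c (fst p) (fst (snd p)) (snd (snd p))) < e"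
    using e unfolding uniformly_continuous_on_def by metis
  have at1: "ang 1 a b c 1 Y Z = 0" if "0 \<le> Y" "Y \<le> 1" "0 \<le> Z" "Z \<le> 1" for Y Z
  proof -
    have q1: "qlen 1 c 1 Y = (1 + Y * c)\<^sup>2" "qlen 1 b 1 Z = (1 + Z * b)\<^sup>2" "qnum 1 a b c 1 Y Z = (1 + Y * c) * (1 + Z * b)"
      by (simp_all add: qlen_def qnum_def power2_eq_square algebra_simps)
    have "0 < 1 + Y * c" "0 < 1 + Z * b" using mult_gt_minus_1[of Y c] mult_gt_minus_1[of Z b] that bnd by auto
    then show ?thesis unfolding ang_def q1 by (simp add: real_sqrt_mult)
  qed
  define x0 where "x0 = max (1/2) (1 - \<delta>/2)"
  show ?thesis
  proof (rule that[of x0])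
    show "0 < x0" "x0 < 1" using \<delta> by (auto simp: x0_def)
    fix X Y Z :: real assume h: "x0 \<le> X" "X < 1" "0 < Y" "Y < 1" "0 < Z" "Z < 1"
    have "dist (X, Y, Z) (1, Y, Z) < \<delta>" using h \<delta> by (simp add: dist_Pair_Pair dist_real_def x0_def)
    then have "dist (ang 1 a b c X Y Z) (ang 1 a b c 1 Y Z) < e"
      using u[of "(1, Y, Z)" "(X, Y, Z)"] h by (simp add: x0_def)
    then show "ang 1 a b c X Y Z < e" using at1[of Y Z] h by (simp add: dist_real_def)
  qed
qed

section \<open>Logarithmic radii\<close>

definition kap :: "geom \<Rightarrow> real" where "kap G = (case G of Hyp \<Rightarrow> 1 | Euc \<Rightarrow> 0)"
definition udom :: "geom \<Rightarrow> real set" where "udom G = (case G of Hyp \<Rightarrow> {..<0} | Euc \<Rightarrow> UNIV)"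
text \<open>For \<open>u = ln (tanh (r / 2))\<close> one has \<open>tanh r = 1 / cosh u\<close> and \<open>1 / cosh r = - tanh u\<close>.\<close>

definition xi :: "geom \<Rightarrow> real \<Rightarrow> real" where "xi G u = (case G of Hyp \<Rightarrow> 1 / cosh u | Euc \<Rightarrow> exp u)"
definition om :: "geom \<Rightarrow> real \<Rightarrow> real" where "om G u = (case G of Hyp \<Rightarrow> - tanh u | Euc \<Rightarrow> 1)"

lemma udom_interval: "lo \<in> udom G \<Longrightarrow> hi \<in> udom G \<Longrightarrow> {lo..hi} \<subseteq> udom G"
  by (cases G) (auto simp: udom_def)

text \<open>These are the hypotheses of \<open>ang_deriv\<close> for \<open>X = xi G u\<close> with
  \<open>om G u\<close> in the role of \<open>wx\<close>.\<close>

lemma om_xi: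
  assumes "u \<in> udom G"
  shows "kdom (kap G) (xi G u)" "0 < om G u" "(om G u)\<^sup>2 = 1 - kap G * (xi G u)\<^sup>2"
    "(xi G has_real_derivative xi G u * om G u) (at u)"
proof -
  have c: "1 < cosh u" if "G = Hyp"
    using assms that cosh_real_ge_1[of u] cosh_real_one_iff[of u] by (auto simp: udom_def less_le)
  show "kdom (kap G) (xi G u)"
  proof (cases G)
    case Hyp
    then show ?thesis using c by (simp add: kdom_def kap_def xi_def power_divide one_less_power)
  qed (simp add: kdom_def kap_def xi_def)
  show "0 < om G u" using assms by (cases G) (auto simp: om_def udom_def)
  show "(om G u)\<^sup>2 = 1 - kap G * (xi G u)\<^sup>2"
  proof (cases G)
    case Hyp
    show ?thesis using c[OF Hyp] Hyp
      by (simp add: om_def kap_def xi_def tanh_def power_divide sinh_square_eq diff_divide_distrib)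
  qed (simp add: om_def kap_def)
  show "(xi G has_real_derivative xi G u * om G u) (at u)"
  proof (cases G)
    case Hyp
    have "((\<lambda>u. 1 / cosh u) has_real_derivative - sinh u / (cosh u)\<^sup>2) (at u)"
      by (rule derivative_eq_intros refl)+ (use c[OF Hyp] in \<open>simp_all add: power2_eq_square\<close>)
    then show ?thesis using Hyp by (simp add: xi_def[abs_def] om_def tanh_def power2_eq_square)
  next
    case Euc
    then show ?thesis by (simp add: xi_def[abs_def] om_def)
  qed
qed

lemma continuous_on_xi [continuous_intros]: "continuous_on S f \<Longrightarrow> continuous_on S (\<lambda>x. xi G (f x))"
  by (cases G) (auto simp: xi_def intro!: continuous_intros)

lemma continuous_on_om [continuous_intros]: "continuous_on S f \<Longrightarrow> continuous_on S (\<lambda>x. om G (f x))"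
  by (cases G) (auto simp: om_def tanh_def intro!: continuous_intros)

section \<open>Angles in logarithmic coordinates\<close>

definition th :: "geom \<Rightarrow> real \<Rightarrow> real \<Rightarrow> real \<Rightarrow> real \<Rightarrow> real \<Rightarrow> real \<Rightarrow> real" where
  "th G a b c u v w = ang (kap G) a b c (xi G u) (xi G v) (xi G w)"

definition edge_wt :: "geom \<Rightarrow> real \<Rightarrow> real \<Rightarrow> real \<Rightarrow> real \<Rightarrow> real \<Rightarrow> real \<Rightarrow> real" where
  "edge_wt G a b c u v w = mwt (kap G) a b c (xi G u) (xi G v) (xi G w) (om G u) (om G v)"

definition side_cosh :: "geom \<Rightarrow> real \<Rightarrow> real \<Rightarrow> real \<Rightarrow> real" where
  "side_cosh G c u v = hlen (kap G) c (xi G u) (xi G v) (om G u) (om G v)"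

lemma th_commute: "th G a b c u v w = th G a c b u w v"
  unfolding th_def by (rule ang_commute)

lemma edge_wt_commute: "edge_wt G a b c u v w = edge_wt G b a c v u w"
  unfolding edge_wt_def mwt_def
  by (simp add: wt_commute[of a b c] qlen_commute[of _ c] disc_perms(2)[of _ a b c] mult_ac)

lemma side_cosh_commute: "side_cosh G c u v = side_cosh G c v u"
  by (simp add: side_cosh_def hlen_def mult_ac)

lemma edge_wt_nonneg_pos:
  assumes "C1t a b c" "u \<in> udom G" "v \<in> udom G" "w \<in> udom G"
  shows "0 \<le> edge_wt G a b c u v w" "0 < edge_wt G a b c u v w + edge_wt G a c b u w v"
proof -
  have d: "kdom (kap G) (xi G u)" "kdom (kap G) (xi G v)" "kdom (kap G) (xi G w)" using assms om_xi by auto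
  have o: "0 < om G u" "0 < om G v" "0 < om G w" using assms om_xi by auto
  have dp: "0 < disc (kap G) a b c (xi G u) (xi G v) (xi G w)" "0 < disc (kap G) a c b (xi G u) (xi G w) (xi G v)"
    using disc_pos[OF assms(1) d] disc_perms(1) by metis+
  have q: "0 < qlen (kap G) c (xi G u) (xi G v)" "0 < qlen (kap G) b (xi G u) (xi G w)"
    using d assms(1) by (auto simp: kdom_def C1t_def intro!: qlen_pos)
  have p: "0 < xi G u" "0 < xi G v" "0 < xi G w" using d by (auto simp: kdom_def)
  have n: "0 \<le> edge_wt G a b c u v w" "0 \<le> edge_wt G a c b u w v"
    unfolding edge_wt_def mwt_def using wt_nonneg[OF assms(1), of "xi G u" "xi G v" "xi G w"]
     wt_nonneg[OF C1t_perms(1)[OF assms(1)], of "xi G u" "xi G w" "xi G v"] dp q o p by auto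
  then show "0 \<le> edge_wt G a b c u v w" by simp
  have "0 < edge_wt G a b c u v w \<or> 0 < edge_wt G a c b u w v"
    unfolding edge_wt_def mwt_def using wt_pos_or[OF assms(1) p] dp q o by auto
  then show "0 < edge_wt G a b c u v w + edge_wt G a c b u w v" using n by linarith
qed

lemma side_cosh_ge_1:
  assumes "-1 < c" "c \<le> 1" "u \<in> udom G" "v \<in> udom G"
  shows "1 \<le> side_cosh G c u v" "G = Hyp \<Longrightarrow> 1 < side_cosh G c u v"
  unfolding side_cosh_def using hlen_ge_1[OF om_xi(1)[OF assms(3)] om_xi(1)[OF assms(4)] om_xi(2,3)[OF assms(3)] om_xi(2,3)[OF assms(4)] assms(1,2)]
  by (auto simp: kap_def)

lemma th_deriv:
  assumes C: "C1t a b c" and u: "u + s * p \<in> udom G" "v + s * q \<in> udom G" "w + s * r \<in> udom G"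
  shows "((\<lambda>s. th G a b c (u + s * p) (v + s * q) (w + s * r)) has_real_derivative
     edge_wt G a b c (u + s * p) (v + s * q) (w + s * r) * (q - side_cosh G c (u + s * p) (v + s * q) * p)
     + edge_wt G a c b (u + s * p) (w + s * r) (v + s * q) * (r - side_cosh G b (u + s * p) (w + s * r) * p)) (at s)"
proof -
  have x: "((\<lambda>s. xi G (u + s * p)) has_real_derivative xi G (u + s * p) * om G (u + s * p) * p) (at s)"
    if "u + s * p \<in> udom G" for u p
    by (rule DERIV_chain2[where f = "xi G" and g = "\<lambda>s. u + s * p" and x = s, OF om_xi(4)[OF that]]) (auto intro!: derivative_eq_intros)
  show ?thesis unfolding th_def edge_wt_def side_cosh_def
    by (rule ang_deriv[OF C]) (use u om_xi x in auto)
qed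

section \<open>Uniform estimates on compact boxes\<close>

lemma compact_pos_lower:
  fixes f :: "'a::topological_space \<Rightarrow> real"
  assumes "compact K" "continuous_on K f" "\<And>x. x \<in> K \<Longrightarrow> 0 < f x"
  obtains m where "0 < m" "\<And>x. x \<in> K \<Longrightarrow> m \<le> f x"
proof (cases "K = {}")
  case False
  then obtain x where "x \<in> K" "\<forall>y\<in>K. f x \<le> f y" using continuous_attains_inf[OF assms(1) _ assms(2)] by blast
  then show ?thesis using assms(3) that by blast
qed (use that[of 1] in auto)

lemma continuous_on_edge_wt_side_cosh:
  assumes C: "C1t a b c" and I: "{lo..hi} \<subseteq> udom G"
  shows "continuous_on ({lo..hi} \<times> {lo..hi} \<times> {lo..hi}) (\<lambda>p. edge_wt G a b c (fst p) (fst (snd p)) (snd (snd p)))"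
    "continuous_on ({lo..hi} \<times> {lo..hi} \<times> {lo..hi}) (\<lambda>p. edge_wt G a c b (fst p) (snd (snd p)) (fst (snd p)))"
    "continuous_on ({lo..hi} \<times> {lo..hi} \<times> {lo..hi}) (\<lambda>p. side_cosh G c' (fst p) (fst (snd p)))"
    "continuous_on ({lo..hi} \<times> {lo..hi} \<times> {lo..hi}) (\<lambda>p. side_cosh G c' (fst p) (snd (snd p)))"
proof -
  let ?K = "{lo..hi} \<times> {lo..hi} \<times> {lo..hi}"
  have ne: "qlen (kap G) c (xi G (fst p)) (xi G (fst (snd p))) * sqrt (disc (kap G) a b c (xi G (fst p)) (xi G (fst (snd p))) (xi G (snd (snd p)))) \<noteq> 0"
    "qlen (kap G) b (xi G (fst p)) (xi G (snd (snd p))) * sqrt (disc (kap G) a c b (xi G (fst p)) (xi G (snd (snd p))) (xi G (fst (snd p)))) \<noteq> 0"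
    "om G (fst p) * om G (fst (snd p)) \<noteq> 0" "om G (fst p) * om G (snd (snd p)) \<noteq> 0"
    if p: "p \<in> ?K" for p
  proof -
    have u: "fst p \<in> udom G" "fst (snd p) \<in> udom G" "snd (snd p) \<in> udom G" using p I by auto
    have d: "kdom (kap G) (xi G (fst p))" "kdom (kap G) (xi G (fst (snd p)))" "kdom (kap G) (xi G (snd (snd p)))"
      using u om_xi by auto
    have dp: "0 < disc (kap G) a b c (xi G (fst p)) (xi G (fst (snd p))) (xi G (snd (snd p)))"
      "0 < disc (kap G) a c b (xi G (fst p)) (xi G (snd (snd p))) (xi G (fst (snd p)))"
      using disc_pos[OF C d] disc_pos[OF C1t_perms(1)[OF C] d(1,3,2)] by auto
    have q: "0 < qlen (kap G) c (xi G (fst p)) (xi G (fst (snd p)))" "0 < qlen (kap G) b (xi G (fst p)) (xi G (snd (snd p)))"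
      using d C by (auto simp: kdom_def C1t_def intro!: qlen_pos)
    show "qlen (kap G) c (xi G (fst p)) (xi G (fst (snd p))) * sqrt (disc (kap G) a b c (xi G (fst p)) (xi G (fst (snd p))) (xi G (snd (snd p)))) \<noteq> 0"
    "qlen (kap G) b (xi G (fst p)) (xi G (snd (snd p))) * sqrt (disc (kap G) a c b (xi G (fst p)) (xi G (snd (snd p))) (xi G (fst (snd p)))) \<noteq> 0"
      using dp q by auto
    show "om G (fst p) * om G (fst (snd p)) \<noteq> 0" "om G (fst p) * om G (snd (snd p)) \<noteq> 0"
      using om_xi(2)[OF u(1)] om_xi(2)[OF u(2)] om_xi(2)[OF u(3)] by auto
  qed
  show "continuous_on ?K (\<lambda>p. edge_wt G a b c (fst p) (fst (snd p)) (snd (snd p)))"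
    "continuous_on ?K (\<lambda>p. edge_wt G a c b (fst p) (snd (snd p)) (fst (snd p)))"
    "continuous_on ?K (\<lambda>p. side_cosh G c' (fst p) (fst (snd p)))"
    "continuous_on ?K (\<lambda>p. side_cosh G c' (fst p) (snd (snd p)))"
    unfolding edge_wt_def mwt_def side_cosh_def hlen_def
    by (intro continuous_intros ballI; erule ne)+
qed

text \<open>Only the sum of the two weights at a corner is bounded below: one of them may vanish,
  but by \<open>wt_pos_or\<close> not both.\<close>

lemma edge_wt_lower:
  assumes C: "C1t a b c" and I: "{lo..hi} \<subseteq> udom G"
  obtains m where "0 < m" "\<And>u v w. u \<in> {lo..hi} \<Longrightarrow> v \<in> {lo..hi} \<Longrightarrow> w \<in> {lo..hi} \<Longrightarrow>
     m \<le> edge_wt G a b c u v w + edge_wt G a c b u w v"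
proof -
  let ?K = "{lo..hi} \<times> {lo..hi} \<times> {lo..hi}"
  define f where "f = (\<lambda>p. edge_wt G a b c (fst p) (fst (snd p)) (snd (snd p)) + edge_wt G a c b (fst p) (snd (snd p)) (fst (snd p)))"
  have cont: "continuous_on ?K f" unfolding f_def
    by (intro continuous_intros continuous_on_edge_wt_side_cosh[OF C I])
  have pos: "0 < f p" if "p \<in> ?K" for p
    unfolding f_def using that I by (intro edge_wt_nonneg_pos(2)[OF C]) auto
  obtain m where m: "0 < m" "\<And>p. p \<in> ?K \<Longrightarrow> m \<le> f p"
    using compact_pos_lower[OF _ cont pos] by (metis compact_Times compact_Icc)
  show ?thesis by (rule that[OF m(1)]) (use m(2) in \<open>force simp: f_def\<close>)
qed

text \<open>In the hyperbolic case \<open>side_cosh - 1\<close> is positive, so at each corner the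
  diagonal entry strictly dominates the off-diagonal ones. This makes the quadratic form definite
  and not merely definite modulo constants.\<close>

lemma edge_wt_side_cosh_lower:
  assumes C: "C1t a b c" and I: "{lo..hi} \<subseteq> udom Hyp"
  obtains m where "0 < m" "\<And>u v w. u \<in> {lo..hi} \<Longrightarrow> v \<in> {lo..hi} \<Longrightarrow> w \<in> {lo..hi} \<Longrightarrow>
     m \<le> edge_wt Hyp a b c u v w * (side_cosh Hyp c u v - 1) + edge_wt Hyp a c b u w v * (side_cosh Hyp b u w - 1)"
proof -
  let ?K = "{lo..hi} \<times> {lo..hi} \<times> {lo..hi}"
  define f where "f = (\<lambda>p. edge_wt Hyp a b c (fst p) (fst (snd p)) (snd (snd p)) * (side_cosh Hyp c (fst p) (fst (snd p)) - 1)
      + edge_wt Hyp a c b (fst p) (snd (snd p)) (fst (snd p)) * (side_cosh Hyp b (fst p) (snd (snd p)) - 1))"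
  have cont: "continuous_on ?K f" unfolding f_def
    by (intro continuous_intros continuous_on_edge_wt_side_cosh[OF C I])
  have pos: "0 < f p" if "p \<in> ?K" for p
  proof -
    have u: "fst p \<in> udom Hyp" "fst (snd p) \<in> udom Hyp" "snd (snd p) \<in> udom Hyp" using that I by auto
    have bnd: "-1 < b" "b \<le> 1" "-1 < c" "c \<le> 1" using C by (auto simp: C1t_def)
    define m1 m2 h1 h2 where m: "m1 = edge_wt Hyp a b c (fst p) (fst (snd p)) (snd (snd p))"
      "m2 = edge_wt Hyp a c b (fst p) (snd (snd p)) (fst (snd p))"
      "h1 = side_cosh Hyp c (fst p) (fst (snd p)) - 1" "h2 = side_cosh Hyp b (fst p) (snd (snd p)) - 1"
    have "0 < h1" "0 < h2" "0 \<le> m1" "0 \<le> m2" "0 < m1 + m2"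
      unfolding m using side_cosh_ge_1(2)[OF bnd(3,4) u(1,2)] side_cosh_ge_1(2)[OF bnd(1,2) u(1,3)]
        edge_wt_nonneg_pos[OF C u] edge_wt_nonneg_pos(1)[OF C1t_perms(1)[OF C] u(1,3,2)] by auto
    then have "0 < m1 * h1 + m2 * h2"
      by (smt (verit) mult_pos_pos mult_nonneg_nonneg)
    then show ?thesis unfolding m f_def .
  qed
  obtain m where m: "0 < m" "\<And>p. p \<in> ?K \<Longrightarrow> m \<le> f p"
    using compact_pos_lower[OF _ cont pos] by (metis compact_Times compact_Icc)
  show ?thesis by (rule that[OF m(1)]) (use m(2) in \<open>force simp: f_def\<close>)
qed

lemma segment_in_Icc:
  fixes x x' s lo hi :: real
  assumes "x \<in> {lo..hi}" "x' \<in> {lo..hi}" "0 \<le> s" "s \<le> 1"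
  shows "x' + s * (x - x') \<in> {lo..hi}"
proof -
  have "(1 - s) *\<^sub>R x' + s *\<^sub>R x \<in> {lo..hi}"
    using assms by (intro convexD[OF convex_real_interval(5)]) auto
  then show ?thesis by (simp add: algebra_simps)
qed

lemma th_lipschitz:
  assumes C: "C1t a b c" and I: "{lo..hi} \<subseteq> udom G"
  obtains L where "0 \<le> L" "\<And>u v w u' v' w'. u \<in> {lo..hi} \<Longrightarrow> v \<in> {lo..hi} \<Longrightarrow> w \<in> {lo..hi} \<Longrightarrow>
     u' \<in> {lo..hi} \<Longrightarrow> v' \<in> {lo..hi} \<Longrightarrow> w' \<in> {lo..hi} \<Longrightarrow>
     \<bar>th G a b c u v w - th G a b c u' v' w'\<bar> \<le> L * (\<bar>u - u'\<bar> + \<bar>v - v'\<bar> + \<bar>w - w'\<bar>)"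
proof -
  let ?K = "{lo..hi} \<times> {lo..hi} \<times> {lo..hi}"
  \<comment> \<open>By \<open>th_deriv\<close> this dominates the derivative of the angle along a
    segment, per unit of total absolute velocity.\<close>
  define f where "f = (\<lambda>p. \<bar>edge_wt G a b c (fst p) (fst (snd p)) (snd (snd p))\<bar> * (1 + \<bar>side_cosh G c (fst p) (fst (snd p))\<bar>)
      + \<bar>edge_wt G a c b (fst p) (snd (snd p)) (fst (snd p))\<bar> * (1 + \<bar>side_cosh G b (fst p) (snd (snd p))\<bar>))"
  have "compact (f ` ?K)"
    unfolding f_def by (intro compact_continuous_image continuous_intros continuous_on_edge_wt_side_cosh[OF C I] compact_Times compact_Icc)
  then have "bounded (f ` ?K)" by (rule compact_imp_bounded)
  then obtain L where L: "\<And>p. p \<in> ?K \<Longrightarrow> \<bar>f p\<bar> \<le> L" unfolding bounded_iff by auto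
  show ?thesis
  proof (rule that[of "max L 0"])
    fix u v w u' v' w' assume h: "u \<in> {lo..hi}" "v \<in> {lo..hi}" "w \<in> {lo..hi}" "u' \<in> {lo..hi}" "v' \<in> {lo..hi}" "w' \<in> {lo..hi}"
    define p q r where d: "p = u - u'" "q = v - v'" "r = w - w'"
    define g where "g = (\<lambda>s. th G a b c (u' + s * p) (v' + s * q) (w' + s * r))"
    have ins: "u' + s * p \<in> {lo..hi}" "v' + s * q \<in> {lo..hi}" "w' + s * r \<in> {lo..hi}" if "0 \<le> s" "s \<le> 1" for s
      unfolding d using segment_in_Icc[OF _ _ that] h by auto
    define g' where "g' = (\<lambda>s. edge_wt G a b c (u' + s * p) (v' + s * q) (w' + s * r) * (q - side_cosh G c (u' + s * p) (v' + s * q) * p)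
     + edge_wt G a c b (u' + s * p) (w' + s * r) (v' + s * q) * (r - side_cosh G b (u' + s * p) (w' + s * r) * p))"
    have "\<exists>s. 0 < s \<and> s < 1 \<and> g 1 - g 0 = (1 - 0) * g' s"
    proof (rule MVT2)
      fix s :: real assume "0 \<le> s" "s \<le> 1"
      then show "(g has_real_derivative g' s) (at s)"
        unfolding g_def g'_def using ins[of s] I by (intro th_deriv[OF C]) auto
    qed simp
    then obtain s where s: "0 < s" "s < 1" "g 1 - g 0 = g' s" by auto
    define m1 m2 h1 h2 where m: "m1 = edge_wt G a b c (u' + s * p) (v' + s * q) (w' + s * r)"
      "m2 = edge_wt G a c b (u' + s * p) (w' + s * r) (v' + s * q)"
      "h1 = side_cosh G c (u' + s * p) (v' + s * q)" "h2 = side_cosh G b (u' + s * p) (w' + s * r)"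
    define S where "S = \<bar>p\<bar> + \<bar>q\<bar> + \<bar>r\<bar>"
    have b: "\<bar>m1\<bar> * (1 + \<bar>h1\<bar>) + \<bar>m2\<bar> * (1 + \<bar>h2\<bar>) \<le> L"
      using L[of "(u' + s * p, v' + s * q, w' + s * r)"] ins[of s] s by (simp add: f_def m)
    have e: "\<bar>q - h1 * p\<bar> \<le> (1 + \<bar>h1\<bar>) * S" "\<bar>r - h2 * p\<bar> \<le> (1 + \<bar>h2\<bar>) * S"
    proof -
      have *: "\<bar>q - h * p\<bar> \<le> (1 + \<bar>h\<bar>) * S" if "\<bar>q\<bar> \<le> S" "\<bar>p\<bar> \<le> S" for q h
      proof -
        have "\<bar>q - h * p\<bar> \<le> \<bar>q\<bar> + \<bar>h\<bar> * \<bar>p\<bar>" using abs_triangle_ineq4[of q "h * p"] by (simp add: abs_mult)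
        also have "\<dots> \<le> S + \<bar>h\<bar> * S" using that by (intro add_mono mult_left_mono) auto
        finally show ?thesis by (simp add: algebra_simps)
      qed
      show "\<bar>q - h1 * p\<bar> \<le> (1 + \<bar>h1\<bar>) * S" "\<bar>r - h2 * p\<bar> \<le> (1 + \<bar>h2\<bar>) * S"
        by (intro *; simp add: S_def)+
    qed
    have "\<bar>g 1 - g 0\<bar> \<le> \<bar>m1\<bar> * \<bar>q - h1 * p\<bar> + \<bar>m2\<bar> * \<bar>r - h2 * p\<bar>"
      unfolding s(3) g'_def m[symmetric] by (simp only: abs_mult[symmetric] abs_triangle_ineq)
    also have "\<dots> \<le> \<bar>m1\<bar> * ((1 + \<bar>h1\<bar>) * S) + \<bar>m2\<bar> * ((1 + \<bar>h2\<bar>) * S)"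
      using e by (intro add_mono mult_left_mono) auto
    also have "\<dots> = (\<bar>m1\<bar> * (1 + \<bar>h1\<bar>) + \<bar>m2\<bar> * (1 + \<bar>h2\<bar>)) * S" by (simp add: algebra_simps)
    also have "\<dots> \<le> max L 0 * S" using b by (intro mult_right_mono) (auto simp: S_def)
    finally show "\<bar>th G a b c u v w - th G a b c u' v' w'\<bar> \<le> max L 0 * (\<bar>u - u'\<bar> + \<bar>v - v'\<bar> + \<bar>w - w'\<bar>)"
      by (simp add: g_def S_def d)
  qed simp
qed

text \<open>In Euclidean geometry, adding a constant to all three logarithmic coordinates is a
  similarity and keeps the angles, so only differences can be controlled there.\<close>

definition dq :: "geom \<Rightarrow> real \<Rightarrow> real \<Rightarrow> real \<Rightarrow> real" where
  "dq G p q r = (case G of Hyp \<Rightarrow> p\<^sup>2 + q\<^sup>2 + r\<^sup>2 | Euc \<Rightarrow> (p - q)\<^sup>2 + (p - r)\<^sup>2 + (q - r)\<^sup>2)"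

lemma dq_nonneg: "0 \<le> dq G p q r"
  by (cases G) (auto simp: dq_def)

text \<open>Since every two weights add up to at least \<open>m\<close>, at least two of the three
  are \<open>\<ge> m / 2\<close>. The square with the third weight is at most twice the sum of the
  other two because \<open>x + y + z = 0\<close>; this gives \<open>6 = 2 * 3\<close>.\<close>

lemma two_large_weights:
  fixes x y z :: real
  assumes "0 \<le> m1" "0 \<le> m2" "0 \<le> m3" "0 \<le> m" "m \<le> m1 + m2" "m \<le> m1 + m3" "m \<le> m2 + m3" "x + y + z = 0"
  shows "m / 6 * (x\<^sup>2 + y\<^sup>2 + z\<^sup>2) \<le> m1 * x\<^sup>2 + m2 * y\<^sup>2 + m3 * z\<^sup>2"
proof -
  have key: "m / 6 * (x\<^sup>2 + y\<^sup>2 + z\<^sup>2) \<le> m1 * x\<^sup>2 + m2 * y\<^sup>2 + m3 * z\<^sup>2"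
    if "m / 2 \<le> m1" "m / 2 \<le> m2" "0 \<le> m3" "x + y + z = 0" for x y z m1 m2 m3 :: real
  proof -
    have z: "z\<^sup>2 = (x + y)\<^sup>2" using that(4) by (metis add_eq_0_iff power2_minus)
    have "x\<^sup>2 + y\<^sup>2 + z\<^sup>2 \<le> 3 * (x\<^sup>2 + y\<^sup>2)"
      unfolding z using zero_le_power2[of "x - y"] by (simp add: power2_eq_square algebra_simps)
    then have "m / 6 * (x\<^sup>2 + y\<^sup>2 + z\<^sup>2) \<le> m / 6 * (3 * (x\<^sup>2 + y\<^sup>2))" using assms(4) by (intro mult_left_mono) auto
    also have "\<dots> = m / 2 * x\<^sup>2 + m / 2 * y\<^sup>2" by (simp add: algebra_simps)
    also have "\<dots> \<le> m1 * x\<^sup>2 + m2 * y\<^sup>2" using that by (intro add_mono mult_right_mono) auto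
    also have "\<dots> \<le> m1 * x\<^sup>2 + m2 * y\<^sup>2 + m3 * z\<^sup>2" using that by simp
    finally show ?thesis .
  qed
  consider "m / 2 \<le> m1" "m / 2 \<le> m2" | "m / 2 \<le> m1" "m / 2 \<le> m3" | "m / 2 \<le> m2" "m / 2 \<le> m3"
    using assms(5-7) by argo
  then show ?thesis
  proof cases
    case 1 then show ?thesis using key[of m1 m2 m3 x y z] assms by simp
  next
    case 2 then show ?thesis using key[of m1 m3 m2 x z y] assms by (simp add: algebra_simps)
  next
    case 3 then show ?thesis using key[of m2 m3 m1 y z x] assms by (simp add: algebra_simps)
  qed
qed

text \<open>Along a segment in direction \<open>(p, q, r)\<close> the angle sum weighted by \<open>p\<close>, \<open>q\<close>, \<open>r\<close> has derivative
  \<open>- \<Sum> M ((p - q)\<^sup>2 + (h - 1) (p\<^sup>2 + q\<^sup>2))\<close>, summed over the edges, where \<open>M\<close> is the weight of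
  the edge and \<open>h\<close> the hyperbolic cosine of its length.\<close>

lemma face_dissip:
  assumes C: "C1t a b c" and I: "{lo..hi} \<subseteq> udom G"
  obtains m where "0 < m" "\<And>u v w u' v' w'. u \<in> {lo..hi} \<Longrightarrow> v \<in> {lo..hi} \<Longrightarrow> w \<in> {lo..hi} \<Longrightarrow>
     u' \<in> {lo..hi} \<Longrightarrow> v' \<in> {lo..hi} \<Longrightarrow> w' \<in> {lo..hi} \<Longrightarrow>
     (u - u') * (th G a b c u v w - th G a b c u' v' w')
     + (v - v') * (th G b a c v u w - th G b a c v' u' w')
     + (w - w') * (th G c a b w u v - th G c a b w' u' v')
     \<le> - m * dq G (u - u') (v - v') (w - w')"
proof -
  note C' = C1t_perms[OF C]
  have C23: "C1t b c a" by (rule C1t_perms(1)[OF C'(2)])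
  obtain m where m: "0 < m" and mle: "\<And>u v w p q r. u \<in> {lo..hi} \<Longrightarrow> v \<in> {lo..hi} \<Longrightarrow> w \<in> {lo..hi} \<Longrightarrow>
     m * dq G p q r \<le>
        edge_wt G a b c u v w * ((p - q)\<^sup>2 + (side_cosh G c u v - 1) * (p\<^sup>2 + q\<^sup>2))
      + edge_wt G a c b u w v * ((p - r)\<^sup>2 + (side_cosh G b u w - 1) * (p\<^sup>2 + r\<^sup>2))
      + edge_wt G b c a v w u * ((q - r)\<^sup>2 + (side_cosh G a v w - 1) * (q\<^sup>2 + r\<^sup>2))"
  proof (cases G)
    case Hyp
    obtain m1 where m1: "0 < m1" "\<And>u v w. u \<in> {lo..hi} \<Longrightarrow> v \<in> {lo..hi} \<Longrightarrow> w \<in> {lo..hi} \<Longrightarrow>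
       m1 \<le> edge_wt Hyp a b c u v w * (side_cosh Hyp c u v - 1) + edge_wt Hyp a c b u w v * (side_cosh Hyp b u w - 1)"
      using edge_wt_side_cosh_lower[OF C I[unfolded Hyp]] by blast
    obtain m2 where m2: "0 < m2" "\<And>u v w. u \<in> {lo..hi} \<Longrightarrow> v \<in> {lo..hi} \<Longrightarrow> w \<in> {lo..hi} \<Longrightarrow>
       m2 \<le> edge_wt Hyp b a c v u w * (side_cosh Hyp c v u - 1) + edge_wt Hyp b c a v w u * (side_cosh Hyp a v w - 1)"
      using edge_wt_side_cosh_lower[OF C'(2) I[unfolded Hyp]] by metis
    obtain m3 where m3: "0 < m3" "\<And>u v w. u \<in> {lo..hi} \<Longrightarrow> v \<in> {lo..hi} \<Longrightarrow> w \<in> {lo..hi} \<Longrightarrow>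
       m3 \<le> edge_wt Hyp c a b w u v * (side_cosh Hyp b w u - 1) + edge_wt Hyp c b a w v u * (side_cosh Hyp a w v - 1)"
      using edge_wt_side_cosh_lower[OF C'(3) I[unfolded Hyp]] by metis
    show ?thesis
    proof (rule that[of "min m1 (min m2 m3)"])
      show "0 < min m1 (min m2 m3)" using m1 m2 m3 by simp
      fix u v w p q r assume h: "u \<in> {lo..hi}" "v \<in> {lo..hi}" "w \<in> {lo..hi}"
      then have ud: "u \<in> udom G" "v \<in> udom G" "w \<in> udom G" using I by auto
      define M1 M2 M3 h1 h2 h3 where d: "M1 = edge_wt Hyp a b c u v w" "M2 = edge_wt Hyp a c b u w v" "M3 = edge_wt Hyp b c a v w u"
        "h1 = side_cosh Hyp c u v - 1" "h2 = side_cosh Hyp b u w - 1" "h3 = side_cosh Hyp a v w - 1"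
      have sym: "edge_wt Hyp b a c v u w = M1" "edge_wt Hyp c a b w u v = M2" "edge_wt Hyp c b a w v u = M3"
        "side_cosh Hyp c v u - 1 = h1" "side_cosh Hyp b w u - 1 = h2" "side_cosh Hyp a w v - 1 = h3"
        unfolding d by (simp_all only: edge_wt_commute[of _ b a c] edge_wt_commute[of _ c a b] edge_wt_commute[of _ c b a] side_cosh_commute[of _ c v] side_cosh_commute[of _ b w] side_cosh_commute[of _ a w])
      have l: "m1 \<le> M1 * h1 + M2 * h2" "m2 \<le> M1 * h1 + M3 * h3" "m3 \<le> M2 * h2 + M3 * h3"
        using m1(2)[OF h] m2(2)[OF h] m3(2)[OF h] unfolding sym by (simp_all add: d)
      have Mn: "0 \<le> M1" "0 \<le> M2" "0 \<le> M3"
        using edge_wt_nonneg_pos(1)[OF C ud] edge_wt_nonneg_pos(1)[OF C'(1) ud(1,3,2)] edge_wt_nonneg_pos(1)[OF C23 ud(2,3,1)] Hyp by (auto simp: d)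
      \<comment> \<open>Each corner bound pays for the square of its own coordinate. Regrouped by
        edges the products give the excess terms, and the squares of differences are only added with
        nonnegative weights.\<close>
      have "min m1 (min m2 m3) * dq G p q r \<le> m1 * p\<^sup>2 + m2 * q\<^sup>2 + m3 * r\<^sup>2"
        unfolding dq_def Hyp geom.case distrib_left by (intro add_mono mult_right_mono) auto
      also have "\<dots> \<le> (M1 * h1 + M2 * h2) * p\<^sup>2 + (M1 * h1 + M3 * h3) * q\<^sup>2 + (M2 * h2 + M3 * h3) * r\<^sup>2"
        using l by (intro add_mono mult_right_mono) auto
      also have "\<dots> \<le> M1 * ((p - q)\<^sup>2 + h1 * (p\<^sup>2 + q\<^sup>2)) + M2 * ((p - r)\<^sup>2 + h2 * (p\<^sup>2 + r\<^sup>2))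
         + M3 * ((q - r)\<^sup>2 + h3 * (q\<^sup>2 + r\<^sup>2))"
      proof -
        have "0 \<le> M1 * (p - q)\<^sup>2 + M2 * (p - r)\<^sup>2 + M3 * (q - r)\<^sup>2" using Mn by simp
        then show ?thesis by (simp add: algebra_simps)
      qed
      finally show "min m1 (min m2 m3) * dq G p q r \<le>
        edge_wt G a b c u v w * ((p - q)\<^sup>2 + (side_cosh G c u v - 1) * (p\<^sup>2 + q\<^sup>2))
      + edge_wt G a c b u w v * ((p - r)\<^sup>2 + (side_cosh G b u w - 1) * (p\<^sup>2 + r\<^sup>2))
      + edge_wt G b c a v w u * ((q - r)\<^sup>2 + (side_cosh G a v w - 1) * (q\<^sup>2 + r\<^sup>2))"
        unfolding Hyp d .
    qed
  next
    case Euc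
    obtain m1 where m1: "0 < m1" "\<And>u v w. u \<in> {lo..hi} \<Longrightarrow> v \<in> {lo..hi} \<Longrightarrow> w \<in> {lo..hi} \<Longrightarrow>
       m1 \<le> edge_wt G a b c u v w + edge_wt G a c b u w v"
      using edge_wt_lower[OF C I] by blast
    obtain m2 where m2: "0 < m2" "\<And>u v w. u \<in> {lo..hi} \<Longrightarrow> v \<in> {lo..hi} \<Longrightarrow> w \<in> {lo..hi} \<Longrightarrow>
       m2 \<le> edge_wt G b a c v u w + edge_wt G b c a v w u"
      using edge_wt_lower[OF C'(2) I] by metis
    obtain m3 where m3: "0 < m3" "\<And>u v w. u \<in> {lo..hi} \<Longrightarrow> v \<in> {lo..hi} \<Longrightarrow> w \<in> {lo..hi} \<Longrightarrow>
       m3 \<le> edge_wt G c a b w u v + edge_wt G c b a w v u"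
      using edge_wt_lower[OF C'(3) I] by metis
    show ?thesis
    proof (rule that[of "min m1 (min m2 m3) / 6"])
      show "0 < min m1 (min m2 m3) / 6" using m1 m2 m3 by simp
      fix u v w p q r assume h: "u \<in> {lo..hi}" "v \<in> {lo..hi}" "w \<in> {lo..hi}"
      then have ud: "u \<in> udom G" "v \<in> udom G" "w \<in> udom G" using I by auto
      have H1: "side_cosh G x y z = 1" for x y z by (simp add: side_cosh_def hlen_def Euc kap_def om_def)
      define M1 M2 M3 where d: "M1 = edge_wt G a b c u v w" "M2 = edge_wt G a c b u w v" "M3 = edge_wt G b c a v w u"
      have sym: "edge_wt G b a c v u w = M1" "edge_wt G c a b w u v = M2" "edge_wt G c b a w v u = M3"
        unfolding d by (simp_all only: edge_wt_commute[of _ b a c] edge_wt_commute[of _ c a b] edge_wt_commute[of _ c b a])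
      have l: "m1 \<le> M1 + M2" "m2 \<le> M1 + M3" "m3 \<le> M2 + M3"
        using m1(2)[OF h] m2(2)[OF h] m3(2)[OF h] unfolding sym by (simp_all add: d)
      have Mn: "0 \<le> M1" "0 \<le> M2" "0 \<le> M3"
        using edge_wt_nonneg_pos(1)[OF C ud] edge_wt_nonneg_pos(1)[OF C'(1) ud(1,3,2)] edge_wt_nonneg_pos(1)[OF C23 ud(2,3,1)] by (auto simp: d)
      \<comment> \<open>The differences are oriented cyclically so that they sum to 0, as
        \<open>two_large_weights\<close> requires.\<close>
      have "min m1 (min m2 m3) / 6 * ((p - q)\<^sup>2 + (r - p)\<^sup>2 + (q - r)\<^sup>2)
          \<le> M1 * (p - q)\<^sup>2 + M2 * (r - p)\<^sup>2 + M3 * (q - r)\<^sup>2"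
        by (rule two_large_weights) (use Mn l m1(1) m2(1) m3(1) in auto)
      then show "min m1 (min m2 m3) / 6 * dq G p q r \<le>
        edge_wt G a b c u v w * ((p - q)\<^sup>2 + (side_cosh G c u v - 1) * (p\<^sup>2 + q\<^sup>2))
      + edge_wt G a c b u w v * ((p - r)\<^sup>2 + (side_cosh G b u w - 1) * (p\<^sup>2 + r\<^sup>2))
      + edge_wt G b c a v w u * ((q - r)\<^sup>2 + (side_cosh G a v w - 1) * (q\<^sup>2 + r\<^sup>2))"
        unfolding H1 d[symmetric] power2_commute[of r p] by (simp add: dq_def Euc)
    qed
  qed
  show ?thesis
  proof (rule that[OF m])
    fix u v w u' v' w' assume h: "u \<in> {lo..hi}" "v \<in> {lo..hi}" "w \<in> {lo..hi}" "u' \<in> {lo..hi}" "v' \<in> {lo..hi}" "w' \<in> {lo..hi}"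
    define p q r where d: "p = u - u'" "q = v - v'" "r = w - w'"
    \<comment> \<open>Pairing the angles with the fixed direction turns the vector estimate into the
      mean value theorem for one real function.\<close>
    define g where "g = (\<lambda>s. p * th G a b c (u' + s * p) (v' + s * q) (w' + s * r)
       + q * th G b a c (v' + s * q) (u' + s * p) (w' + s * r)
       + r * th G c a b (w' + s * r) (u' + s * p) (v' + s * q))"
    have ins: "u' + s * p \<in> {lo..hi}" "v' + s * q \<in> {lo..hi}" "w' + s * r \<in> {lo..hi}" if "0 \<le> s" "s \<le> 1" for s
      unfolding d using segment_in_Icc[OF _ _ that] h by auto
    have dg: "\<exists>g'. (g has_real_derivative g') (at s) \<and> g' \<le> - m * dq G p q r" if s: "0 \<le> s" "s \<le> 1" for s
    proof -
      define x y z where xyz: "x = u' + s * p" "y = v' + s * q" "z = w' + s * r"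
      have xi: "x \<in> {lo..hi}" "y \<in> {lo..hi}" "z \<in> {lo..hi}" unfolding xyz using ins s by auto
      then have ud: "x \<in> udom G" "y \<in> udom G" "z \<in> udom G" using I by auto
      define g' where "g' = p * (edge_wt G a b c x y z * (q - side_cosh G c x y * p) + edge_wt G a c b x z y * (r - side_cosh G b x z * p))
        + q * (edge_wt G b a c y x z * (p - side_cosh G c y x * q) + edge_wt G b c a y z x * (r - side_cosh G a y z * q))
        + r * (edge_wt G c a b z x y * (p - side_cosh G b z x * r) + edge_wt G c b a z y x * (q - side_cosh G a z y * r))"
      have "(g has_real_derivative g') (at s)"
        unfolding g_def g'_def xyz
        by (intro DERIV_add DERIV_cmult th_deriv C C'(2) C'(3) ud[unfolded xyz])
      moreover have "g' = - (edge_wt G a b c x y z * ((p - q)\<^sup>2 + (side_cosh G c x y - 1) * (p\<^sup>2 + q\<^sup>2))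
      + edge_wt G a c b x z y * ((p - r)\<^sup>2 + (side_cosh G b x z - 1) * (p\<^sup>2 + r\<^sup>2))
      + edge_wt G b c a y z x * ((q - r)\<^sup>2 + (side_cosh G a y z - 1) * (q\<^sup>2 + r\<^sup>2)))"
        unfolding g'_def edge_wt_commute[of G b a c y x z] edge_wt_commute[of G c a b z x y] edge_wt_commute[of G c b a z y x]
          side_cosh_commute[of G c y x] side_cosh_commute[of G b z x] side_cosh_commute[of G a z y]
        by (simp add: power2_eq_square algebra_simps)
      ultimately show ?thesis using mle[OF xi, of p q r] by auto
    qed
    obtain g' where g': "\<And>s. 0 \<le> s \<Longrightarrow> s \<le> 1 \<Longrightarrow> (g has_real_derivative g' s) (at s) \<and> g' s \<le> - m * dq G p q r"
      using dg by metis
    have "\<exists>z>0. z < 1 \<and> g 1 - g 0 = (1 - 0) * g' z"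
      by (rule MVT2) (use g' in auto)
    then have "g 1 - g 0 \<le> - m * dq G p q r" using g' by force
    then show "(u - u') * (th G a b c u v w - th G a b c u' v' w')
     + (v - v') * (th G b a c v u w - th G b a c v' u' w')
     + (w - w') * (th G c a b w u v - th G c a b w' u' v')
     \<le> - m * dq G (u - u') (v - v') (w - w')"
      by (simp add: g_def d algebra_simps)
  qed
qed

text \<open>The six values span a compact box inside the domain, to which \<open>face_dissip\<close>
  applies; its constant is discarded. Thus no common bounds on two solutions are required when
  uniqueness is proved.\<close>

lemma face_monotone:
  assumes C: "C1t a b c" and ud: "{u, v, w, u', v', w'} \<subseteq> udom G"
  shows "(u - u') * (th G a b c u v w - th G a b c u' v' w')
     + (v - v') * (th G b a c v u w - th G b a c v' u' w')
     + (w - w') * (th G c a b w u v - th G c a b w' u' v') \<le> 0"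
proof -
  define lo hi where lh: "lo = Min {u, v, w, u', v', w'}" "hi = Max {u, v, w, u', v', w'}"
  have "lo \<in> {u, v, w, u', v', w'}" "hi \<in> {u, v, w, u', v', w'}"
    unfolding lh by (rule Min_in Max_in; simp)+
  then have I: "{lo..hi} \<subseteq> udom G" using ud by (intro udom_interval) auto
  have "{u, v, w, u', v', w'} \<subseteq> {lo..hi}" unfolding lh by (auto simp del: Min_insert Max_insert)
  moreover obtain m where "0 < m" "\<And>u v w u' v' w'. u \<in> {lo..hi} \<Longrightarrow> v \<in> {lo..hi} \<Longrightarrow> w \<in> {lo..hi} \<Longrightarrow>
     u' \<in> {lo..hi} \<Longrightarrow> v' \<in> {lo..hi} \<Longrightarrow> w' \<in> {lo..hi} \<Longrightarrow>
     (u - u') * (th G a b c u v w - th G a b c u' v' w')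
     + (v - v') * (th G b a c v u w - th G b a c v' u' w')
     + (w - w') * (th G c a b w u v - th G c a b w' u' v')
     \<le> - m * dq G (u - u') (v - v') (w - w')"
    using face_dissip[OF C I] by blast
  ultimately have "(u - u') * (th G a b c u v w - th G a b c u' v' w')
     + (v - v') * (th G b a c v u w - th G b a c v' u' w')
     + (w - w') * (th G c a b w u v - th G c a b w' u' v') \<le> - m * dq G (u - u') (v - v') (w - w')"
    by blast
  also have "\<dots> \<le> 0" using \<open>0 < m\<close> dq_nonneg[of G "u - u'" "v - v'" "w - w'"] by simp
  finally show ?thesis .
qed

section \<open>Angles when the logarithmic coordinates separate\<close>

text \<open>\<open>1 / cosh u\<close> is comparable to \<open>exp u\<close> for negative
  \<open>u\<close>. Hence differences of logarithmic coordinates control quotients of the values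
  \<open>xi\<close>.\<close>

lemma xi_bounds:
  assumes "u \<in> udom G"
  shows "exp u \<le> xi G u" "xi G u \<le> 2 * exp u"
proof -
  have "exp u \<le> 1 / cosh u \<and> 1 / cosh u \<le> 2 * exp u" if "u < 0"
  proof
    have "cosh u \<le> exp (- u)" using that by (simp add: cosh_def)
    moreover have "exp (- u) = 1 / exp u" by (simp add: exp_minus inverse_eq_divide)
    ultimately show "exp u \<le> 1 / cosh u" by (simp add: field_simps cosh_real_pos)
    have "exp (- u) / 2 \<le> cosh u" by (simp add: cosh_def)
    then show "1 / cosh u \<le> 2 * exp u" by (simp add: field_simps cosh_real_pos exp_minus)
  qed
  then show "exp u \<le> xi G u" "xi G u \<le> 2 * exp u" using assms by (cases G; simp add: xi_def udom_def)+
qed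

lemma xi_ratio_le:
  assumes "u \<in> udom G" "v \<in> udom G" "u \<le> v - D"
  shows "0 < xi G u / xi G v" "xi G u / xi G v \<le> 2 * exp (- D)"
proof -
  have p: "0 < xi G u" "0 < xi G v" using assms om_xi(1) by (auto simp: kdom_def)
  then show "0 < xi G u / xi G v" by simp
  have "xi G u \<le> 2 * exp u" using xi_bounds assms by simp
  also have "\<dots> \<le> 2 * exp (v - D)" using assms by simp
  also have "\<dots> = 2 * exp (- D) * exp v" by (simp add: exp_diff exp_minus field_simps)
  also have "\<dots> \<le> 2 * exp (- D) * xi G v" using xi_bounds(1)[OF assms(2)] by (intro mult_left_mono) auto
  finally show "xi G u / xi G v \<le> 2 * exp (- D)" using p by (simp add: field_simps)
qed

lemma kap_xi_le:
  assumes "u \<in> udom G" "G = Hyp \<longrightarrow> u \<le> - D"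
  shows "0 \<le> kap G * xi G u" "kap G * xi G u \<le> 2 * exp (- D)"
proof -
  have "0 < xi G u" using assms om_xi(1) by (auto simp: kdom_def)
  then show "0 \<le> kap G * xi G u" by (simp add: kap_def split: geom.split)
  show "kap G * xi G u \<le> 2 * exp (- D)"
  proof (cases G)
    case Hyp
    have "xi G u \<le> 2 * exp u" using xi_bounds assms by simp
    also have "\<dots> \<le> 2 * exp (- D)" using assms Hyp by simp
    finally show ?thesis by (simp add: Hyp kap_def)
  qed (simp add: kap_def)
qed

lemma exp_neg_nat_tendsto: "(\<lambda>n::nat. 2 * exp (- real n)) \<longlonglongrightarrow> 0"
  by real_asymp

lemma xi_ratio_tendsto:
  fixes u v :: "nat \<Rightarrow> real"
  assumes "\<And>n. u n \<in> udom G" "\<And>n. v n \<in> udom G" "\<And>n. u n \<le> v n - real n"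
  shows "(\<lambda>n. xi G (u n) / xi G (v n)) \<longlonglongrightarrow> 0"
  by (rule tendsto_sandwich[OF _ _ tendsto_const exp_neg_nat_tendsto])
    (use xi_ratio_le[OF assms] less_imp_le in \<open>auto intro!: always_eventually\<close>)

lemma kap_xi_tendsto:
  fixes u v :: "nat \<Rightarrow> real"
  assumes "\<And>n. u n \<in> udom G" "\<And>n. v n \<in> udom G" "\<And>n. G = Hyp \<longrightarrow> u n \<le> - real n" "\<And>n. G = Hyp \<longrightarrow> v n \<le> - real n"
  shows "(\<lambda>n. kap G * xi G (u n) * xi G (v n)) \<longlonglongrightarrow> 0"
proof -
  have "(\<lambda>n. kap G * xi G (u n)) \<longlonglongrightarrow> 0" "(\<lambda>n. kap G * xi G (v n)) \<longlonglongrightarrow> 0"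
    using kap_xi_le[OF assms(1,3)] kap_xi_le[OF assms(2,4)]
    by (auto intro!: tendsto_sandwich[OF _ _ tendsto_const exp_neg_nat_tendsto] always_eventually)
  from tendsto_mult[OF this] have "(\<lambda>n. kap G * xi G (u n) * (kap G * xi G (v n))) \<longlonglongrightarrow> 0" by simp
  moreover have "kap G * xi G (u n) * (kap G * xi G (v n)) = kap G * xi G (u n) * xi G (v n)" for n
    by (simp add: kap_def split: geom.split)
  ultimately show ?thesis by simp
qed

text \<open>If the bound failed for arbitrarily large \<open>D\<close>, counterexamples for
  \<open>D \<ge> n\<close> would form a sequence satisfying \<open>P (real n)\<close> along which
  \<open>f\<close> stays away from \<open>l\<close>. Limits along sequences thus become bounds that
  are uniform in the three coordinates.\<close>

lemma eventually_gap_by_sequences: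
  fixes P :: "real \<Rightarrow> real \<Rightarrow> real \<Rightarrow> real \<Rightarrow> bool" and f :: "real \<Rightarrow> real \<Rightarrow> real \<Rightarrow> real"
  assumes mono: "\<And>D D' u v w. P D' u v w \<Longrightarrow> D \<le> D' \<Longrightarrow> P D u v w"
    and seq: "\<And>u v w. (\<And>n::nat. P (real n) (u n) (v n) (w n)) \<Longrightarrow> (\<lambda>n. f (u n) (v n) (w n)) \<longlonglongrightarrow> l"
    and e: "0 < e"
  shows "\<forall>\<^sub>F D in at_top. \<forall>u v w. P D u v w \<longrightarrow> l - e < f u v w"
proof (rule ccontr)
  assume "\<not> ?thesis"
  then have "\<forall>n::nat. \<exists>D\<ge>real n. \<exists>u v w. P D u v w \<and> \<not> l - e < f u v w"
    unfolding eventually_at_top_linorder by blast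
  then have "\<forall>n::nat. \<exists>u v w. P (real n) u v w \<and> \<not> l - e < f u v w" using mono by blast
  then obtain u v w where uvw: "\<And>n::nat. P (real n) (u n) (v n) (w n)" "\<And>n. \<not> l - e < f (u n) (v n) (w n)"
    by metis
  have "\<forall>\<^sub>F n in sequentially. l - e < f (u n) (v n) (w n)"
    using seq[of u v w, OF uvw(1)] e by (intro order_tendstoD(1)) auto
  then show False using uvw(2) by simp
qed

lemma th_link_lower:
  assumes C: "C1t a b c" and e: "0 < e"
  shows "\<forall>\<^sub>F D in at_top. \<forall>u v w. u \<in> udom G \<and> v \<in> udom G \<and> w \<in> udom G \<and> u \<le> v - D \<and> u \<le> w - D
     \<and> (G = Hyp \<longrightarrow> u \<le> - D) \<longrightarrow> arccos (- a) - e < th G a b c u v w"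
proof (rule eventually_gap_by_sequences[OF _ _ e])
  fix u v w :: "nat \<Rightarrow> real"
  assume *: "\<And>n. u n \<in> udom G \<and> v n \<in> udom G \<and> w n \<in> udom G \<and> u n \<le> v n - real n \<and> u n \<le> w n - real n
     \<and> (G = Hyp \<longrightarrow> u n \<le> - real n)"
  have ud: "\<And>n. u n \<in> udom G" "\<And>n. v n \<in> udom G" "\<And>n. w n \<in> udom G" using * by auto
  show "(\<lambda>n. th G a b c (u n) (v n) (w n)) \<longlonglongrightarrow> arccos (- a)"
    unfolding th_def
  proof (rule ang_tendsto_link[OF C om_xi(1)[OF ud(1)] om_xi(1)[OF ud(2)] om_xi(1)[OF ud(3)]])
    show "(\<lambda>n. xi G (u n) / xi G (v n)) \<longlonglongrightarrow> 0" "(\<lambda>n. xi G (u n) / xi G (w n)) \<longlonglongrightarrow> 0"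
      using * by (auto intro!: xi_ratio_tendsto)
    show "(\<lambda>n. kap G * (xi G (u n))\<^sup>2) \<longlonglongrightarrow> 0"
      using kap_xi_tendsto[of u G u] * by (simp add: power2_eq_square mult.assoc)
  qed
qed fastforce

text \<open>Two small radii make the side between them short, and the dual law of cosines for this
  one side drives the whole angle sum to \<open>pi\<close>, whatever the third radius is.\<close>

lemma th_sum_tendsto:
  fixes u v w :: "nat \<Rightarrow> real"
  assumes C: "C1t a b c" and ud: "\<And>n. u n \<in> udom G" "\<And>n. v n \<in> udom G" "\<And>n. w n \<in> udom G"
    and h: "\<And>n. G = Hyp \<longrightarrow> u n \<le> - real n" "\<And>n. G = Hyp \<longrightarrow> v n \<le> - real n"
  shows "(\<lambda>n. th G a b c (u n) (v n) (w n) + th G b a c (v n) (u n) (w n) + th G c a b (w n) (u n) (v n)) \<longlonglongrightarrow> pi"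
  unfolding th_def
proof (rule ang_sum_tendsto[OF C om_xi(1)[OF ud(1)] om_xi(1)[OF ud(2)] om_xi(1)[OF ud(3)]])
  show "(\<lambda>n. kap G * (xi G (u n))\<^sup>2) \<longlonglongrightarrow> 0" "(\<lambda>n. kap G * (xi G (v n))\<^sup>2) \<longlonglongrightarrow> 0"
    using kap_xi_tendsto[of u G u] kap_xi_tendsto[of v G v] ud h by (simp_all add: power2_eq_square mult.assoc)
  show "(\<lambda>n. kap G * xi G (u n) * xi G (v n)) \<longlonglongrightarrow> 0"
    using kap_xi_tendsto[of u G v] ud h by simp
qed

text \<open>The angle at the comparatively large circle tends to 0, so the limit \<open>pi\<close>
  of the full angle sum is left to the two shrinking corners.\<close>

lemma th_pair_lower:
  assumes C: "C1t a b c" and e: "0 < e"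
  shows "\<forall>\<^sub>F D in at_top. \<forall>u v w. u \<in> udom G \<and> v \<in> udom G \<and> w \<in> udom G \<and> u \<le> w - D \<and> v \<le> w - D
     \<and> (G = Hyp \<longrightarrow> u \<le> - D \<and> v \<le> - D) \<longrightarrow> pi - e < th G a b c u v w + th G b a c v u w"
proof (rule eventually_gap_by_sequences[OF _ _ e])
  fix u v w :: "nat \<Rightarrow> real"
  assume *: "\<And>n. u n \<in> udom G \<and> v n \<in> udom G \<and> w n \<in> udom G \<and> u n \<le> w n - real n \<and> v n \<le> w n - real n
     \<and> (G = Hyp \<longrightarrow> u n \<le> - real n \<and> v n \<le> - real n)"
  have ud: "\<And>n. u n \<in> udom G" "\<And>n. v n \<in> udom G" "\<And>n. w n \<in> udom G" using * by auto
  have k: "(\<lambda>n. kap G * (xi G (u n))\<^sup>2) \<longlonglongrightarrow> 0" "(\<lambda>n. kap G * (xi G (v n))\<^sup>2) \<longlonglongrightarrow> 0"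
    using kap_xi_tendsto[of u G u] kap_xi_tendsto[of v G v] * by (simp_all add: power2_eq_square mult.assoc)
  have "(\<lambda>n. th G c a b (w n) (u n) (v n)) \<longlonglongrightarrow> 0"
    unfolding th_def
  proof (rule ang_tendsto_0[OF C1t_perms(3)[OF C] om_xi(1)[OF ud(3)] om_xi(1)[OF ud(1)] om_xi(1)[OF ud(2)] _ _ k])
    show "(\<lambda>n. xi G (u n) / xi G (w n)) \<longlonglongrightarrow> 0" "(\<lambda>n. xi G (v n) / xi G (w n)) \<longlonglongrightarrow> 0"
      using * by (auto intro!: xi_ratio_tendsto)
    show "(\<lambda>n. kap G * xi G (u n) * xi G (v n)) \<longlonglongrightarrow> 0"
      using kap_xi_tendsto[of u G v] * by simp
  qed
  from tendsto_diff[OF th_sum_tendsto[OF C, of u G v w, OF ud] this]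
  show "(\<lambda>n. th G a b c (u n) (v n) (w n) + th G b a c (v n) (u n) (w n)) \<longlonglongrightarrow> pi"
    using * by simp
qed fastforce

lemma th_triple_lower:
  assumes C: "C1t a b c" and e: "0 < e"
  shows "\<forall>\<^sub>F D in at_top. \<forall>u v w. u \<in> udom G \<and> v \<in> udom G \<and> w \<in> udom G
     \<and> (G = Hyp \<longrightarrow> u \<le> - D \<and> v \<le> - D \<and> w \<le> - D) \<longrightarrow> pi - e < th G a b c u v w + th G b a c v u w + th G c a b w u v"
proof (rule eventually_gap_by_sequences[OF _ _ e])
  fix u v w :: "nat \<Rightarrow> real"
  assume *: "\<And>n. u n \<in> udom G \<and> v n \<in> udom G \<and> w n \<in> udom G \<and> (G = Hyp \<longrightarrow> u n \<le> - real n \<and> v n \<le> - real n \<and> w n \<le> - real n)"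
  show "(\<lambda>n. th G a b c (u n) (v n) (w n) + th G b a c (v n) (u n) (w n) + th G c a b (w n) (u n) (v n)) \<longlonglongrightarrow> pi"
    by (rule th_sum_tendsto[OF C]) (use * in auto)
qed fastforce

lemma th_small_if_large:
  assumes C: "C1t a b c" and e: "0 < e"
  obtains \<beta> where "0 < \<beta>" "\<And>u v w. - \<beta> \<le> u \<Longrightarrow> u < 0 \<Longrightarrow> v < 0 \<Longrightarrow> w < 0 \<Longrightarrow> th Hyp a b c u v w < e"
proof -
  obtain x0 where x0: "0 < x0" "x0 < 1"
    "\<And>X Y Z. x0 \<le> X \<Longrightarrow> X < 1 \<Longrightarrow> 0 < Y \<Longrightarrow> Y < 1 \<Longrightarrow> 0 < Z \<Longrightarrow> Z < 1 \<Longrightarrow> ang 1 a b c X Y Z < e"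
    using ang_small_if_large[OF C e] by blast
  \<comment> \<open>\<open>1 / cosh u\<close> takes the value \<open>x0\<close> at
    \<open>u = - \<beta>\<close> and is larger between there and 0.\<close>
  define \<beta> where "\<beta> = arcosh (1 / x0)"
  have "1 < 1 / x0" using x0 by simp
  then have b: "0 < \<beta>" "cosh \<beta> = 1 / x0"
    unfolding \<beta>_def by (auto simp: arcosh_real_gt_1_iff cosh_arcosh_real) 
  have x1: "0 < 1 / cosh v" "1 / cosh v < 1" if "v < 0" for v :: real
    using om_xi(1)[of v Hyp] that by (auto simp: kdom_def udom_def kap_def xi_def abs_square_less_1 cosh_real_pos)
  show ?thesis
  proof (rule that[OF b(1)])
    fix u v w :: real assume h: "- \<beta> \<le> u" "u < 0" "v < 0" "w < 0"
    have "cosh (- u) \<le> cosh \<beta>" using h b by (subst cosh_real_nonneg_le_iff) auto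
    then have "x0 \<le> 1 / cosh u" using b x0 by (simp add: field_simps cosh_real_pos)
    then show "th Hyp a b c u v w < e"
      unfolding th_def kap_def xi_def geom.case using x1 h by (intro x0(3)) auto
  qed
qed

lemma th_range:
  assumes C: "C1t a b c" and ud: "u \<in> udom G" "v \<in> udom G" "w \<in> udom G"
  shows "0 < th G a b c u v w" "th G a b c u v w < pi" "th G a b c u v w < arccos (- a)"
    "th G a b c u v w + th G b a c v u w + th G c a b w u v \<le> pi"
    "G = Euc \<Longrightarrow> th G a b c u v w + th G b a c v u w + th G c a b w u v = pi"
    "\<bar>cos (th G a b c u v w)\<bar> < 1"
proof -
  note d = om_xi(1)[OF ud(1)] om_xi(1)[OF ud(2)] om_xi(1)[OF ud(3)]
  show r: "0 < th G a b c u v w" "th G a b c u v w < pi"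
    unfolding th_def using ang_cos_sin(3,4)[OF C d om_xi(2,3)[OF ud(1)]] by auto
  show "th G a b c u v w < arccos (- a)" "th G a b c u v w + th G b a c v u w + th G c a b w u v \<le> pi"
    unfolding th_def using ang_less[OF C d] ang_sum(1)[OF C d] by auto
  show "G = Euc \<Longrightarrow> th G a b c u v w + th G b a c v u w + th G c a b w u v = pi"
    unfolding th_def using ang_sum(2)[OF C d] by (simp add: kap_def)
  show "\<bar>cos (th G a b c u v w)\<bar> < 1"
    using r cos_monotone_0_pi[of 0 "th G a b c u v w"] cos_monotone_0_pi[of "th G a b c u v w" pi] by (simp add: abs_less_iff)
qed

section \<open>Counting cells of the triangulation\<close>

lemma rtrancl_crossing:
  assumes "(a, b) \<in> R\<^sup>*" "a \<in> A" "b \<notin> A"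
  obtains x y where "(x, y) \<in> R" "x \<in> A" "y \<notin> A"
  using assms by (induction rule: rtrancl_induct) blast+

text \<open>A tree is grown by one vertex and one edge at a time: by \<open>rtrancl_crossing\<close>
  some edge leaves any proper vertex subset, and it is new because the edges chosen so far stay
  inside. The bound is applied to vertex links.\<close>

lemma connected_graph_card_le:
  fixes N :: "'a set" and E :: "'a set set"
  assumes "finite N" "finite E" "N \<noteq> {}"
    and conn: "\<And>a b. a \<in> N \<Longrightarrow> b \<in> N \<Longrightarrow> (a, b) \<in> {(x, y). {x, y} \<in> E}\<^sup>*"
    and sub: "\<And>e. e \<in> E \<Longrightarrow> e \<subseteq> N"
  shows "card N \<le> card E + 1"
proof -
  have "1 \<le> k \<Longrightarrow> k \<le> card N \<Longrightarrow> \<exists>W F. W \<subseteq> N \<and> card W = k \<and> F \<subseteq> E \<and> card F + 1 = k \<and> (\<forall>e\<in>F. e \<subseteq> W)" for k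
  proof (induction k rule: nat_induct_at_least)
    case base
    obtain a where "a \<in> N" using assms(3) by blast
    then have "{a} \<subseteq> N \<and> card {a} = 1 \<and> {} \<subseteq> E \<and> card ({} :: 'a set set) + 1 = 1 \<and> (\<forall>e\<in>{}. e \<subseteq> {a})" by simp
    then show ?case by blast
  next
    case (Suc k)
    have "k \<le> card N" using Suc.prems by simp
    from Suc.IH[OF this] obtain W F where WF: "W \<subseteq> N" "card W = k" "F \<subseteq> E" "card F + 1 = k" "\<forall>e\<in>F. e \<subseteq> W"
      by blast
    have finW: "finite W" "finite F"
      using finite_subset[OF WF(1) assms(1)] finite_subset[OF WF(3) assms(2)] by simp_all
    have "W \<noteq> {}" using WF(2,4) by force
    moreover have "W \<noteq> N" using WF(2) Suc.prems by force
    ultimately obtain a b where ab: "a \<in> W" "b \<in> N" "b \<notin> W" using WF(1) by blast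
    then have "(a, b) \<in> {(x, y). {x, y} \<in> E}\<^sup>*" using conn WF(1) by blast
    then obtain x y where "(x, y) \<in> {(x, y). {x, y} \<in> E}" and xy: "x \<in> W" "y \<notin> W"
      using rtrancl_crossing[of a b _ W] ab by metis
    then have xyE: "{x, y} \<in> E" by simp
    have nF: "{x, y} \<notin> F" using WF(5) xy by blast
    have "insert y W \<subseteq> N" using sub[OF xyE] WF(1) by blast
    moreover have "card (insert y W) = Suc k" "card (insert {x, y} F) + 1 = Suc k"
      using finW xy nF WF(2,4) by simp_all
    moreover have "insert {x, y} F \<subseteq> E" "\<forall>e\<in>insert {x, y} F. e \<subseteq> insert y W" using WF(3,5) xyE xy by auto
    ultimately show ?case by blast
  qed
  note grow = this
  have "1 \<le> card N" using assms(1,3) by (simp add: Suc_le_eq card_gt_0_iff)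
  from grow[OF this order_refl] obtain F where "F \<subseteq> E" "card F + 1 = card N" by (elim exE conjE)
  then show ?thesis using card_mono[OF assms(2)] by (metis add_le_mono1)
qed

lemma surf_facts:
  assumes "surface_triangulation T"
  shows "finite T" "T \<noteq> {}" "f \<in> T \<Longrightarrow> card f = 3" "f \<in> T \<Longrightarrow> finite f" "finite (verts T)" "finite (edges T)"
    "f \<in> T \<Longrightarrow> f \<subseteq> verts T" "e \<in> edges T \<Longrightarrow> card {f \<in> T. e \<subseteq> f} = 1 \<or> card {f \<in> T. e \<subseteq> f} = 2"
    "bedges T \<subseteq> edges T" "bverts T \<subseteq> verts T" "verts T \<noteq> {}"
proof -
  have T: "finite T" "T \<noteq> {}" "\<And>f. f \<in> T \<Longrightarrow> card f = 3" "\<And>e. e \<in> edges T \<Longrightarrow> card {f \<in> T. e \<subseteq> f} \<le> 2"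
    using assms unfolding surface_triangulation_def by auto
  show "finite T" "T \<noteq> {}" "f \<in> T \<Longrightarrow> card f = 3" using T by auto
  have fin: "finite f" if "f \<in> T" for f using T(3)[OF that] by (metis card.infinite zero_neq_numeral)
  then show "f \<in> T \<Longrightarrow> finite f" by simp
  show fv: "finite (verts T)" unfolding verts_def using T(1) fin by blast
  have "edges T \<subseteq> Pow (verts T)" unfolding edges_def verts_def by blast
  then show "finite (edges T)" using fv by (meson finite_Pow_iff finite_subset)
  show "f \<in> T \<Longrightarrow> f \<subseteq> verts T" unfolding verts_def by blast
  show "bedges T \<subseteq> edges T" unfolding bedges_def by blast
  show "bverts T \<subseteq> verts T" unfolding bverts_def bedges_def edges_def verts_def by blast
  show "card {f \<in> T. e \<subseteq> f} = 1 \<or> card {f \<in> T. e \<subseteq> f} = 2" if "e \<in> edges T"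
  proof -
    have "{f \<in> T. e \<subseteq> f} \<noteq> {}" using that unfolding edges_def by blast
    then have "card {f \<in> T. e \<subseteq> f} > 0" using T(1) by (simp add: card_gt_0_iff)
    then show ?thesis using T(4)[OF that] by linarith
  qed
  obtain f where "f \<in> T" using T(2) by blast
  moreover then have "f \<noteq> {}" using T(3) by fastforce
  ultimately show "verts T \<noteq> {}" unfolding verts_def by blast
qed

lemma face_cases:
  assumes "surface_triangulation T" "f \<in> T"
  obtains a b c where "f = {a, b, c}" "a \<noteq> b" "a \<noteq> c" "b \<noteq> c"
  using surf_facts(3)[OF assms] by (metis card_3_iff)

lemma face_edge:
  assumes "surface_triangulation T" "f \<in> T" "a \<in> f" "b \<in> f" "a \<noteq> b"
  shows "{a, b} \<in> edges T"
  using assms unfolding edges_def by auto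

lemma card_2_subsets_of_3:
  assumes "a \<noteq> b" "a \<noteq> c" "b \<noteq> c"
  shows "{e. card e = 2 \<and> e \<subseteq> {a, b, c}} = {{a, b}, {a, c}, {b, c}}"
proof (rule set_eqI)
  fix e
  show "(e \<in> {e. card e = 2 \<and> e \<subseteq> {a, b, c}}) = (e \<in> {{a, b}, {a, c}, {b, c}})"
    using assms by (auto simp: card_2_iff)
qed

text \<open>Connectedness of the surface enters the necessity of attainability here: a face with
  vertices both inside and outside \<open>A\<close> makes the angle bound strict.\<close>

lemma crossing_face:
  assumes S: "surface_triangulation T" and A: "A \<subset> verts T" "A \<noteq> {}"
  obtains f where "f \<in> T" "f \<inter> A \<noteq> {}" "\<not> f \<subseteq> A"
proof -
  obtain a b where ab: "a \<in> A" "b \<in> verts T" "b \<notin> A" using A by blast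
  then have "(a, b) \<in> (skel_adj T)\<^sup>*" using S A unfolding surface_triangulation_def by blast
  then obtain x y where xy: "(x, y) \<in> skel_adj T" "x \<in> A" "y \<notin> A"
    using rtrancl_crossing ab by metis
  then obtain f where "f \<in> T" "{x, y} \<subseteq> f" unfolding skel_adj_def edges_def by auto
  then show ?thesis using that xy by blast
qed

definition vbase :: "'v set set \<Rightarrow> 'v \<Rightarrow> real" where
  "vbase T v = (if v \<in> bverts T then pi else 2 * pi)"

text \<open>The limit of the total angle of the face \<open>f\<close> at its vertices in \<open>A\<close> as the radii in \<open>A\<close> shrink.\<close>

definition lim_sum :: "('v set \<Rightarrow> real) \<Rightarrow> 'v set \<Rightarrow> 'v set \<Rightarrow> real" where
  "lim_sum \<Theta> A f = (if f \<inter> A = {} then 0 else if card (f \<inter> A) = 1 then pi - \<Theta> (f - A) else pi)"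

text \<open>Edges are counted through the faces containing them, interior edges twice and boundary
  edges once. This trades the edge terms of the Euler characteristics for faces.\<close>

lemma edge_face_count:
  assumes S: "surface_triangulation T"
  shows "(\<Sum>f\<in>T. int (card {e. card e = 2 \<and> e \<subseteq> f \<and> e \<inter> A \<noteq> {}}))
    = 2 * int (card {e \<in> edges T - bedges T. e \<inter> A \<noteq> {}}) + int (card {e \<in> bedges T. e \<inter> A \<noteq> {}})"
proof -
  note F = surf_facts[OF S]
  let ?E = "{e \<in> edges T. e \<inter> A \<noteq> {}}"
  have finE: "finite ?E" using F(6) by simp
  have "{e. card e = 2 \<and> e \<subseteq> f \<and> e \<inter> A \<noteq> {}} = {e \<in> ?E. e \<subseteq> f}" if "f \<in> T" for f
    using that unfolding edges_def by blast
  then have "(\<Sum>f\<in>T. int (card {e. card e = 2 \<and> e \<subseteq> f \<and> e \<inter> A \<noteq> {}})) = (\<Sum>f\<in>T. int (card {e \<in> ?E. e \<subseteq> f}))"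
    by simp
  also have "\<dots> = (\<Sum>f\<in>T. \<Sum>e\<in>?E. if e \<subseteq> f then 1 else 0)"
    using finE by (simp add: sum.inter_filter[symmetric])
  also have "\<dots> = (\<Sum>e\<in>?E. \<Sum>f\<in>T. if e \<subseteq> f then 1 else 0)" by (rule sum.swap)
  also have "\<dots> = (\<Sum>e\<in>?E. int (card {f \<in> T. e \<subseteq> f}))"
    using F(1) by (simp add: sum.inter_filter[symmetric])
  also have "\<dots> = (\<Sum>e\<in>{e \<in> edges T - bedges T. e \<inter> A \<noteq> {}} \<union> {e \<in> bedges T. e \<inter> A \<noteq> {}}. int (card {f \<in> T. e \<subseteq> f}))"
    using F(9) by (intro sum.cong) auto
  also have "\<dots> = (\<Sum>e\<in>{e \<in> edges T - bedges T. e \<inter> A \<noteq> {}}. int (card {f \<in> T. e \<subseteq> f}))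
     + (\<Sum>e\<in>{e \<in> bedges T. e \<inter> A \<noteq> {}}. int (card {f \<in> T. e \<subseteq> f}))"
    using F(6) finite_subset[OF F(9) F(6)] by (intro sum.union_disjoint) auto
  also have "(\<Sum>e\<in>{e \<in> edges T - bedges T. e \<inter> A \<noteq> {}}. int (card {f \<in> T. e \<subseteq> f})) = (\<Sum>e\<in>{e \<in> edges T - bedges T. e \<inter> A \<noteq> {}}. 2)"
    using F(8) unfolding bedges_def by (intro sum.cong) fastforce+
  also have "(\<Sum>e\<in>{e \<in> bedges T. e \<inter> A \<noteq> {}}. int (card {f \<in> T. e \<subseteq> f})) = (\<Sum>e\<in>{e \<in> bedges T. e \<inter> A \<noteq> {}}. 1)"
    unfolding bedges_def by (intro sum.cong) auto
  finally show ?thesis by simp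
qed

text \<open>Two vertices in \<open>A\<close> already meet all three edges, so faces with two and
  with three vertices in \<open>A\<close> count alike, as they do in \<open>lim_sum\<close>.\<close>

lemma card_edges_meeting:
  assumes S: "surface_triangulation T" and f: "f \<in> T"
  shows "card {e. card e = 2 \<and> e \<subseteq> f \<and> e \<inter> A \<noteq> {}} =
    (if f \<inter> A = {} then 0 else if card (f \<inter> A) = 1 then 2 else 3)"
proof -
  obtain a b c where abc: "f = {a, b, c}" "a \<noteq> b" "a \<noteq> c" "b \<noteq> c" by (rule face_cases[OF S f])
  have "{e. card e = 2 \<and> e \<subseteq> f \<and> e \<inter> A \<noteq> {}} = {e \<in> {{a, b}, {a, c}, {b, c}}. e \<inter> A \<noteq> {}}"
    unfolding card_2_subsets_of_3[OF abc(2-4), symmetric] abc(1) by auto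
  also have "\<dots> = (if a \<in> A \<or> b \<in> A then {{a, b}} else {}) \<union> (if a \<in> A \<or> c \<in> A then {{a, c}} else {})
      \<union> (if b \<in> A \<or> c \<in> A then {{b, c}} else {})" by auto
  finally have 1: "{e. card e = 2 \<and> e \<subseteq> f \<and> e \<inter> A \<noteq> {}} = \<dots>" .
  have 2: "f \<inter> A = (if a \<in> A then {a} else {}) \<union> (if b \<in> A then {b} else {}) \<union> (if c \<in> A then {c} else {})"
    unfolding abc(1) by auto
  have ne: "{a, b} \<noteq> {a, c}" "{a, b} \<noteq> {b, c}" "{a, c} \<noteq> {b, c}" using abc(2-4) by (auto simp: doubleton_eq_iff)
  show ?thesis unfolding 1 2 using abc(2-4) ne
    by (cases "a \<in> A"; cases "b \<in> A"; cases "c \<in> A") (simp_all add: card_insert_if insert_commute)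
qed

text \<open>Pairs in \<open>Lk T A\<close> correspond to the faces with exactly one vertex in
  \<open>A\<close>. Counting edges through faces turns \<open>2 * chi_int T A + chi_bdry T A\<close>
  into twice the interior vertices of \<open>A\<close> plus its boundary vertices, minus the faces
  with at least two vertices in \<open>A\<close>. The combinatorial bound can then be compared with
  the angles face by face.\<close>

lemma attain_rhs:
  assumes S: "surface_triangulation T" and A: "A \<subseteq> verts T"
  shows "- (\<Sum>p\<in>Lk T A. pi - \<Theta> (fst p)) + 2 * pi * chi_int T A + pi * chi_bdry T A
    = (\<Sum>v\<in>A. vbase T v) - (\<Sum>f\<in>T. lim_sum \<Theta> A f)"
proof -
  note F = surf_facts[OF S]
  have finA: "finite A" using A F(5) finite_subset by blast
  let ?T1 = "{f \<in> T. card (f \<inter> A) = 1}"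
  let ?T2 = "{f \<in> T. f \<inter> A \<noteq> {} \<and> card (f \<inter> A) \<noteq> 1}"
  have lk: "(\<Sum>p\<in>Lk T A. pi - \<Theta> (fst p)) = (\<Sum>f\<in>?T1. pi - \<Theta> (f - A))"
  proof (rule sum.reindex_bij_witness[of _ "\<lambda>f. (f - A, the_elem (f \<inter> A))" "\<lambda>p. insert (snd p) (fst p)"])
    fix p assume "p \<in> Lk T A"
    then obtain e v where p: "p = (e, v)" "v \<in> A" "e \<in> edges T" "e \<inter> A = {}" "insert v e \<in> T"
      unfolding Lk_def by auto
    have i: "insert v e \<inter> A = {v}" "insert v e - A = e" using p by auto
    show "(insert (snd p) (fst p) - A, the_elem (insert (snd p) (fst p) \<inter> A)) = p"
      "insert (snd p) (fst p) \<in> ?T1" "pi - \<Theta> (insert (snd p) (fst p) - A) = pi - \<Theta> (fst p)"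
      using i p by simp_all
  next
    fix f assume f: "f \<in> ?T1"
    then obtain v where v: "f \<inter> A = {v}" by (auto simp: card_1_singleton_iff)
    have i: "insert v (f - A) = f" using v by auto
    have "card f = card (f \<inter> A) + card (f - A)"
      using F(4)[of f] f by (metis (no_types, lifting) card_Int_Diff mem_Collect_eq)
    then have "card (f - A) = 2" using f F(3)[of f] by simp
    then have "f - A \<in> edges T" unfolding edges_def using f by blast
    then show "(f - A, the_elem (f \<inter> A)) \<in> Lk T A" unfolding Lk_def using v i f by auto
    show "insert (snd (f - A, the_elem (f \<inter> A))) (fst (f - A, the_elem (f \<inter> A))) = f" using v i by simp
  qed
  have split: "{f \<in> T. f \<inter> A \<noteq> {}} = ?T1 \<union> ?T2" by auto
  have dis: "?T1 \<inter> ?T2 = {}" by auto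
  have cF: "card {f \<in> T. f \<inter> A \<noteq> {}} = card ?T1 + card ?T2"
    unfolding split using F(1) dis by (simp add: card_Un_disjoint)
  have "(\<Sum>f\<in>T. lim_sum \<Theta> A f) = (\<Sum>f\<in>{f \<in> T. f \<inter> A \<noteq> {}}. lim_sum \<Theta> A f)"
    using F(1) by (intro sum.mono_neutral_right) (auto simp: lim_sum_def)
  also have "\<dots> = (\<Sum>f\<in>?T1. lim_sum \<Theta> A f) + (\<Sum>f\<in>?T2. lim_sum \<Theta> A f)"
    unfolding split using F(1) dis by (intro sum.union_disjoint) auto
  also have "(\<Sum>f\<in>?T1. lim_sum \<Theta> A f) = (\<Sum>f\<in>?T1. pi - \<Theta> (f - A))"
    by (intro sum.cong) (auto simp: lim_sum_def)
  also have "(\<Sum>f\<in>?T2. lim_sum \<Theta> A f) = pi * real (card ?T2)"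
    by (simp add: lim_sum_def)
  finally have ls: "(\<Sum>f\<in>T. lim_sum \<Theta> A f) = (\<Sum>f\<in>?T1. pi - \<Theta> (f - A)) + pi * real (card ?T2)" .
  have "(\<Sum>v\<in>A. vbase T v) = (\<Sum>v\<in>A \<inter> bverts T. vbase T v) + (\<Sum>v\<in>A - bverts T. vbase T v)"
    using finA by (metis (no_types, lifting) sum.Int_Diff)
  then have vb: "(\<Sum>v\<in>A. vbase T v) = pi * real (card (A \<inter> bverts T)) + 2 * pi * real (card (A - bverts T))"
    by (simp add: vbase_def)
  have "(\<Sum>f\<in>T. int (card {e. card e = 2 \<and> e \<subseteq> f \<and> e \<inter> A \<noteq> {}}))
     = (\<Sum>f\<in>T. (if f \<inter> A = {} then 0 else if card (f \<inter> A) = 1 then 2 else 3))"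
    by (intro sum.cong refl) (simp add: card_edges_meeting[OF S])
  also have "\<dots> = (\<Sum>f\<in>{f \<in> T. f \<inter> A \<noteq> {}}. (if f \<inter> A = {} then 0 else if card (f \<inter> A) = 1 then 2 else 3))"
    using F(1) by (intro sum.mono_neutral_right) auto
  also have "\<dots> = (\<Sum>f\<in>?T1. (if f \<inter> A = {} then 0 else if card (f \<inter> A) = 1 then 2 else 3))
     + (\<Sum>f\<in>?T2. (if f \<inter> A = {} then 0 else if card (f \<inter> A) = 1 then 2 else 3))"
    unfolding split using F(1) dis by (intro sum.union_disjoint) auto
  also have "(\<Sum>f\<in>?T1. (if f \<inter> A = {} then 0 else if card (f \<inter> A) = 1 then 2 else 3)) = (\<Sum>f\<in>?T1. 2 :: int)"
    by (intro sum.cong) auto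
  finally have cnt: "(\<Sum>f\<in>T. int (card {e. card e = 2 \<and> e \<subseteq> f \<and> e \<inter> A \<noteq> {}}))
     = 2 * int (card ?T1) + 3 * int (card ?T2)" by simp
  have key: "2 * int (card {e \<in> edges T - bedges T. e \<inter> A \<noteq> {}}) + int (card {e \<in> bedges T. e \<inter> A \<noteq> {}})
     = 2 * int (card ?T1) + 3 * int (card ?T2)"
    using edge_face_count[OF S, of A] cnt by simp
  have "2 * chi_int T A + chi_bdry T A = 2 * int (card (A - bverts T)) + int (card (A \<inter> bverts T)) - int (card ?T2)"
    unfolding chi_int_def chi_bdry_def cF using key by simp
  then have "2 * real_of_int (chi_int T A) + real_of_int (chi_bdry T A)
     = 2 * real (card (A - bverts T)) + real (card (A \<inter> bverts T)) - real (card ?T2)"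
    by linarith
  then have "pi * (2 * real_of_int (chi_int T A) + real_of_int (chi_bdry T A))
     = pi * (2 * real (card (A - bverts T)) + real (card (A \<inter> bverts T)) - real (card ?T2))" by simp
  then show ?thesis unfolding lk ls vb by (simp add: algebra_simps)
qed

text \<open>Let the link of \<open>v\<close> have vertices \<open>N\<close>, edges \<open>E\<close>,
  and endpoints \<open>N1\<close>. Counting incidences gives \<open>2 |E| + |N1| = 2 |N|\<close>,
  and connectedness gives \<open>|N| \<le> |E| + 1\<close>. So \<open>|N1|\<close> is even and at
  most 2, and it is positive because \<open>v\<close> lies on the boundary.\<close>

lemma boundary_degree:
  assumes S: "surface_triangulation T" and v: "v \<in> bverts T"
  shows "card {e \<in> bedges T. v \<in> e} = 2"
proof -
  note F = surf_facts[OF S]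
  define N where "N = link_verts T v"
  define E where "E = (\<lambda>f. f - {v}) ` {f \<in> T. v \<in> f}"
  have vv: "v \<in> verts T" using v F(10) by blast
  have NE: "N = \<Union>E" unfolding N_def link_verts_def E_def by blast
  have finE: "finite E" unfolding E_def using F(1) by simp
  have cardE: "card e = 2" if "e \<in> E" for e
    using that F(3,4) unfolding E_def by auto
  have finN: "finite N" unfolding NE using finE cardE by (metis card.infinite finite_Union zero_neq_numeral)
  obtain f0 where f0: "f0 \<in> T" "v \<in> f0" using vv unfolding verts_def by blast
  have "card (f0 - {v}) = 2" using f0 by (intro cardE) (simp add: E_def)
  then have "f0 - {v} \<noteq> {}" by (metis card.empty zero_neq_numeral)
  then have "N \<noteq> {}" using f0 unfolding NE E_def by blast
  have cE: "card E = card {f \<in> T. v \<in> f}" unfolding E_def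
    by (rule card_image, rule inj_onI) (metis insert_Diff mem_Collect_eq)
  have le: "card N \<le> card E + 1"
  proof (rule connected_graph_card_le[OF finN finE \<open>N \<noteq> {}\<close>])
    fix a b assume ab: "a \<in> N" "b \<in> N"
    have "(a, b) \<in> (link_adj T v)\<^sup>*" using S vv ab unfolding surface_triangulation_def N_def by blast
    moreover have "link_adj T v \<subseteq> {(x, y). {x, y} \<in> E}"
    proof (rule subrelI)
      fix x y assume "(x, y) \<in> link_adj T v"
      then have h: "insert v {x, y} \<in> T" "v \<notin> {x, y}" unfolding link_adj_def by auto
      then have "{x, y} = insert v {x, y} - {v}" by auto
      then show "(x, y) \<in> {(x, y). {x, y} \<in> E}" unfolding E_def using h by blast
    qed
    ultimately show "(a, b) \<in> {(x, y). {x, y} \<in> E}\<^sup>*" using rtrancl_mono by blast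
  qed (auto simp: NE)
  have edge: "{v, a} \<in> edges T" if an: "a \<in> N" for a
  proof -
    obtain f where "f \<in> T" "v \<in> f" "a \<in> f" "a \<noteq> v" using an unfolding NE E_def by blast
    then show ?thesis using face_edge[OF S] by metis
  qed
  have vnN: "v \<notin> N" unfolding NE E_def by blast
  define N1 where "N1 = {a \<in> N. {v, a} \<in> bedges T}"
  have "{e \<in> bedges T. v \<in> e} = (\<lambda>a. {v, a}) ` N1"
  proof
    show "{e \<in> bedges T. v \<in> e} \<subseteq> (\<lambda>a. {v, a}) ` N1"
    proof
      fix e assume e: "e \<in> {e \<in> bedges T. v \<in> e}"
      then have "e \<in> edges T" using F(9) by blast
      then obtain f where f: "f \<in> T" "e \<subseteq> f" "card e = 2" unfolding edges_def by blast
      then obtain a where a: "e = {v, a}" "a \<noteq> v" using e by (auto simp: card_2_iff)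
      then have "a \<in> N" unfolding NE E_def using f by blast
      then show "e \<in> (\<lambda>a. {v, a}) ` N1" unfolding N1_def using a e by blast
    qed
  qed (auto simp: N1_def)
  moreover have "inj_on (\<lambda>a. {v, a}) N1" by (auto simp: inj_on_def doubleton_eq_iff)
  ultimately have card1: "card {e \<in> bedges T. v \<in> e} = card N1" by (simp add: card_image)
  have deg: "card {f \<in> T. {v, a} \<subseteq> f} = (if a \<in> N1 then 1 else 2)" if "a \<in> N" for a
    using F(8)[OF edge[OF that]] that edge[OF that] unfolding N1_def bedges_def by auto
  have "(\<Sum>a\<in>N. card {f \<in> T. {v, a} \<subseteq> f}) = (\<Sum>a\<in>N. \<Sum>f\<in>{f \<in> T. v \<in> f}. if a \<in> f then 1 else 0)"
    using F(1) by (intro sum.cong refl) (simp add: sum.inter_filter[symmetric] conj_commute conj_left_commute Int_def)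
  also have "\<dots> = (\<Sum>f\<in>{f \<in> T. v \<in> f}. \<Sum>a\<in>N. if a \<in> f then 1 else 0)" by (rule sum.swap)
  also have "\<dots> = (\<Sum>f\<in>{f \<in> T. v \<in> f}. 2)"
  proof (intro sum.cong refl)
    fix f assume f: "f \<in> {f \<in> T. v \<in> f}"
    then have fE: "f - {v} \<in> E" unfolding E_def by blast
    then have "{a \<in> N. a \<in> f} = f - {v}" using vnN unfolding NE by blast
    then show "(\<Sum>a\<in>N. if a \<in> f then 1 else 0) = (2::nat)"
      using finN cardE[OF fE] by (simp add: sum.inter_filter[symmetric])
  qed
  finally have s2: "(\<Sum>a\<in>N. card {f \<in> T. {v, a} \<subseteq> f}) = 2 * card E" by (simp add: cE)
  have "(\<Sum>a\<in>N. card {f \<in> T. {v, a} \<subseteq> f}) + card N1 = (\<Sum>a\<in>N. (if a \<in> N1 then 1 else 2)) + (\<Sum>a\<in>N. if a \<in> N1 then 1 else 0)"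
    using deg finN by (simp add: sum.inter_filter[symmetric] N1_def)
  also have "\<dots> = (\<Sum>a\<in>N. 2)" unfolding sum.distrib[symmetric] by (intro sum.cong) auto
  finally have tot: "2 * card E + card N1 = 2 * card N" using s2 by simp
  have "bedges T \<inter> {e. v \<in> e} \<noteq> {}" using v unfolding bverts_def by blast
  then have "card {e \<in> bedges T. v \<in> e} > 0"
    using finite_subset[OF F(9) F(6)] by (simp add: card_gt_0_iff) blast
  then show ?thesis using card1 tot le by presburger
qed

text \<open>Incidences between boundary vertices and boundary edges are counted twice, using that
  each boundary vertex has degree 2.\<close>

lemma card_bverts:
  assumes S: "surface_triangulation T"
  shows "card (bverts T) = card (bedges T)"
proof -
  note F = surf_facts[OF S]
  have fb: "finite (bedges T)" "finite (bverts T)"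
    using finite_subset[OF F(9) F(6)] finite_subset[OF F(10) F(5)] by auto
  have "2 * card (bverts T) = (\<Sum>v\<in>bverts T. card {e \<in> bedges T. v \<in> e})"
    using boundary_degree[OF S] by simp
  also have "\<dots> = (\<Sum>v\<in>bverts T. \<Sum>e\<in>bedges T. if v \<in> e then 1 else 0)"
    using fb by (simp add: sum.inter_filter[symmetric])
  also have "\<dots> = (\<Sum>e\<in>bedges T. \<Sum>v\<in>bverts T. if v \<in> e then 1 else 0)" by (rule sum.swap)
  also have "\<dots> = (\<Sum>e\<in>bedges T. 2)"
  proof (intro sum.cong refl)
    fix e assume e: "e \<in> bedges T"
    then have "{v \<in> bverts T. v \<in> e} = e" unfolding bverts_def by blast
    moreover have "card e = 2" using e F(9) unfolding edges_def by blast
    ultimately show "(\<Sum>v\<in>bverts T. if v \<in> e then 1 else 0) = (2::nat)"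
      using fb by (simp add: sum.inter_filter[symmetric])
  qed
  finally show ?thesis by simp
qed

text \<open>The left side is the total curvature when every face has angle sum \<open>pi\<close>.
  The identity follows from counting edges through faces and from the equality of the numbers of
  boundary vertices and boundary edges.\<close>

lemma gauss_bonnet_count:
  assumes S: "surface_triangulation T"
  shows "(\<Sum>v\<in>verts T. vbase T v) - pi * card T = 2 * pi * euler_char T"
proof -
  note F = surf_facts[OF S]
  have e: "e \<inter> verts T \<noteq> {}" if "e \<in> edges T" for e
  proof -
    have "e \<subseteq> verts T" "card e = 2" using that unfolding edges_def verts_def by blast+
    then show ?thesis by (metis card.empty inf.absorb1 zero_neq_numeral)
  qed
  have fm: "f \<inter> verts T = f" if "f \<in> T" for f using F(7)[OF that] by blast
  have s1: "{e \<in> edges T - bedges T. e \<inter> verts T \<noteq> {}} = edges T - bedges T" "{e \<in> bedges T. e \<inter> verts T \<noteq> {}} = bedges T"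
    using e F(9) by blast+
  have "(\<Sum>f\<in>T. int (card {e. card e = 2 \<and> e \<subseteq> f \<and> e \<inter> verts T \<noteq> {}})) = (\<Sum>f\<in>T. 3)"
  proof (intro sum.cong refl)
    fix f assume f: "f \<in> T"
    then show "int (card {e. card e = 2 \<and> e \<subseteq> f \<and> e \<inter> verts T \<noteq> {}}) = 3"
      unfolding card_edges_meeting[OF S f] fm[OF f] using F(3)[OF f] by auto
  qed
  then have "3 * int (card T) = 2 * int (card (edges T - bedges T)) + int (card (bedges T))"
    using edge_face_count[OF S, of "verts T"] s1 by simp
  moreover have "int (card (edges T - bedges T)) = int (card (edges T)) - int (card (bedges T))"
    using F(6,9) by (simp add: card_Diff_subset finite_subset card_mono of_nat_diff)
  moreover have "int (card (verts T - bverts T)) = int (card (verts T)) - int (card (bverts T))"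
    using F(5,10) by (simp add: card_Diff_subset finite_subset card_mono of_nat_diff)
  moreover have "3 * F = 2 * EI + EB \<Longrightarrow> EI = E - EB \<Longrightarrow> VI = V - VB \<Longrightarrow> VB = EB
      \<Longrightarrow> 2 * (V - E + F) = 2 * VI + VB - F" for F E EI EB V VI VB :: int
    by algebra
  ultimately have i: "2 * euler_char T = 2 * int (card (verts T - bverts T)) + int (card (bverts T)) - int (card T)"
    using arg_cong[where f = int, OF card_bverts[OF S]] unfolding euler_char_def by blast
  have "(\<Sum>v\<in>verts T. vbase T v) = (\<Sum>v\<in>verts T \<inter> bverts T. vbase T v) + (\<Sum>v\<in>verts T - bverts T. vbase T v)"
    using F(5) by (metis (no_types, lifting) sum.Int_Diff)
  also have "verts T \<inter> bverts T = bverts T" using F(10) by blast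
  finally have vb: "(\<Sum>v\<in>verts T. vbase T v) = pi * real (card (bverts T)) + 2 * pi * real (card (verts T - bverts T))"
    by (simp add: vbase_def)
  have "2 * real_of_int (euler_char T) = 2 * real (card (verts T - bverts T)) + real (card (bverts T)) - real (card T)"
    using i by linarith
  then have "pi * (2 * real_of_int (euler_char T)) = pi * (2 * real (card (verts T - bverts T)) + real (card (bverts T)) - real (card T))"
    by simp
  then show ?thesis unfolding vb by (simp add: algebra_simps)
qed

section \<open>Ordinary differential equations\<close>

lemma integral_exp_bound:
  fixes lm t :: real
  assumes "0 < lm" "0 \<le> t"
  shows "integral {0..t} (\<lambda>s. exp (lm * s)) \<le> exp (lm * t) / lm"
proof -
  have "((\<lambda>s. exp (lm * s)) has_integral (exp (lm * t) / lm - exp (lm * 0) / lm)) {0..t}"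
    by (rule fundamental_theorem_of_calculus[OF assms(2)])
      (use assms in \<open>auto simp flip: has_real_derivative_iff_has_vector_derivative intro!: derivative_eq_intros\<close>)
  then show ?thesis using assms by (simp add: integral_unique)
qed

lemma at_within_Icc_Ici: "0 \<le> t \<Longrightarrow> t < b \<Longrightarrow> at t within {0..b} = at t within {0..}" for t b :: real
  by (rule at_within_nhd[of _ "{..<b}"]) auto

text \<open>The vertex type carries no topology. Wrapping it in \<open>discrete\<close> turns a
  family of functions of time into one element of a complete space of bounded continuous functions,
  where the contraction principle applies.\<close>

lemma continuous_on_real_discrete:
  fixes g :: "real \<Rightarrow> 'v \<Rightarrow> real"
  assumes "\<And>v. continuous_on UNIV (\<lambda>t. g t v)"
  shows "continuous_on UNIV (\<lambda>p. g (fst p) (of_discrete (snd p)))"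
  unfolding continuous_on_eq_continuous_at[OF open_UNIV]
proof
  fix p :: "real \<times> 'v discrete"
  obtain t d where p: "p = (t, d)" by fastforce
  have "isCont (\<lambda>t. g t (of_discrete d)) t"
    using assms by (simp add: continuous_on_eq_continuous_at)
  then have *: "((\<lambda>q. g (fst q) (of_discrete d)) \<longlongrightarrow> g t (of_discrete d)) (at p)"
    by (intro isCont_tendsto_compose[of t "\<lambda>t. g t (of_discrete d)"]) (auto simp: p intro!: tendsto_eq_intros)
  have "\<forall>\<^sub>F q in at p. snd q = d"
    unfolding eventually_at_topological
    by (intro exI[of _ "UNIV \<times> {d}"]) (auto simp: p intro!: open_Times open_discrete)
  then have "\<forall>\<^sub>F q in at p. g (fst q) (of_discrete d) = g (fst q) (of_discrete (snd q))"
    by eventually_elim simp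
  from Lim_transform_eventually[OF * this]
  show "isCont (\<lambda>p. g (fst p) (of_discrete (snd p))) p"
    by (simp add: isCont_def p)
qed

lemma continuous_on_lipschitz_coords:
  fixes F :: "('v \<Rightarrow> real) \<Rightarrow> real" and x :: "real \<Rightarrow> 'v \<Rightarrow> real"
  assumes "\<And>p q. \<bar>F p - F q\<bar> \<le> L * (\<Sum>w\<in>V. \<bar>p w - q w\<bar>)" "\<And>w. w \<in> V \<Longrightarrow> continuous_on S (\<lambda>s. x s w)"
  shows "continuous_on S (\<lambda>s. F (x s))"
  unfolding continuous_on_def
proof
  fix s assume s: "s \<in> S"
  have "((\<lambda>r. L * (\<Sum>w\<in>V. \<bar>x r w - x s w\<bar>)) \<longlongrightarrow> L * (\<Sum>w\<in>V. \<bar>x s w - x s w\<bar>)) (at s within S)"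
    using assms(2) s by (intro tendsto_intros) (auto simp: continuous_on_def)
  then have "((\<lambda>r. L * (\<Sum>w\<in>V. \<bar>x r w - x s w\<bar>)) \<longlongrightarrow> 0) (at s within S)" by simp
  then have "((\<lambda>r. F (x r) - F (x s)) \<longlongrightarrow> 0) (at s within S)"
    by (rule Lim_null_comparison[rotated]) (use assms(1) in \<open>auto intro!: always_eventually\<close>)
  then show "((\<lambda>r. F (x r)) \<longlongrightarrow> F (x s)) (at s within S)" by (simp add: LIM_zero_iff)
qed

text \<open>Picard iteration by the contraction principle for the weighted functions \<open>exp (- lm t) x(t)\<close>,
  which turns a Lipschitz vector field into a contraction on the whole half line.\<close>

lemma bounded_lipschitz_ode:
  fixes F :: "('v \<Rightarrow> real) \<Rightarrow> 'v \<Rightarrow> real" and x0 :: "'v \<Rightarrow> real"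
  assumes V: "finite V"
    and lip: "\<And>v p q. v \<in> V \<Longrightarrow> \<bar>F p v - F q v\<bar> \<le> L * (\<Sum>w\<in>V. \<bar>p w - q w\<bar>)"
    and bnd: "\<And>v p. v \<in> V \<Longrightarrow> \<bar>F p v\<bar> \<le> B"
    and L: "0 \<le> L" and B: "0 \<le> B"
  shows "\<exists>x. (\<forall>v\<in>V. x 0 v = x0 v) \<and>
    (\<forall>t\<ge>0. \<forall>v\<in>V. ((\<lambda>s. x s v) has_real_derivative F (x t) v) (at t within {0..}))"
proof -
  \<comment> \<open>Large enough for the contraction factor \<open>L * card V / lm\<close> to be at
    most \<open>1/2\<close>.\<close>
  define lm where "lm = 2 * L * card V + 1"
  have lam: "0 < lm" using L by (simp add: lm_def add_nonneg_pos)
  define X :: "((real \<times> 'v discrete) \<Rightarrow>\<^sub>C real) \<Rightarrow> real \<Rightarrow> 'v \<Rightarrow> real" where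
    "X = (\<lambda>z s w. exp (lm * s) * apply_bcontfun z (s, discrete w))"
  define I where "I = (\<lambda>z v t. x0 v + integral {0..t} (\<lambda>s. F (X z s) v))"
  \<comment> \<open>\<open>max 0 t\<close> extends the iterate to negative times and the value 0
    extends it off \<open>V\<close>, so that it lives on the whole product type.\<close>
  define P where "P = (\<lambda>z t v. if v \<in> V then exp (- lm * max 0 t) * I z v (max 0 t) else 0)"
  have contX: "continuous_on S (\<lambda>s. X z s w)" for z S w
    unfolding X_def by (intro continuous_intros continuous_on_compose2[OF continuous_on_apply_bcontfun[of UNIV]]) auto
  have contF: "continuous_on S (\<lambda>s. F (X z s) v)" if "v \<in> V" for z S v
    by (rule continuous_on_lipschitz_coords[OF lip[OF that] contX])
  have intF: "(\<lambda>s. F (X z s) v) integrable_on {0..t}" if "v \<in> V" for z t v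
    by (intro integrable_continuous_real contF that)
  have contP: "continuous_on UNIV (\<lambda>t. P z t v)" for z v
  proof (cases "v \<in> V")
    case True
    have "continuous_on {0..} (I z v)"
      unfolding continuous_on_eq_continuous_within
    proof
      fix t :: real assume t: "t \<in> {0..}"
      have "continuous_on {0..t + 1} (\<lambda>t. integral {0..t} (\<lambda>s. F (X z s) v))"
        by (intro indefinite_integral_continuous_1 intF True)
      then have "continuous (at t within {0..t + 1}) (I z v)"
        using t unfolding I_def by (intro continuous_intros) (auto simp: continuous_on_eq_continuous_within)
      then show "continuous (at t within {0..}) (I z v)"
        using at_within_Icc_Ici[of t "t + 1"] t by simp
    qed
    then have "continuous_on UNIV (\<lambda>t. I z v (max 0 t))"
      by (rule continuous_on_compose2) (auto intro!: continuous_intros)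
    then show ?thesis unfolding P_def using True by (auto intro!: continuous_intros)
  qed (simp add: P_def)
  \<comment> \<open>The bound \<open>B\<close> permits at most linear growth, which the exponential
    weight absorbs.\<close>
  have bndP: "\<bar>P z t v\<bar> \<le> (\<Sum>w\<in>V. \<bar>x0 w\<bar>) + B / lm" for z t v
  proof (cases "v \<in> V")
    case True
    define u where "u = max 0 t"
    have u: "0 \<le> u" by (simp add: u_def)
    have "norm (integral {0..u} (\<lambda>s. F (X z s) v)) \<le> B * (u - 0)"
      by (rule integral_bound[OF u contF[OF True]]) (use bnd True in auto)
    then have "\<bar>I z v u\<bar> \<le> \<bar>x0 v\<bar> + B * u" unfolding I_def by simp
    then have "\<bar>P z t v\<bar> \<le> exp (- lm * u) * (\<bar>x0 v\<bar> + B * u)"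
      unfolding P_def u_def[symmetric] using True by (simp add: abs_mult)
    also have "\<dots> \<le> \<bar>x0 v\<bar> + B / lm"
    proof -
      have "exp (- lm * u) * \<bar>x0 v\<bar> \<le> 1 * \<bar>x0 v\<bar>" using lam u by (intro mult_right_mono) auto
      moreover have "exp (- lm * u) * (lm * u) \<le> 1"
      proof -
        have "lm * u \<le> exp (lm * u)" using exp_ge_add_one_self[of "lm * u"] by linarith
        then show ?thesis by (simp add: exp_minus field_simps)
      qed
      then have "exp (- lm * u) * u \<le> 1 / lm" using lam by (simp add: field_simps)
      then have "B * (exp (- lm * u) * u) \<le> B * (1 / lm)" using B by (intro mult_left_mono)
      ultimately show ?thesis by (simp add: algebra_simps)
    qed
    also have "\<bar>x0 v\<bar> \<le> (\<Sum>w\<in>V. \<bar>x0 w\<bar>)" using True V by (intro member_le_sum) auto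
    finally show ?thesis by simp
  next
    case False
    then show ?thesis using B lam by (simp add: P_def sum_nonneg)
  qed
  define Q where "Q = (\<lambda>z p. P z (fst p) (of_discrete (snd p)))"
  have Qb: "Q z \<in> bcontfun" for z
    unfolding Q_def by (rule bcontfun_normI[OF continuous_on_real_discrete[OF contP]]) (use bndP in auto)
  have app: "apply_bcontfun (Bcontfun (Q z)) = Q z" for z using Qb by (simp add: Bcontfun_inverse)
  have "\<exists>!z. Bcontfun (Q z) = z"
  proof (rule banach_fix_type)
    show "(0::real) \<le> 1/2" "(1/2::real) < 1" by auto
    show "\<forall>y z. dist (Bcontfun (Q y)) (Bcontfun (Q z)) \<le> 1/2 * dist y z"
    proof (intro allI dist_bound)
      fix y z :: "(real \<times> 'v discrete) \<Rightarrow>\<^sub>C real" and p :: "real \<times> 'v discrete"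
      define u v where uv: "u = max 0 (fst p)" "v = of_discrete (snd p)"
      have u: "0 \<le> u" by (simp add: uv)
      show "dist (apply_bcontfun (Bcontfun (Q y)) p) (apply_bcontfun (Bcontfun (Q z)) p) \<le> 1/2 * dist y z"
      proof (cases "v \<in> V")
        case True
        have pt: "\<bar>F (X y s) v - F (X z s) v\<bar> \<le> L * card V * dist y z * exp (lm * s)" for s
        proof -
          have "\<bar>X y s w - X z s w\<bar> \<le> exp (lm * s) * dist y z" for w
          proof -
            have "X y s w - X z s w = exp (lm * s) * (apply_bcontfun y (s, discrete w) - apply_bcontfun z (s, discrete w))"
              by (simp add: X_def algebra_simps)
            then show ?thesis using dist_bounded[of y "(s, discrete w)" z] by (simp add: abs_mult dist_real_def)
          qed
          then have "(\<Sum>w\<in>V. \<bar>X y s w - X z s w\<bar>) \<le> (\<Sum>w\<in>V. exp (lm * s) * dist y z)" by (intro sum_mono)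
          then have "L * (\<Sum>w\<in>V. \<bar>X y s w - X z s w\<bar>) \<le> L * (card V * (exp (lm * s) * dist y z))"
            using L by (intro mult_left_mono) auto
          then show ?thesis using lip[OF True, of "X y s" "X z s"] by (simp add: mult_ac)
        qed
        have "norm (integral {0..u} (\<lambda>s. F (X y s) v - F (X z s) v)) \<le> integral {0..u} (\<lambda>s. L * card V * dist y z * exp (lm * s))"
          by (rule integral_norm_bound_integral) (use pt in \<open>auto intro!: integrable_continuous_real continuous_intros contF True\<close>)
        also have "\<dots> = L * card V * dist y z * integral {0..u} (\<lambda>s. exp (lm * s))" by simp
        also have "\<dots> \<le> L * card V * dist y z * (exp (lm * u) / lm)"
          using L integral_exp_bound[OF lam u] by (intro mult_left_mono) auto
        finally have "\<bar>I y v u - I z v u\<bar> \<le> L * card V * dist y z * (exp (lm * u) / lm)"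
          unfolding I_def by (simp add: integral_diff[OF intF intF] True)
        then have "exp (- lm * u) * \<bar>I y v u - I z v u\<bar> \<le> exp (- lm * u) * (L * card V * dist y z * (exp (lm * u) / lm))"
          by (intro mult_left_mono) auto
        also have "\<dots> = L * card V / lm * dist y z" by (simp add: exp_minus field_simps)
        also have "\<dots> \<le> 1/2 * dist y z" using lam by (intro mult_right_mono) (auto simp: lm_def field_simps)
        finally show ?thesis
          unfolding app unfolding Q_def P_def uv[symmetric] using True
          by (simp add: dist_real_def abs_mult flip: right_diff_distrib)
      qed (unfold app, simp add: Q_def P_def uv[symmetric])
    qed
  qed
  then obtain z where z: "Bcontfun (Q z) = z" by blast
  have Xz: "X z t v = I z v t" if "0 \<le> t" "v \<in> V" for t v
  proof -
    have "apply_bcontfun z (t, discrete v) = Q z (t, discrete v)" using app z by metis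
    then show ?thesis using that by (simp add: X_def Q_def P_def discrete_inverse exp_minus)
  qed
  show ?thesis
  proof (intro exI[of _ "X z"] conjI ballI allI impI)
    show "X z 0 v = x0 v" if "v \<in> V" for v using Xz[of 0 v] that by (simp add: I_def)
    fix t v assume t: "(0::real) \<le> t" and v: "v \<in> V"
    have "((\<lambda>x. integral {0..x} (\<lambda>s. F (X z s) v)) has_real_derivative F (X z t) v) (at t within {0..t+1})"
      by (rule integral_has_real_derivative) (use t in \<open>auto intro!: contF v\<close>)
    then have "((\<lambda>x. integral {0..x} (\<lambda>s. F (X z s) v)) has_real_derivative F (X z t) v) (at t within {0..})"
      using at_within_Icc_Ici[of t "t+1"] t by simp
    then have "(I z v has_real_derivative F (X z t) v) (at t within {0..})"
      unfolding I_def by (auto intro!: derivative_eq_intros)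
    then show "((\<lambda>s. X z s v) has_real_derivative F (X z t) v) (at t within {0..})"
      by (rule has_field_derivative_transform_within[where d = 1]) (use t v Xz in auto)
  qed
qed

text \<open>If the minimum over the family drops below \<open>c\<close> on \<open>[0, t]\<close>, look at the member and the time at
  which the overall minimum is attained.\<close>

lemma min_family_barrier:
  fixes f :: "'i \<Rightarrow> real \<Rightarrow> real"
  assumes fin: "finite I" and I: "i \<in> I"
    and der: "\<And>i t. i \<in> I \<Longrightarrow> 0 \<le> t \<Longrightarrow> (f i has_real_derivative f' i t) (at t within {0..})"
    and init: "\<And>i. i \<in> I \<Longrightarrow> c \<le> f i 0"
    and pos: "\<And>i t. i \<in> I \<Longrightarrow> 0 \<le> t \<Longrightarrow> f i t < c \<Longrightarrow> (\<And>j. j \<in> I \<Longrightarrow> f i t \<le> f j t) \<Longrightarrow> 0 < f' i t"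
    and t: "0 \<le> t"
  shows "c \<le> f i t"
proof (rule ccontr)
  assume "\<not> c \<le> f i t"
  then have lt: "f i t < c" by simp
  have cont: "continuous_on {0..t} (f j)" if "j \<in> I" for j
    by (rule DERIV_continuous_on[where D = "f' j"], rule DERIV_subset[OF der[OF that]]) auto
  have "\<exists>\<tau>\<in>{0..t}. \<forall>s\<in>{0..t}. f j \<tau> \<le> f j s" if "j \<in> I" for j
    using continuous_attains_inf[OF compact_Icc _ cont[OF that]] t by auto
  then obtain \<tau> where \<tau>: "\<And>j. j \<in> I \<Longrightarrow> \<tau> j \<in> {0..t}" "\<And>j s. j \<in> I \<Longrightarrow> s \<in> {0..t} \<Longrightarrow> f j (\<tau> j) \<le> f j s"
    by metis
  obtain j where j: "j \<in> I" "\<And>k. k \<in> I \<Longrightarrow> f j (\<tau> j) \<le> f k (\<tau> k)"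
    using arg_min_if_finite[OF fin, of "\<lambda>j. f j (\<tau> j)"] I by (metis empty_iff not_le)
  define s where "s = \<tau> j"
  have s: "0 \<le> s" "s \<le> t" using \<tau>(1)[OF j(1)] by (auto simp: s_def)
  have min: "f j s \<le> f k r" if "k \<in> I" "r \<in> {0..t}" for k r
    using j(2)[OF that(1)] \<tau>(2)[OF that] by (simp add: s_def)
  have lc: "f j s < c" using min[OF I, of t] t lt by simp
  then have "s \<noteq> 0" using init[OF j(1)] by auto
  \<comment> \<open>The minimum is not attained at time 0, so times just before \<open>s\<close> are
    available; a positive derivative would give smaller values there.\<close>
  then have s0: "0 < s" using s by simp
  have "0 < f' j s" by (rule pos[OF j(1) s(1) lc]) (use min s in auto)
  moreover have "(f j has_real_derivative f' j s) (at s)"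
    using der[OF j(1) s(1)] s0 by (simp add: at_within_interior[of s "{0..}"])
  ultimately obtain d where d: "0 < d" "\<And>h. 0 < h \<Longrightarrow> h < d \<Longrightarrow> f j (s - h) < f j s"
    using DERIV_pos_inc_left by blast
  define h where "h = min (d / 2) s"
  have "f j (s - h) < f j s" using d s0 by (intro d(2)) (auto simp: h_def)
  moreover have "f j s \<le> f j (s - h)" using s s0 d by (intro min j(1)) (auto simp: h_def)
  ultimately show False by simp
qed

lemma DERIV_within_Ici_nonincreasing:
  fixes f :: "real \<Rightarrow> real"
  assumes "\<And>x. 0 \<le> x \<Longrightarrow> x \<le> t \<Longrightarrow> (f has_real_derivative f' x) (at x within {0..})"
    "\<And>x. 0 \<le> x \<Longrightarrow> x \<le> t \<Longrightarrow> f' x \<le> 0" "0 \<le> s" "s \<le> t"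
  shows "f t \<le> f s"
proof (rule DERIV_nonpos_imp_decreasing_open[OF assms(4)])
  fix x assume "s < x" "x < t"
  then show "\<exists>y. (f has_real_derivative y) (at x) \<and> y \<le> 0"
    using assms(1,2)[of x] assms(3) by (auto simp: at_within_interior[of x "{0..}"] intro!: exI[of _ "f' x"])
next
  show "continuous_on {s..t} f"
    by (rule DERIV_continuous_on[where D = f'], rule DERIV_subset[OF assms(1)]) (use assms(3) in auto)
qed

text \<open>Gronwall's argument: \<open>exp (lm * t) * y t\<close> is nonincreasing.\<close>

lemma exp_decay:
  fixes y :: "real \<Rightarrow> real"
  assumes "\<And>t. 0 \<le> t \<Longrightarrow> (y has_real_derivative y' t) (at t within {0..})" "\<And>t. 0 \<le> t \<Longrightarrow> y' t \<le> - lm * y t" "0 \<le> t"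
  shows "y t \<le> exp (- lm * t) * y 0"
proof -
  have "exp (lm * t) * y t \<le> exp (lm * 0) * y 0"
  proof (rule DERIV_within_Ici_nonincreasing[where f = "\<lambda>t. exp (lm * t) * y t"
        and f' = "\<lambda>t. exp (lm * t) * (y' t + lm * y t)" and s = 0 and t = t])
    fix t :: real assume t: "0 \<le> t"
    show "((\<lambda>t. exp (lm * t) * y t) has_real_derivative exp (lm * t) * (y' t + lm * y t)) (at t within {0..})"
      by (rule derivative_eq_intros assms(1)[OF t] refl)+ (simp add: algebra_simps)
    show "exp (lm * t) * (y' t + lm * y t) \<le> 0" using assms(2)[OF t] by (simp add: mult_le_0_iff)
  qed (use assms in auto)
  then show ?thesis by (simp add: exp_minus field_simps)
qed

text \<open>By the mean value theorem \<open>f'\<close> takes values \<open>f (n + 1) - f n\<close> at arbitrarily late times.\<close>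

lemma derivative_limit_zero:
  fixes f :: "real \<Rightarrow> real"
  assumes der: "\<And>t. 0 \<le> t \<Longrightarrow> (f has_real_derivative f' t) (at t within {0..})"
    and f: "(f \<longlongrightarrow> l) at_top" and f': "(f' \<longlongrightarrow> m) at_top"
  shows "m = 0"
proof -
  have "\<exists>z>real n + 1. z < real n + 2 \<and> f (real n + 2) - f (real n + 1) = (real n + 2 - (real n + 1)) * f' z" for n
  proof (rule MVT2)
    fix x assume "real n + 1 \<le> x"
    then show "(f has_real_derivative f' x) (at x)" using der[of x] by (simp add: at_within_interior[of x "{0..}"])
  qed simp
  then obtain z where z: "\<And>n. real n + 1 < z n" "\<And>n. f (real n + 2) - f (real n + 1) = f' (z n)"
    by (simp add: algebra_simps) metis
  have lim: "filterlim (\<lambda>n::nat. real n + a) at_top sequentially" for a by real_asymp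
  have zl: "filterlim z at_top sequentially"
    by (rule filterlim_at_top_mono[OF lim[of 1]]) (use z(1) less_imp_le in \<open>auto intro!: always_eventually\<close>)
  have "(\<lambda>n. f (real n + 2) - f (real n + 1)) \<longlonglongrightarrow> l - l"
    by (intro tendsto_diff filterlim_compose[OF f] lim)
  then have "(\<lambda>n. f' (z n)) \<longlonglongrightarrow> 0" using z(2) by simp
  moreover have "(\<lambda>n. f' (z n)) \<longlonglongrightarrow> m" by (rule filterlim_compose[OF f' zl])
  ultimately show ?thesis by (rule LIMSEQ_unique[symmetric])
qed

text \<open>The hypothesis is uniform in \<open>h\<close>, so letting \<open>h\<close> tend to
  infinity gives the same rate for the distance to the limit.\<close>

lemma cauchy_exp_limit:
  fixes f :: "real \<Rightarrow> real"
  assumes "\<And>t h. 0 \<le> t \<Longrightarrow> 0 \<le> h \<Longrightarrow> \<bar>f (t + h) - f t\<bar> \<le> K * exp (- lm * t)" "0 < lm"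
  obtains l where "(f \<longlongrightarrow> l) at_top" "\<And>t. 0 \<le> t \<Longrightarrow> \<bar>f t - l\<bar> \<le> K * exp (- lm * t)"
proof -
  have e0: "((\<lambda>t. K * exp (- lm * t)) \<longlongrightarrow> 0) at_top" using assms(2) by real_asymp
  have "Cauchy (\<lambda>n::nat. f (real n))"
  proof (rule metric_CauchyI)
    fix e :: real assume e: "0 < e"
    have "(\<lambda>n::nat. K * exp (- lm * real n)) \<longlonglongrightarrow> 0"
      by (rule filterlim_compose[OF e0 filterlim_real_sequentially])
    then have "\<forall>\<^sub>F n in sequentially. K * exp (- lm * real n) < e / 2" using e by (intro order_tendstoD(2)) auto
    then obtain N where N: "K * exp (- lm * real N) < e / 2" by (auto simp: eventually_sequentially)
    have *: "\<bar>f (real n) - f (real N)\<bar> < e / 2" if "N \<le> n" for n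
      using assms(1)[of "real N" "real n - real N"] N that by simp
    show "\<exists>N. \<forall>m\<ge>N. \<forall>n\<ge>N. dist (f (real m)) (f (real n)) < e"
    proof (intro exI[of _ N] allI impI)
      fix m n assume "N \<le> m" "N \<le> n"
      then show "dist (f (real m)) (f (real n)) < e" using *[of m] *[of n] unfolding dist_real_def by linarith
    qed
  qed
  then obtain l where l: "(\<lambda>n::nat. f (real n)) \<longlonglongrightarrow> l" by (auto simp: Cauchy_convergent_iff convergent_def)
  have b: "\<bar>f t - l\<bar> \<le> K * exp (- lm * t)" if t: "0 \<le> t" for t
  proof (rule tendsto_upperbound)
    show "(\<lambda>n. \<bar>f t - f (real n)\<bar>) \<longlonglongrightarrow> \<bar>f t - l\<bar>" by (intro tendsto_intros l)
    show "\<forall>\<^sub>F n in sequentially. \<bar>f t - f (real n)\<bar> \<le> K * exp (- lm * t)"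
    proof (rule eventually_sequentiallyI[of "nat \<lceil>t\<rceil>"])
      fix n assume "nat \<lceil>t\<rceil> \<le> n"
      then have "t \<le> real n" by linarith
      then show "\<bar>f t - f (real n)\<bar> \<le> K * exp (- lm * t)" using assms(1)[of t "real n - t"] t by (simp add: abs_minus_commute)
    qed
  qed simp
  have "((\<lambda>t. f t - l) \<longlongrightarrow> 0) at_top"
    by (rule Lim_null_comparison[OF _ e0]) (use b in \<open>auto intro!: eventually_at_top_linorderI[of 0]\<close>)
  then have "(f \<longlongrightarrow> l) at_top" by (simp add: LIM_zero_iff)
  then show ?thesis using b that by blast
qed

section \<open>Radii and their logarithmic coordinates\<close>

text \<open>In the hyperbolic case the quotient in \<open>lgr\<close> is
  \<open>tanh (r / 2)\<close>, and \<open>rad\<close> is the inverse map. The exponential form makes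
  inverses and derivatives rational computations in \<open>exp u\<close> and
  \<open>exp r\<close>.\<close>

definition rad :: "geom \<Rightarrow> real \<Rightarrow> real" where
  "rad G u = (case G of Hyp \<Rightarrow> ln ((1 + exp u) / (1 - exp u)) | Euc \<Rightarrow> exp u)"
definition lgr :: "geom \<Rightarrow> real \<Rightarrow> real" where
  "lgr G r = (case G of Hyp \<Rightarrow> ln ((exp r - 1) / (exp r + 1)) | Euc \<Rightarrow> ln r)"

lemma lgr_rad:
  assumes "u \<in> udom G"
  shows "0 < rad G u" "lgr G (rad G u) = u" "(rad G has_real_derivative flow_factor G (rad G u)) (at u)"
proof -
  have "0 < rad G u \<and> lgr G (rad G u) = u \<and> (rad G has_real_derivative flow_factor G (rad G u)) (at u)"
  proof (cases G)
    case Euc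
    then show ?thesis by (simp add: rad_def[abs_def] lgr_def flow_factor_def)
  next
    case Hyp
    then have u: "exp u < 1" "0 < exp u" using assms by (auto simp: udom_def)
    define e where "e = exp u"
    have e: "0 < e" "e < 1" using u by (auto simp: e_def)
    have r: "exp (ln ((1 + e) / (1 - e))) = (1 + e) / (1 - e)" using e by (intro exp_ln) auto
    have "1 < (1 + e) / (1 - e)" using e by (simp add: field_simps)
    then have 1: "0 < rad G u" unfolding rad_def Hyp geom.case e_def[symmetric] by simp
    have "((1 + e) / (1 - e) - 1) / ((1 + e) / (1 - e) + 1) = e" using e by (simp add: field_simps)
    then have 2: "lgr G (rad G u) = u" unfolding lgr_def rad_def Hyp geom.case e_def[symmetric] r
      by (simp add: e_def)
    have s: "sinh (rad G u) = 2 * e / ((1 + e) * (1 - e))"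
    proof -
      have "exp (- ln ((1 + e) / (1 - e))) = (1 - e) / (1 + e)" unfolding exp_minus r by simp
      then have "sinh (rad G u) = ((1 + e) / (1 - e) - (1 - e) / (1 + e)) / 2"
        unfolding rad_def Hyp geom.case e_def[symmetric] sinh_def r by simp
      also have "(1 + e) / (1 - e) - (1 - e) / (1 + e) = ((1 + e) * (1 + e) - (1 - e) * (1 - e)) / ((1 - e) * (1 + e))"
        using e by (subst diff_frac_eq) auto
      also have "(1 + e) * (1 + e) - (1 - e) * (1 - e) = 4 * e" by (simp add: algebra_simps)
      finally show ?thesis by (simp add: mult.commute)
    qed
    have "((\<lambda>u. (1 + exp u) / (1 - exp u)) has_real_derivative 2 * e / ((1 - e) * (1 - e))) (at u)"
      by (rule derivative_eq_intros refl)+ (use u in \<open>simp_all add: e_def algebra_simps\<close>)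
    from DERIV_chain2[OF DERIV_ln this] have "((\<lambda>u. ln ((1 + exp u) / (1 - exp u))) has_real_derivative
        inverse ((1 + e) / (1 - e)) * (2 * e / ((1 - e) * (1 - e)))) (at u)"
      unfolding e_def[symmetric] using e by simp
    also have "inverse ((1 + e) / (1 - e)) * (2 * e / ((1 - e) * (1 - e))) = 2 * e / ((1 + e) * (1 - e))"
      using e by (simp add: divide_simps)
    finally show ?thesis using 1 2 s Hyp by (simp add: rad_def[abs_def] flow_factor_def)
  qed
  then show "0 < rad G u" "lgr G (rad G u) = u" "(rad G has_real_derivative flow_factor G (rad G u)) (at u)" by auto
qed

lemma rad_lgr:
  assumes "0 < r"
  shows "lgr G r \<in> udom G" "rad G (lgr G r) = r" "0 < flow_factor G r"
    "(lgr G has_real_derivative 1 / flow_factor G r) (at r)"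
proof -
  have "lgr G r \<in> udom G \<and> rad G (lgr G r) = r \<and> 0 < flow_factor G r \<and> (lgr G has_real_derivative 1 / flow_factor G r) (at r)"
  proof (cases G)
    case Euc
    then show ?thesis using assms DERIV_ln[OF assms]
      by (simp add: rad_def lgr_def[abs_def] flow_factor_def udom_def inverse_eq_divide)
  next
    case Hyp
    define e where "e = exp r"
    have e: "1 < e" using assms by (simp add: e_def)
    have pos: "0 < (e - 1) / (e + 1)" "(e - 1) / (e + 1) < 1" using e by auto
    have 1: "lgr G r \<in> udom G" unfolding Hyp lgr_def udom_def geom.case e_def[symmetric] using pos by simp
    have x: "exp (ln ((e - 1) / (e + 1))) = (e - 1) / (e + 1)" using pos by simp
    have "(1 + (e - 1) / (e + 1)) / (1 - (e - 1) / (e + 1)) = e" using e by (simp add: field_simps)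
    then have 2: "rad G (lgr G r) = r" unfolding Hyp lgr_def rad_def geom.case e_def[symmetric] x by (simp add: e_def)
    have 3: "0 < flow_factor G r" using assms Hyp by (simp add: flow_factor_def)
    have s: "sinh r = (e * e - 1) / (2 * e)" using e by (simp add: sinh_def exp_minus e_def[symmetric] field_simps)
    have "((\<lambda>r. (exp r - 1) / (exp r + 1)) has_real_derivative 2 * e / ((e + 1) * (e + 1))) (at r)"
    proof -
      have "exp r + 1 \<noteq> 0" using e unfolding e_def by linarith
      then show ?thesis
        by - ((rule derivative_eq_intros refl)+, simp_all add: e_def algebra_simps)
    qed
    from DERIV_chain2[OF DERIV_ln this] have "((\<lambda>r. ln ((exp r - 1) / (exp r + 1))) has_real_derivative
        inverse ((e - 1) / (e + 1)) * (2 * e / ((e + 1) * (e + 1)))) (at r)"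
      using pos by (simp add: e_def)
    also have "inverse ((e - 1) / (e + 1)) * (2 * e / ((e + 1) * (e + 1))) = 2 * e / ((e - 1) * (e + 1))"
      using e by (simp add: divide_simps)
    also have "\<dots> = 1 / sinh r" unfolding s using e by (simp add: divide_simps algebra_simps)
    finally show ?thesis using 1 2 3 Hyp by (simp add: lgr_def[abs_def] flow_factor_def)
  qed
  then show "lgr G r \<in> udom G" "rad G (lgr G r) = r" "0 < flow_factor G r"
    "(lgr G has_real_derivative 1 / flow_factor G r) (at r)" by auto
qed

text \<open>\<open>cosh (ln q)\<close> is the mean of \<open>q\<close> and \<open>1 / q\<close>; for
  \<open>q = tanh (r / 2)\<close> it is \<open>1 / tanh r\<close> by the double angle
  formula.\<close>

lemma xi_lgr:
  assumes "0 < r"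
  shows "xi G (lgr G r) = (case G of Hyp \<Rightarrow> tanh r | Euc \<Rightarrow> r)"
proof (cases G)
  case Hyp
  define e where "e = exp r"
  have e: "1 < e" using assms by (simp add: e_def)
  have pos: "0 < (e - 1) / (e + 1)" using e by auto
  have x: "exp (ln ((e - 1) / (e + 1))) = (e - 1) / (e + 1)" using pos by simp
  have y: "exp (- ln ((e - 1) / (e + 1))) = (e + 1) / (e - 1)" unfolding exp_minus x by simp
  have "cosh (ln ((e - 1) / (e + 1))) = ((e - 1) / (e + 1) + (e + 1) / (e - 1)) / 2"
    unfolding cosh_def x y by simp
  have halve: "2 * m / n / 2 = m / n" for m n :: real by simp
  note \<open>cosh (ln ((e - 1) / (e + 1))) = ((e - 1) / (e + 1) + (e + 1) / (e - 1)) / 2\<close>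
  also have "(e - 1) / (e + 1) + (e + 1) / (e - 1) = ((e - 1) * (e - 1) + (e + 1) * (e + 1)) / ((e + 1) * (e - 1))"
    using e by (subst add_frac_eq) auto
  also have "(e - 1) * (e - 1) + (e + 1) * (e + 1) = 2 * (e * e + 1)" by (simp add: algebra_simps)
  finally have "cosh (ln ((e - 1) / (e + 1))) = (e * e + 1) / ((e + 1) * (e - 1))"
    by (simp only: halve)
  then have c: "1 / cosh (ln ((e - 1) / (e + 1))) = (e + 1) * (e - 1) / (e * e + 1)" by simp
  have "sinh r = (e * e - 1) / (2 * e)" "cosh r = (e * e + 1) / (2 * e)"
    using e by (simp_all add: sinh_def cosh_def exp_minus e_def[symmetric] field_simps)
  then have "tanh r = (e * e - 1) / (e * e + 1)" unfolding tanh_def using e by simp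
  also have "e * e - 1 = (e + 1) * (e - 1)" by (simp add: algebra_simps)
  finally show ?thesis unfolding Hyp xi_def lgr_def geom.case e_def[symmetric] c by simp
qed (use assms in \<open>simp add: xi_def lgr_def\<close>)

lemma hyp_edge:
  fixes x y c :: real
  assumes "-1 < c" "0 < x" "0 < y"
  defines "W \<equiv> cosh x * cosh y + sinh x * sinh y * c"
  shows "1 \<le> W" "cosh (arcosh W) = W" "sinh (arcosh W) = cosh x * cosh y * sqrt (qlen 1 c (tanh x) (tanh y))"
    "0 \<le> arcosh W"
proof -
  have "sinh x * sinh y * (-1) \<le> sinh x * sinh y * c" using assms by (intro mult_left_mono) auto
  then have "cosh (x - y) \<le> W" unfolding W_def cosh_diff by simp
  then show W: "1 \<le> W" using cosh_real_ge_1[of "x - y"] by linarith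
  then show cw: "cosh (arcosh W) = W" and an: "0 \<le> arcosh W" by (simp_all add: cosh_arcosh_real arcosh_nonneg_real)
  define C D where cd: "C = cosh x" "D = cosh y"
  have p: "0 < C" "0 < D" by (auto simp: cd cosh_real_pos)
  have sx: "sinh x = C * tanh x" "sinh y = D * tanh y" using p by (auto simp: cd tanh_def)
  have "C\<^sup>2 * (1 - (tanh x)\<^sup>2) = C\<^sup>2 - (C * tanh x)\<^sup>2" "D\<^sup>2 * (1 - (tanh y)\<^sup>2) = D\<^sup>2 - (D * tanh y)\<^sup>2"
    by (simp_all add: power2_eq_square algebra_simps)
  then have tx: "C\<^sup>2 * (1 - (tanh x)\<^sup>2) = 1" "D\<^sup>2 * (1 - (tanh y)\<^sup>2) = 1"
    unfolding sx[symmetric] unfolding cd by (simp_all add: hyperbolic_pythagoras)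
  have "W\<^sup>2 - 1 = (C * D)\<^sup>2 * qlen 1 c (tanh x) (tanh y)"
  proof -
    have W': "W = C * D * (1 + tanh x * tanh y * c)" unfolding W_def sx cd[symmetric] by (simp add: algebra_simps)
    \<comment> \<open>Writing 1 as a product of two expressions \<open>cosh^2 (1 - tanh^2)\<close>
      makes the difference homogeneous, so the hyperbolic cosines factor out.\<close>
    have "W\<^sup>2 - 1 = W\<^sup>2 - (C\<^sup>2 * (1 - (tanh x)\<^sup>2)) * (D\<^sup>2 * (1 - (tanh y)\<^sup>2))" unfolding tx by simp
    also have "\<dots> = (C * D)\<^sup>2 * ((1 + tanh x * tanh y * c)\<^sup>2 - (1 - (tanh x)\<^sup>2) * (1 - (tanh y)\<^sup>2))"
      unfolding W' by algebra
    also have "(1 + tanh x * tanh y * c)\<^sup>2 - (1 - (tanh x)\<^sup>2) * (1 - (tanh y)\<^sup>2) = qlen 1 c (tanh x) (tanh y)"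
      unfolding qlen_def by algebra
    finally show ?thesis .
  qed
  then have "(sinh (arcosh W))\<^sup>2 = (C * D)\<^sup>2 * qlen 1 c (tanh x) (tanh y)"
    by (simp add: sinh_square_eq cw)
  then have "sqrt ((sinh (arcosh W))\<^sup>2) = C * D * sqrt (qlen 1 c (tanh x) (tanh y))"
    using p by (simp add: real_sqrt_mult)
  then show "sinh (arcosh W) = cosh x * cosh y * sqrt (qlen 1 c (tanh x) (tanh y))" using an by (simp add: cd)
qed

lemma euc_edge:
  fixes x y c :: real
  assumes "-1 < c" "c \<le> 1" "0 < x" "0 < y"
  shows "0 < sqrt (x\<^sup>2 + y\<^sup>2 + 2 * x * y * c)" "(sqrt (x\<^sup>2 + y\<^sup>2 + 2 * x * y * c))\<^sup>2 = x\<^sup>2 + y\<^sup>2 + 2 * x * y * c"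
    "x\<^sup>2 + y\<^sup>2 + 2 * x * y * c = qlen 0 c x y"
proof -
  show e: "x\<^sup>2 + y\<^sup>2 + 2 * x * y * c = qlen 0 c x y" by (simp add: qlen_def)
  have "0 < qlen 0 c x y" using assms by (intro qlen_pos) auto
  then show "0 < sqrt (x\<^sup>2 + y\<^sup>2 + 2 * x * y * c)" "(sqrt (x\<^sup>2 + y\<^sup>2 + 2 * x * y * c))\<^sup>2 = x\<^sup>2 + y\<^sup>2 + 2 * x * y * c"
    unfolding e by auto
qed

lemma edge_len_commute: "edge_len G \<Theta> r a b = edge_len G \<Theta> r b a"
  by (cases G) (simp_all add: edge_len_def insert_commute mult_ac add.commute)

text \<open>Numerator and denominator of the law of cosines share a positive factor,
  \<open>K\<close> in the hyperbolic and 2 in the Euclidean case; what remains is the quotient in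
  \<open>ang\<close>. The triangle inequality holds because \<open>cos \<theta>\<close> is strictly
  above \<open>-1\<close>.\<close>

lemma corner_quotient:
  fixes G :: geom and \<Theta> :: "'v set \<Rightarrow> real" and r :: "'v \<Rightarrow> real"
  assumes C: "C1t (cos (\<Theta> {p, q})) (cos (\<Theta> {v, q})) (cos (\<Theta> {v, p}))"
    and r: "0 < r v" "0 < r p" "0 < r q"
  defines "\<theta> \<equiv> th G (cos (\<Theta> {p, q})) (cos (\<Theta> {v, q})) (cos (\<Theta> {v, p})) (lgr G (r v)) (lgr G (r p)) (lgr G (r q))"
  shows "corner_angle G \<Theta> r v p q = \<theta>" "edge_len G \<Theta> r p q < edge_len G \<Theta> r p v + edge_len G \<Theta> r q v"
proof -
  define a b c where abc: "a = cos (\<Theta> {p, q})" "b = cos (\<Theta> {v, q})" "c = cos (\<Theta> {v, p})"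
  have C: "C1t a b c" using C by (simp add: abc)
  have bnd: "-1 < a" "a \<le> 1" "-1 < b" "b \<le> 1" "-1 < c" "c \<le> 1" using C by (auto simp: C1t_def)
  note ud = rad_lgr(1)[OF r(1), of G] rad_lgr(1)[OF r(2), of G] rad_lgr(1)[OF r(3), of G]
  define x y z where xyz: "x = r v" "y = r p" "z = r q"
  define lx ly lz where l: "lx = edge_len G \<Theta> r v p" "ly = edge_len G \<Theta> r v q" "lz = edge_len G \<Theta> r p q"
  have th: "\<theta> = th G a b c (lgr G x) (lgr G y) (lgr G z)" unfolding \<theta>_def abc xyz ..
  have rng: "0 < \<theta>" "\<theta> < pi" "\<bar>cos \<theta>\<bar> < 1" unfolding th xyz using th_range(1,2,6)[OF C ud] by auto
  have cth: "cos \<theta> = qnum (kap G) a b c (xi G (lgr G x)) (xi G (lgr G y)) (xi G (lgr G z))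
      / sqrt (qlen (kap G) c (xi G (lgr G x)) (xi G (lgr G y)) * qlen (kap G) b (xi G (lgr G x)) (xi G (lgr G z)))"
    unfolding th th_def xyz using ang_cos_sin(1)[OF C om_xi(1)[OF ud(1)] om_xi(1)[OF ud(2)] om_xi(1)[OF ud(3)] om_xi(2,3)[OF ud(1)]] .
  have xi: "xi G (lgr G x) = (case G of Hyp \<Rightarrow> tanh x | Euc \<Rightarrow> x)" "xi G (lgr G y) = (case G of Hyp \<Rightarrow> tanh y | Euc \<Rightarrow> y)"
    "xi G (lgr G z) = (case G of Hyp \<Rightarrow> tanh z | Euc \<Rightarrow> z)"
    unfolding xyz by (simp_all only: xi_lgr[OF r(1)] xi_lgr[OF r(2)] xi_lgr[OF r(3)])
  have "corner_angle G \<Theta> r v p q = \<theta> \<and> lz < lx + ly"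
  proof (cases G)
    case Hyp
    define X Y Z where XYZ: "X = tanh x" "Y = tanh y" "Z = tanh z"
    have le: "lx = arcosh (cosh x * cosh y + sinh x * sinh y * c)" "ly = arcosh (cosh x * cosh z + sinh x * sinh z * b)"
      "lz = arcosh (cosh y * cosh z + sinh y * sinh z * a)"
      by (simp_all add: l edge_len_def Hyp abc xyz)
    have pos: "0 < x" "0 < y" "0 < z" using r by (auto simp: xyz)
    note hx = hyp_edge[OF bnd(5) pos(1,2), folded le] and hy = hyp_edge[OF bnd(3) pos(1,3), folded le]
      and hz = hyp_edge[OF bnd(1) pos(2,3), folded le]
    define Q where "Q = sqrt (qlen 1 c X Y * qlen 1 b X Z)"
    have kd: "kdom 1 X" "kdom 1 Y" "kdom 1 Z"
      using om_xi(1)[OF ud(1)] om_xi(1)[OF ud(2)] om_xi(1)[OF ud(3)] xi unfolding xyz XYZ Hyp by (simp_all add: kap_def)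
    have "0 < qlen 1 c X Y" "0 < qlen 1 b X Z" using kd bnd by (auto simp: kdom_def intro!: qlen_pos)
    then have Q: "0 < Q" "Q = sqrt (qlen 1 c X Y) * sqrt (qlen 1 b X Z)" by (auto simp: Q_def real_sqrt_mult)
    define K where "K = cosh x * cosh x * cosh y * cosh z"
    have K: "0 < K" by (simp add: K_def cosh_real_pos)
    have sh: "sinh lx * sinh ly = K * Q" unfolding hx(3) hy(3) Q(2) XYZ K_def by (simp add: mult_ac)
    have sh': "sinh x = cosh x * X" "sinh y = cosh y * Y" "sinh z = cosh z * Z"
      by (simp_all add: XYZ tanh_def cosh_real_pos less_imp_neq[THEN not_sym])
    \<comment> \<open>This factor 1 is multiplied to the single term \<open>cosh lz\<close> so that
      it, too, contains the common factor \<open>K\<close>.\<close>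
    have tx: "1 = cosh x * cosh x * (1 - X\<^sup>2)"
    proof -
      have "cosh x * cosh x - sinh x * sinh x = 1" using hyperbolic_pythagoras[of x] by (simp add: power2_eq_square)
      then show ?thesis unfolding sh' by (simp add: algebra_simps power2_eq_square)
    qed
    have num: "cosh lx * cosh ly - cosh lz = K * qnum 1 a b c X Y Z"
    proof -
      have "cosh lx * cosh ly - cosh lz = (cosh x * cosh y + cosh x * X * (cosh y * Y) * c) * (cosh x * cosh z + cosh x * X * (cosh z * Z) * b)
          - 1 * (cosh y * cosh z + cosh y * Y * (cosh z * Z) * a)"
        unfolding hx(2) hy(2) hz(2) sh' by simp
      also have "\<dots> = K * ((1 + X * Y * c) * (1 + X * Z * b) - (1 - X\<^sup>2) * (1 + Y * Z * a))"
        unfolding K_def by (subst tx) (simp add: algebra_simps)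
      also have "(1 + X * Y * c) * (1 + X * Z * b) - (1 - X\<^sup>2) * (1 + Y * Z * a) = qnum 1 a b c X Y Z"
        unfolding qnum_def by algebra
      finally show ?thesis .
    qed
    have quot: "(cosh lx * cosh ly - cosh lz) / (sinh lx * sinh ly) = cos \<theta>"
      unfolding num sh cth xi unfolding Hyp geom.case kap_def Q_def[symmetric] XYZ[symmetric] using K by simp
    have "corner_angle G \<Theta> r v p q = arccos (cos \<theta>)"
      unfolding corner_angle_def Let_def l[symmetric] unfolding Hyp geom.case quot ..
    then have 1: "corner_angle G \<Theta> r v p q = \<theta>" using rng by (simp add: arccos_cos)
    have ss: "0 < sinh lx * sinh ly" unfolding sh using K Q by simp
    have "cosh lz = cosh lx * cosh ly - sinh lx * sinh ly * cos \<theta>"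
    proof -
      have "cosh lx * cosh ly - cosh lz = cos \<theta> * (sinh lx * sinh ly)"
        using quot ss by (metis nonzero_eq_divide_eq less_irrefl)
      then show ?thesis by (simp add: mult.commute)
    qed
    also have "\<dots> < cosh lx * cosh ly + sinh lx * sinh ly"
    proof -
      have "sinh lx * sinh ly * (- cos \<theta>) < sinh lx * sinh ly * 1" using ss rng(3) by (intro mult_strict_left_mono) auto
      then show ?thesis by simp
    qed
    also have "\<dots> = cosh (lx + ly)" by (simp add: cosh_add)
    finally have "lz < lx + ly" using hx(4) hy(4) hz(4) cosh_real_nonneg_less_iff by simp
    then show ?thesis using 1 by simp
  next
    case Euc
    have pos: "0 < x" "0 < y" "0 < z" using r by (auto simp: xyz)
    have le: "lx = sqrt (x\<^sup>2 + y\<^sup>2 + 2 * x * y * c)" "ly = sqrt (x\<^sup>2 + z\<^sup>2 + 2 * x * z * b)"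
      "lz = sqrt (y\<^sup>2 + z\<^sup>2 + 2 * y * z * a)"
      by (simp_all add: l edge_len_def Euc abc xyz)
    note hx = euc_edge[OF bnd(5,6) pos(1,2), folded le] and hy = euc_edge[OF bnd(3,4) pos(1,3), folded le]
      and hz = euc_edge[OF bnd(1,2) pos(2,3), folded le]
    have num: "lx\<^sup>2 + ly\<^sup>2 - lz\<^sup>2 = 2 * qnum 0 a b c x y z"
      unfolding hx(2) hy(2) hz(2) qnum_def by algebra
    have den: "lx * ly = sqrt (qlen 0 c x y * qlen 0 b x z)"
      unfolding le hx(3) hy(3) real_sqrt_mult ..
    have quot: "(lx\<^sup>2 + ly\<^sup>2 - lz\<^sup>2) / (2 * lx * ly) = cos \<theta>"
      unfolding num cth xi mult.assoc[of 2 lx ly] den unfolding Euc geom.case kap_def by simp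
    have "corner_angle G \<Theta> r v p q = arccos (cos \<theta>)"
      unfolding corner_angle_def Let_def l[symmetric] unfolding Euc geom.case quot ..
    then have 1: "corner_angle G \<Theta> r v p q = \<theta>" using rng by (simp add: arccos_cos)
    have ss: "0 < lx * ly" using hx hy by simp
    have "lz\<^sup>2 = lx\<^sup>2 + ly\<^sup>2 - 2 * (lx * ly) * cos \<theta>"
    proof -
      have "2 * lx * ly \<noteq> 0" using ss by auto
      then have "lx\<^sup>2 + ly\<^sup>2 - lz\<^sup>2 = cos \<theta> * (2 * lx * ly)"
        using quot by (metis nonzero_eq_divide_eq)
      then show ?thesis by (simp add: algebra_simps)
    qed
    also have "\<dots> < lx\<^sup>2 + ly\<^sup>2 + 2 * (lx * ly)"
    proof -
      have "2 * (lx * ly) * (- cos \<theta>) < 2 * (lx * ly) * 1" using ss rng(3) by (intro mult_strict_left_mono) auto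
      then show ?thesis by simp
    qed
    also have "\<dots> = (lx + ly)\<^sup>2" by (simp add: power2_eq_square algebra_simps)
    finally have "lz < lx + ly" using hx(1) hy(1) by (rule power2_less_imp_less[OF _ add_nonneg_nonneg[OF less_imp_le less_imp_le]])
    then show ?thesis using 1 by simp
  qed
  then show "corner_angle G \<Theta> r v p q = \<theta>" "edge_len G \<Theta> r p q < edge_len G \<Theta> r p v + edge_len G \<Theta> r q v"
    unfolding l edge_len_commute[of G \<Theta> r p v] edge_len_commute[of G \<Theta> r q v] by blast+
qed

section \<open>The curvature vector field\<close>

text \<open>Constants come from compactness one face or one vertex at a time; monotone dependence on
  the constant lets finitely many of them be replaced by a common one.\<close>

lemma finite_uniform_pos:
  fixes Q :: "'a \<Rightarrow> real \<Rightarrow> bool"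
  assumes "finite S" "\<And>x. x \<in> S \<Longrightarrow> \<exists>m>0. Q x m" "\<And>x m m'. x \<in> S \<Longrightarrow> Q x m \<Longrightarrow> 0 < m' \<Longrightarrow> m' \<le> m \<Longrightarrow> Q x m'"
  shows "\<exists>m>0. \<forall>x\<in>S. Q x m"
  using assms
proof (induction S rule: finite_induct)
  case empty
  show ?case by (intro exI[of _ 1]) simp
next
  case (insert x S)
  then obtain m where m: "m > 0" "\<forall>x\<in>S. Q x m" by blast
  obtain m' where m': "m' > 0" "Q x m'" using insert.prems(1)[of x] by blast
  show ?case
  proof (intro exI[of _ "min m m'"] conjI ballI)
    fix y assume y: "y \<in> insert x S"
    show "Q y (min m m')"
    proof (cases "y = x")
      case True then show ?thesis using insert.prems(2)[OF y, of m'] m m' by simp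
    next
      case False then show ?thesis using insert.prems(2)[OF y, of m] m m' y by simp
    qed
  qed (use m m' in simp)
qed

lemma finite_uniform_bound:
  fixes Q :: "'a \<Rightarrow> real \<Rightarrow> bool"
  assumes "finite S" "\<And>x. x \<in> S \<Longrightarrow> \<exists>L\<ge>0. Q x L" "\<And>x L L'. x \<in> S \<Longrightarrow> Q x L \<Longrightarrow> L \<le> L' \<Longrightarrow> Q x L'"
  shows "\<exists>L\<ge>0. \<forall>x\<in>S. Q x L"
proof -
  obtain L where L: "\<And>x. x \<in> S \<Longrightarrow> 0 \<le> L x \<and> Q x (L x)" using assms(2) by metis
  have "L x \<le> sum L S" if "x \<in> S" for x using L assms(1) that by (intro member_le_sum) auto
  then have "\<forall>x\<in>S. Q x (sum L S)" using L assms(3) by blast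
  moreover have "0 \<le> sum L S" using L by (simp add: sum_nonneg)
  ultimately show ?thesis by blast
qed

lemma incidence_swap:
  fixes h :: "'a set \<Rightarrow> 'a \<Rightarrow> real"
  assumes "finite A" "finite T"
  shows "(\<Sum>v\<in>A. \<Sum>f\<in>{f \<in> T. v \<in> f}. h f v) = (\<Sum>f\<in>T. \<Sum>v\<in>f \<inter> A. h f v)"
proof -
  have "f \<inter> A = {v \<in> A. v \<in> f}" for f by blast
  then show ?thesis using sum.swap_restrict[OF assms, of "\<lambda>v f. h f v" "\<lambda>v f. v \<in> f"] by simp
qed

lemma arccos_minus_cos: "0 \<le> t \<Longrightarrow> t \<le> pi \<Longrightarrow> arccos (- cos t) = pi - t"
  using arccos_cos[of "pi - t"] by simp

section \<open>The vector field in terms of labelled faces\<close>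

locale circle_data =
  fixes G :: geom and T :: "'v set set" and \<Theta> :: "'v set \<Rightarrow> real" and k :: "'v \<Rightarrow> real"
  assumes S: "surface_triangulation T"
    and \<Theta>_range: "\<forall>e\<in>edges T. 0 \<le> \<Theta> e \<and> \<Theta> e < pi"
    and C1: "C1 T \<Theta>"
    and K: "curvature_vector G T k"
begin

abbreviation "V \<equiv> verts T"

text \<open>Both orderings of the other two vertices are summed and halved, as in
  \<open>cone_angle\<close>, so no labelling of the faces has to be chosen.\<close>

definition fang :: "('v \<Rightarrow> real) \<Rightarrow> 'v set \<Rightarrow> 'v \<Rightarrow> real" where
  "fang u f v = (\<Sum>a\<in>f - {v}. \<Sum>b\<in>f - {v, a}.
     th G (cos (\<Theta> {a, b})) (cos (\<Theta> {v, b})) (cos (\<Theta> {v, a})) (u v) (u a) (u b)) / 2"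

definition F :: "('v \<Rightarrow> real) \<Rightarrow> 'v \<Rightarrow> real" where
  "F u v = k v - vbase T v + (\<Sum>f\<in>{f \<in> T. v \<in> f}. fang u f v)"

definition inU :: "('v \<Rightarrow> real) \<Rightarrow> bool" where "inU u \<longleftrightarrow> (\<forall>v\<in>V. u v \<in> udom G)"

lemmas surf = surf_facts[OF S]

lemma fang_eq:
  assumes "a \<noteq> b" "a \<noteq> c" "b \<noteq> c"
  shows "fang u {a, b, c} a = th G (cos (\<Theta> {b, c})) (cos (\<Theta> {a, c})) (cos (\<Theta> {a, b})) (u a) (u b) (u c)"
proof -
  have s: "{a, b, c} - {a} = {b, c}" "{a, b, c} - {a, b} = {c}" "{a, b, c} - {a, c} = {b}" using assms by auto
  have two: "(\<Sum>x\<in>{b, c}. g x) = g b + g c" for g :: "'v \<Rightarrow> real" using assms by simp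
  have com: "{c, b} = {b, c}" by auto
  show ?thesis unfolding fang_def s(1) two unfolding s(2,3) com
    by (simp add: com th_commute[of G _ "cos (\<Theta> {a, b})"])
qed

lemma face_C1t:
  assumes "{a, b, c} \<in> T" "a \<noteq> b" "a \<noteq> c" "b \<noteq> c"
  shows "C1t (cos (\<Theta> {b, c})) (cos (\<Theta> {a, c})) (cos (\<Theta> {a, b}))"
proof -
  have e: "{a, b} \<in> edges T" "{a, c} \<in> edges T" "{b, c} \<in> edges T"
    using face_edge[OF S assms(1)] assms by auto
  have r: "-1 < cos (\<Theta> e) \<and> cos (\<Theta> e) \<le> 1" if "e \<in> edges T" for e
    using \<Theta>_range that cos_monotone_0_pi[of "\<Theta> e" pi] by auto
  have card: "card {a, b, c} = 3" "card {b, c, a} = 3" "card {c, a, b} = 3" using assms by auto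
  have c1: "\<And>a b c. {a, b, c} \<in> T \<Longrightarrow> card {a, b, c} = 3 \<Longrightarrow> 0 \<le> cos (\<Theta> {a, b}) + cos (\<Theta> {b, c}) * cos (\<Theta> {c, a})"
    using C1 unfolding C1_def by blast
  have p: "{b, c, a} \<in> T" "{c, a, b} \<in> T" using assms(1) by (simp_all add: insert_commute)
  have com: "{c, a} = {a, c}" "{b, a} = {a, b}" "{c, b} = {b, c}" by auto
  show ?thesis unfolding C1t_def
    using r[OF e(1)] r[OF e(2)] r[OF e(3)] c1[OF assms(1) card(1)] c1[OF p(1) card(2)] c1[OF p(2) card(3)]
    unfolding com by (simp add: mult.commute)
qed

text \<open>A labelling of a face, bundled with its three angle functions and exterior angles. It is
  the passage from the label-free \<open>fang\<close> to the lemmas on \<open>th\<close> in three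
  variables.\<close>

definition face_rep :: "'v set \<Rightarrow> 'v \<Rightarrow> 'v \<Rightarrow> 'v \<Rightarrow> real \<Rightarrow> real \<Rightarrow> real \<Rightarrow> bool" where
  "face_rep f a b c x y z \<longleftrightarrow> f = {a, b, c} \<and> a \<noteq> b \<and> a \<noteq> c \<and> b \<noteq> c \<and> a \<in> V \<and> b \<in> V \<and> c \<in> V \<and> C1t x y z
    \<and> (\<forall>u. fang u f a = th G x y z (u a) (u b) (u c)) \<and> (\<forall>u. fang u f b = th G y x z (u b) (u a) (u c))
    \<and> (\<forall>u. fang u f c = th G z x y (u c) (u a) (u b))
    \<and> arccos (- x) = pi - \<Theta> {b, c} \<and> arccos (- y) = pi - \<Theta> {a, c} \<and> arccos (- z) = pi - \<Theta> {a, b}"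

lemma face_repD:
  assumes "face_rep f a b c x y z"
  shows "f = {a, b, c}" "a \<noteq> b" "a \<noteq> c" "b \<noteq> c" "a \<in> V" "b \<in> V" "c \<in> V" "C1t x y z"
    "fang u f a = th G x y z (u a) (u b) (u c)" "fang u f b = th G y x z (u b) (u a) (u c)"
    "fang u f c = th G z x y (u c) (u a) (u b)"
    "arccos (- x) = pi - \<Theta> {b, c}" "arccos (- y) = pi - \<Theta> {a, c}" "arccos (- z) = pi - \<Theta> {a, b}"
  using assms unfolding face_rep_def by blast+

lemma face_repr:
  assumes "f \<in> T"
  obtains a b c x y z where "face_rep f a b c x y z"
proof -
  obtain a b c where f: "f = {a, b, c}" and ne: "a \<noteq> b" "a \<noteq> c" "b \<noteq> c" by (rule face_cases[OF S assms])
  define x y z where xyz: "x = cos (\<Theta> {b, c})" "y = cos (\<Theta> {a, c})" "z = cos (\<Theta> {a, b})"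
  have com: "{c, a} = {a, c}" "{b, a} = {a, b}" "{c, b} = {b, c}" by auto
  have p: "{a, b, c} = {b, a, c}" "{a, b, c} = {c, a, b}" by auto
  have "fang u f a = th G x y z (u a) (u b) (u c)" for u unfolding f xyz by (rule fang_eq[OF ne])
  moreover have "fang u f b = th G y x z (u b) (u a) (u c)" for u
    unfolding f p(1) xyz using fang_eq[of b a c u] ne com by simp
  moreover have "fang u f c = th G z x y (u c) (u a) (u b)" for u
    unfolding f p(2) xyz using fang_eq[of c a b u] ne com by simp
  moreover have "C1t x y z" unfolding xyz using face_C1t assms f ne by blast
  moreover have "{b, c} \<in> edges T" "{a, c} \<in> edges T" "{a, b} \<in> edges T" using face_edge[OF S assms] f ne by auto
  then have "arccos (- x) = pi - \<Theta> {b, c}" "arccos (- y) = pi - \<Theta> {a, c}" "arccos (- z) = pi - \<Theta> {a, b}"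
    unfolding xyz using \<Theta>_range by (auto intro!: arccos_minus_cos simp: less_imp_le)
  moreover have "a \<in> V" "b \<in> V" "c \<in> V" using surf(7)[OF assms] f by auto
  ultimately have "face_rep f a b c x y z" unfolding face_rep_def using f ne by blast
  then show ?thesis by (rule that)
qed

lemma F_cong: "(\<And>v. v \<in> V \<Longrightarrow> u v = w v) \<Longrightarrow> v \<in> V \<Longrightarrow> F u v = F w v"
proof -
  assume eq: "\<And>v. v \<in> V \<Longrightarrow> u v = w v" and v: "v \<in> V"
  have "fang u f v = fang w f v" if "f \<in> T" "v \<in> f" for f
    unfolding fang_def using surf(7)[OF that(1)] that(2) eq
    by (intro arg_cong[where f = "\<lambda>x. x / 2"] sum.cong refl) (simp add: subset_iff)
  then show ?thesis unfolding F_def by (intro arg_cong2[where f = "(+)"] sum.cong) auto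
qed

lemma curv_eq_F:
  assumes r: "\<And>v. v \<in> V \<Longrightarrow> 0 < r v" and v: "v \<in> V"
  shows "k v - curv G T \<Theta> r v = F (\<lambda>w. lgr G (r w)) v"
proof -
  have "(\<Sum>a\<in>f - {v}. \<Sum>b\<in>f - {v, a}. corner_angle G \<Theta> r v a b) / 2 = fang (\<lambda>w. lgr G (r w)) f v"
    if f: "f \<in> T" "v \<in> f" for f
    unfolding fang_def
  proof (intro arg_cong[where f = "\<lambda>x. x / 2"] sum.cong refl)
    fix a b assume ab: "a \<in> f - {v}" "b \<in> f - {v, a}"
    have "{v, a, b} \<subseteq> f" "card {v, a, b} = 3" using ab f by auto
    then have "{v, a, b} = f" using surf(3)[OF f(1)] surf(4)[OF f(1)] by (simp add: card_subset_eq)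
    then have "C1t (cos (\<Theta> {a, b})) (cos (\<Theta> {v, b})) (cos (\<Theta> {v, a}))"
      using f ab by (intro face_C1t) auto
    moreover have "a \<in> V" "b \<in> V" using ab surf(7)[OF f(1)] by auto
    ultimately show "corner_angle G \<Theta> r v a b = th G (cos (\<Theta> {a, b})) (cos (\<Theta> {v, b})) (cos (\<Theta> {v, a})) (lgr G (r v)) (lgr G (r a)) (lgr G (r b))"
      using r v by (intro corner_quotient(1)) auto
  qed
  then have "cone_angle G T \<Theta> r v = (\<Sum>f\<in>{f \<in> T. v \<in> f}. fang (\<lambda>w. lgr G (r w)) f v)"
    unfolding cone_angle_def by (intro sum.cong) auto
  then show ?thesis unfolding curv_def F_def vbase_def by simp
qed

lemma realizable_if_pos:
  assumes r: "\<And>v. v \<in> V \<Longrightarrow> 0 < r v"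
  shows "realizable G T \<Theta> r"
  unfolding realizable_def
proof (intro allI impI)
  fix a b c assume h: "{a, b, c} \<in> T \<and> card {a, b, c} = 3"
  then have f: "{a, b, c} \<in> T" and "a \<noteq> b" "a \<noteq> c" "b \<noteq> c" by (auto simp: card_insert_if split: if_splits)
  then have "{c, a, b} \<in> T" "c \<noteq> a" "c \<noteq> b" by (auto simp: insert_commute)
  then have "C1t (cos (\<Theta> {a, b})) (cos (\<Theta> {c, b})) (cos (\<Theta> {c, a}))"
    using \<open>a \<noteq> b\<close> by (intro face_C1t) auto
  moreover have "a \<in> V" "b \<in> V" "c \<in> V" using surf(7)[OF f] by auto
  ultimately show "edge_len G \<Theta> r a b < edge_len G \<Theta> r a c + edge_len G \<Theta> r b c"
    using r by (intro corner_quotient(2)) auto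
qed

lemma circle_pattern_if_pos:
  assumes r: "\<And>v. v \<in> V \<Longrightarrow> 0 < r v"
  shows "circle_pattern G T \<Theta> r"
  unfolding circle_pattern_def
proof (intro ballI allI impI)
  fix e a b assume e: "e \<in> edges T" "e = {a, b}"
  have "a \<in> V" "b \<in> V" using e unfolding edges_def verts_def by auto
  then have p: "0 < r a" "0 < r b" using r by auto
  have c: "-1 < cos (\<Theta> {a, b})" using \<Theta>_range e cos_monotone_0_pi[of "\<Theta> e" pi] by auto
  show "let l = edge_len G \<Theta> r a b in case G of
        Hyp \<Rightarrow> cosh l = cosh (r a) * cosh (r b) + sinh (r a) * sinh (r b) * cos (\<Theta> e)
      | Euc \<Rightarrow> l\<^sup>2 = (r a)\<^sup>2 + (r b)\<^sup>2 + 2 * r a * r b * cos (\<Theta> e)"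
  proof (cases G)
    case Hyp
    then show ?thesis using hyp_edge(2)[OF c p] e by (simp add: Let_def edge_len_def)
  next
    case Euc
    then show ?thesis using euc_edge(2)[OF c cos_le_one p] e by (simp add: Let_def edge_len_def)
  qed
qed

section \<open>Angle sums over vertex sets and attainability\<close>

lemma fang_range:
  assumes "inU u" "f \<in> T" "v \<in> f"
  shows "0 < fang u f v" "fang u f v < pi"
proof -
  obtain a b c x y z where frep: "face_rep f a b c x y z" by (rule face_repr[OF assms(2)])
  note fr = face_repD[OF frep]
  have ud: "u a \<in> udom G" "u b \<in> udom G" "u c \<in> udom G" using assms(1) fr by (auto simp: inU_def)
  have "v = a \<or> v = b \<or> v = c" using assms(3) fr(1) by auto
  then show "0 < fang u f v" "fang u f v < pi"
    using th_range(1,2)[OF fr(8) ud] th_range(1,2)[OF C1t_perms(2)[OF fr(8)] ud(2,1,3)]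
      th_range(1,2)[OF C1t_perms(3)[OF fr(8)] ud(3,1,2)] fr(9-11)[of u] by auto
qed

text \<open>A single angle is below \<open>pi - \<Theta>\<close> of the opposite edge by
  \<open>th_range\<close>; two angles sum to less than \<open>pi\<close> because the third one is
  positive; three angles sum to at most \<open>pi\<close>. Only the last bound is weak.\<close>

lemma face_sum_upper:
  assumes u: "inU u" and f: "f \<in> T"
  shows "(\<Sum>v\<in>f \<inter> A. fang u f v) \<le> lim_sum \<Theta> A f"
    "f \<inter> A \<noteq> {} \<Longrightarrow> \<not> f \<subseteq> A \<Longrightarrow> (\<Sum>v\<in>f \<inter> A. fang u f v) < lim_sum \<Theta> A f"
proof -
  obtain a b c x y z where frep: "face_rep f a b c x y z" by (rule face_repr[OF f])
  note fr = face_repD[OF frep]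
  have ud: "u a \<in> udom G" "u b \<in> udom G" "u c \<in> udom G" using u fr by (auto simp: inU_def)
  define A1 A2 A3 where A: "A1 = fang u f a" "A2 = fang u f b" "A3 = fang u f c"
  have b: "A1 < pi - \<Theta> {b, c}" "A2 < pi - \<Theta> {a, c}" "A3 < pi - \<Theta> {a, b}" "A1 + A2 + A3 \<le> pi" "0 < A1" "0 < A2" "0 < A3"
    unfolding A fr(9-11) using th_range(1,3,4)[OF fr(8) ud] th_range(1,3)[OF C1t_perms(2)[OF fr(8)] ud(2,1,3)]
      th_range(1,3)[OF C1t_perms(3)[OF fr(8)] ud(3,1,2)] fr(12-14) by auto
  have sets: "f \<inter> A = (if a \<in> A then {a} else {}) \<union> (if b \<in> A then {b} else {}) \<union> (if c \<in> A then {c} else {})"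
    "f - A = (if a \<in> A then {} else {a}) \<union> (if b \<in> A then {} else {b}) \<union> (if c \<in> A then {} else {c})"
    unfolding fr(1) by auto
  have sub: "f \<subseteq> A \<longleftrightarrow> a \<in> A \<and> b \<in> A \<and> c \<in> A" unfolding fr(1) by auto
  have "(\<Sum>v\<in>f \<inter> A. fang u f v) \<le> lim_sum \<Theta> A f \<and>
    (f \<inter> A \<noteq> {} \<and> \<not> f \<subseteq> A \<longrightarrow> (\<Sum>v\<in>f \<inter> A. fang u f v) < lim_sum \<Theta> A f)"
    unfolding lim_sum_def sub sets using fr(2-4) b
    by (cases "a \<in> A"; cases "b \<in> A"; cases "c \<in> A") (simp_all add: A[symmetric] insert_commute)
  then show "(\<Sum>v\<in>f \<inter> A. fang u f v) \<le> lim_sum \<Theta> A f"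
    "f \<inter> A \<noteq> {} \<Longrightarrow> \<not> f \<subseteq> A \<Longrightarrow> (\<Sum>v\<in>f \<inter> A. fang u f v) < lim_sum \<Theta> A f" by blast+
qed

text \<open>Euclidean angles depend only on ratios of radii, that is, on differences of
  \<open>u\<close>. In hyperbolic geometry the radii in \<open>A\<close> must also be small
  absolutely, to make the triangles between them nearly flat.\<close>

definition gap :: "real \<Rightarrow> 'v set \<Rightarrow> ('v \<Rightarrow> real) \<Rightarrow> bool" where
  "gap D A u \<longleftrightarrow> (\<forall>a\<in>A. \<forall>b\<in>V - A. u a \<le> u b - D) \<and> (G = Hyp \<longrightarrow> (\<forall>a\<in>A. u a \<le> - D))"

text \<open>The bounds of \<open>face_sum_upper\<close> are attained in the limit of a large gap,
  uniformly in all configurations with that gap.\<close>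

lemma face_sum_lower:
  assumes f: "f \<in> T" and e: "0 < e"
  shows "\<forall>\<^sub>F D in at_top. \<forall>u. inU u \<and> gap D A u \<longrightarrow> lim_sum \<Theta> A f - e < (\<Sum>v\<in>f \<inter> A. fang u f v)"
proof -
  obtain a b c x y z where frep: "face_rep f a b c x y z" by (rule face_repr[OF f])
  note fr = face_repD[OF frep]
  note C = fr(8) and C' = C1t_perms[OF fr(8)]
  have C23: "C1t y z x" by (rule C1t_perms(1)[OF C'(2)])
  have sets: "f \<inter> A = (if a \<in> A then {a} else {}) \<union> (if b \<in> A then {b} else {}) \<union> (if c \<in> A then {c} else {})"
    "f - A = (if a \<in> A then {} else {a}) \<union> (if b \<in> A then {} else {b}) \<union> (if c \<in> A then {} else {c})"
    unfolding fr(1) by auto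
  show ?thesis
    \<comment> \<open>The seven facts match the nonempty intersections of the face with
      \<open>A\<close>: three single vertices, three pairs and the whole face.\<close>
    using th_link_lower[OF C e, of G] th_link_lower[OF C'(2) e, of G] th_link_lower[OF C'(3) e, of G]
      th_pair_lower[OF C e, of G] th_pair_lower[OF C'(1) e, of G] th_pair_lower[OF C23 e, of G] th_triple_lower[OF C e, of G]
  proof eventually_elim
    case (elim D)
    show ?case
    proof (intro allI impI)
      fix u assume u: "inU u \<and> gap D A u"
      have ud: "u a \<in> udom G" "u b \<in> udom G" "u c \<in> udom G" using u fr by (auto simp: inU_def)
      have g: "\<And>p q. p \<in> A \<Longrightarrow> q \<notin> A \<Longrightarrow> q \<in> V \<Longrightarrow> u p \<le> u q - D" "\<And>p. p \<in> A \<Longrightarrow> G = Hyp \<longrightarrow> u p \<le> - D"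
        using u by (auto simp: gap_def)
      define A1 A2 A3 where A: "A1 = fang u f a" "A2 = fang u f b" "A3 = fang u f c"
      have l1: "a \<in> A \<Longrightarrow> b \<notin> A \<Longrightarrow> c \<notin> A \<Longrightarrow> pi - \<Theta> {b, c} - e < A1"
        using elim(1) ud g(1)[of a b] g(1)[of a c] g(2)[of a] fr unfolding A fr(9) by auto
      have l2: "b \<in> A \<Longrightarrow> a \<notin> A \<Longrightarrow> c \<notin> A \<Longrightarrow> pi - \<Theta> {a, c} - e < A2"
        using elim(2) ud g(1)[of b a] g(1)[of b c] g(2)[of b] fr unfolding A fr(10) by auto
      have l3: "c \<in> A \<Longrightarrow> a \<notin> A \<Longrightarrow> b \<notin> A \<Longrightarrow> pi - \<Theta> {a, b} - e < A3"
        using elim(3) ud g(1)[of c a] g(1)[of c b] g(2)[of c] fr unfolding A fr(11) by auto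
      have l12: "a \<in> A \<Longrightarrow> b \<in> A \<Longrightarrow> c \<notin> A \<Longrightarrow> pi - e < A1 + A2"
        using elim(4) ud g(1)[of a c] g(1)[of b c] g(2)[of a] g(2)[of b] fr(7) unfolding A fr(9,10) by auto
      have l13: "a \<in> A \<Longrightarrow> c \<in> A \<Longrightarrow> b \<notin> A \<Longrightarrow> pi - e < A1 + A3"
        using elim(5) ud g(1)[of a b] g(1)[of c b] g(2)[of a] g(2)[of c] fr(6)
        unfolding A fr(9,11) th_commute[of G x y z] by auto
      have l23: "b \<in> A \<Longrightarrow> c \<in> A \<Longrightarrow> a \<notin> A \<Longrightarrow> pi - e < A2 + A3"
        using elim(6) ud g(1)[of b a] g(1)[of c a] g(2)[of b] g(2)[of c] fr(5)
        unfolding A fr(10,11) th_commute[of G y x z] th_commute[of G z x y] by auto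
      have l123: "a \<in> A \<Longrightarrow> b \<in> A \<Longrightarrow> c \<in> A \<Longrightarrow> pi - e < A1 + A2 + A3"
        using elim(7) ud g(2)[of a] g(2)[of b] g(2)[of c] unfolding A fr(9-11) by auto
      show "lim_sum \<Theta> A f - e < (\<Sum>v\<in>f \<inter> A. fang u f v)"
        unfolding lim_sum_def sets using fr(2-4) l1 l2 l3 l12 l13 l23 l123 e
        by (cases "a \<in> A"; cases "b \<in> A"; cases "c \<in> A") (simp_all add: A[symmetric] insert_commute)
    qed
  qed
qed

lemma sum_F:
  assumes "A \<subseteq> V"
  shows "(\<Sum>v\<in>A. F u v) = (\<Sum>v\<in>A. k v) - (\<Sum>v\<in>A. vbase T v) + (\<Sum>f\<in>T. \<Sum>v\<in>f \<inter> A. fang u f v)"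
  unfolding F_def sum.distrib sum_subtractf
  using incidence_swap[of A T "fang u"] finite_subset[OF assms surf(5)] surf(1) by simp

text \<open>\<open>\<delta>\<close> is the slack in the inequality for \<open>A\<close>. For
  \<open>A = V\<close> in hyperbolic geometry it comes from the curvature vector condition and the
  Gauss-Bonnet count; in the Euclidean case the sum over \<open>V\<close> vanishes, so this set is
  excluded. Finitely many sets \<open>A\<close> share one \<open>D\<close>.\<close>

lemma gap_sum_pos:
  assumes at: "attainable T \<Theta> k"
  shows "\<exists>D. \<forall>A u. A \<subseteq> V \<and> A \<noteq> {} \<and> (G = Euc \<longrightarrow> A \<noteq> V) \<and> inU u \<and> gap D A u \<longrightarrow> 0 < (\<Sum>v\<in>A. F u v)"
proof -
  have "\<forall>\<^sub>F D in at_top. \<forall>u. inU u \<and> gap D A u \<longrightarrow> 0 < (\<Sum>v\<in>A. F u v)"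
    if A: "A \<subseteq> V" "A \<noteq> {}" "G = Euc \<longrightarrow> A \<noteq> V" for A
  proof -
    define \<delta> where "\<delta> = (\<Sum>v\<in>A. k v) - ((\<Sum>v\<in>A. vbase T v) - (\<Sum>f\<in>T. lim_sum \<Theta> A f))"
    have d: "0 < \<delta>"
    proof (cases "A = V")
      case False
      then show ?thesis unfolding \<delta>_def attain_rhs[OF S A(1), symmetric] using at A unfolding attainable_def by auto
    next
      case True
      then have Hyp: "G = Hyp" using A(3) by (cases G) auto
      have "lim_sum \<Theta> A f = pi" if f: "f \<in> T" for f
      proof -
        have "f \<inter> A = f" using surf(7)[OF f] True by blast
        then show ?thesis using surf(3)[OF f] by (auto simp: lim_sum_def)
      qed
      then have "(\<Sum>f\<in>T. lim_sum \<Theta> A f) = pi * card T" by simp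
      then show ?thesis unfolding \<delta>_def using K gauss_bonnet_count[OF S] Hyp True
        unfolding curvature_vector_def by simp
    qed
    \<comment> \<open>Every face may lose \<open>e\<close>; the extra 1 in the denominator leaves a
      positive remainder.\<close>
    define e where "e = \<delta> / (card T + 1)"
    have e: "0 < e" using d by (simp add: e_def)
    have "\<forall>\<^sub>F D in at_top. \<forall>f\<in>T. \<forall>u. inU u \<and> gap D A u \<longrightarrow> lim_sum \<Theta> A f - e < (\<Sum>v\<in>f \<inter> A. fang u f v)"
      using face_sum_lower[OF _ e] surf(1) by (intro eventually_ball_finite) auto
    then show ?thesis
    proof eventually_elim
      case (elim D)
      show ?case
      proof (intro allI impI)
        fix u assume u: "inU u \<and> gap D A u"
        have "(\<Sum>f\<in>T. lim_sum \<Theta> A f - e) \<le> (\<Sum>f\<in>T. \<Sum>v\<in>f \<inter> A. fang u f v)"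
          using elim u by (intro sum_mono) (simp add: less_imp_le)
        then have "(\<Sum>f\<in>T. lim_sum \<Theta> A f) - card T * e \<le> (\<Sum>f\<in>T. \<Sum>v\<in>f \<inter> A. fang u f v)"
          by (simp add: sum_subtractf)
        moreover have "card T * e < \<delta>" using d by (simp add: e_def field_simps)
        ultimately show "0 < (\<Sum>v\<in>A. F u v)" unfolding sum_F[OF A(1)] \<delta>_def by linarith
      qed
    qed
  qed
  then have "\<forall>\<^sub>F D in at_top. \<forall>A\<in>{A. A \<subseteq> V \<and> A \<noteq> {} \<and> (G = Euc \<longrightarrow> A \<noteq> V)}. \<forall>u. inU u \<and> gap D A u \<longrightarrow> 0 < (\<Sum>v\<in>A. F u v)"
    using surf(5) by (intro eventually_ball_finite) auto
  then obtain D where "\<forall>A\<in>{A. A \<subseteq> V \<and> A \<noteq> {} \<and> (G = Euc \<longrightarrow> A \<noteq> V)}. \<forall>u. inU u \<and> gap D A u \<longrightarrow> 0 < (\<Sum>v\<in>A. F u v)"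
    unfolding eventually_at_top_linorder by blast
  then show ?thesis by blast
qed

text \<open>Each Euclidean face contributes exactly \<open>pi\<close>, so the sum is determined by
  the Gauss-Bonnet count and vanishes by the curvature vector condition. This is the conservation
  law of the Euclidean flow.\<close>

lemma sum_F_Euc:
  assumes "G = Euc" "inU u"
  shows "(\<Sum>v\<in>V. F u v) = 0"
proof -
  have "(\<Sum>v\<in>f \<inter> V. fang u f v) = pi" if f: "f \<in> T" for f
  proof -
    obtain a b c x y z where frep: "face_rep f a b c x y z" by (rule face_repr[OF f])
  note fr = face_repD[OF frep]
    have ud: "u a \<in> udom G" "u b \<in> udom G" "u c \<in> udom G" using assms(2) fr(5-7) by (auto simp: inU_def)
    have "f \<inter> V = {a, b, c}" using fr by auto
    then have "(\<Sum>v\<in>f \<inter> V. fang u f v) = fang u f a + fang u f b + fang u f c" using fr(2-4) by simp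
    then show ?thesis unfolding fr(9-11) using th_range(5)[OF fr(8) ud assms(1)] by simp
  qed
  then have "(\<Sum>f\<in>T. \<Sum>v\<in>f \<inter> V. fang u f v) = pi * card T" by simp
  then show ?thesis unfolding sum_F[OF order_refl] using K gauss_bonnet_count[OF S] assms(1)
    unfolding curvature_vector_def by simp
qed

text \<open>At a zero of \<open>F\<close> the prescribed angle sum over \<open>A\<close> equals the
  sum of the face contributions. These are bounded by \<open>lim_sum\<close>, strictly on a face
  that crosses the border of \<open>A\<close>.\<close>

lemma attainable_if_zero:
  assumes u: "inU u" and z: "\<And>v. v \<in> V \<Longrightarrow> F u v = 0"
  shows "attainable T \<Theta> k"
  unfolding attainable_def
proof (intro allI impI)
  fix A assume A: "A \<subset> V \<and> A \<noteq> {}"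
  then have AV: "A \<subseteq> V" by auto
  obtain f0 where f0: "f0 \<in> T" "f0 \<inter> A \<noteq> {}" "\<not> f0 \<subseteq> A" using crossing_face[OF S] A by metis
  have "(\<Sum>f\<in>T. \<Sum>v\<in>f \<inter> A. fang u f v) < (\<Sum>f\<in>T. lim_sum \<Theta> A f)"
  proof (rule sum_strict_mono_ex1[OF surf(1)])
    show "\<forall>f\<in>T. (\<Sum>v\<in>f \<inter> A. fang u f v) \<le> lim_sum \<Theta> A f" using face_sum_upper(1)[OF u] by blast
    show "\<exists>f\<in>T. (\<Sum>v\<in>f \<inter> A. fang u f v) < lim_sum \<Theta> A f"
      using face_sum_upper(2)[OF u f0(1)] f0 by blast
  qed
  moreover have "(\<Sum>v\<in>A. F u v) = 0" using z AV by (intro sum.neutral) auto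
  ultimately show "- (\<Sum>p\<in>Lk T A. pi - \<Theta> (fst p)) + 2 * pi * real_of_int (chi_int T A) + pi * real_of_int (chi_bdry T A) < sum k A"
    unfolding attain_rhs[OF S AV] using sum_F[OF AV, of u] by linarith
qed

section \<open>Lipschitz bounds and dissipation of the vector field\<close>

text \<open>The form \<open>dq\<close> without a labelling; the division by 2 compensates for
  ordered pairs.\<close>

definition dqf :: "('v \<Rightarrow> real) \<Rightarrow> 'v set \<Rightarrow> real" where
  "dqf d f = (case G of Hyp \<Rightarrow> (\<Sum>v\<in>f. (d v)\<^sup>2) | Euc \<Rightarrow> (\<Sum>v\<in>f. \<Sum>w\<in>f. (d v - d w)\<^sup>2) / 2)"

lemma dqf_eq:
  assumes "a \<noteq> b" "a \<noteq> c" "b \<noteq> c"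
  shows "dqf d {a, b, c} = dq G (d a) (d b) (d c)"
proof (cases G)
  case Hyp
  show ?thesis unfolding dqf_def dq_def unfolding Hyp geom.case using assms by simp
next
  case Euc
  show ?thesis unfolding dqf_def dq_def unfolding Euc geom.case using assms
    by (simp add: power2_commute[of "d b" "d a"] power2_commute[of "d c" "d a"] power2_commute[of "d c" "d b"])
qed

definition box :: "real \<Rightarrow> real \<Rightarrow> ('v \<Rightarrow> real) \<Rightarrow> bool" where
  "box lo hi u \<longleftrightarrow> (\<forall>v\<in>V. u v \<in> {lo..hi})"

lemma box_inU: "box lo hi u \<Longrightarrow> {lo..hi} \<subseteq> udom G \<Longrightarrow> inU u"
  by (auto simp: box_def inU_def)

lemma F_lipschitz:
  assumes I: "{lo..hi} \<subseteq> udom G"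
  shows "\<exists>L\<ge>0. \<forall>v\<in>V. \<forall>p q. box lo hi p \<and> box lo hi q \<longrightarrow> \<bar>F p v - F q v\<bar> \<le> L * (\<Sum>w\<in>V. \<bar>p w - q w\<bar>)"
proof -
  have ex: "\<exists>L\<ge>0. \<forall>p q. box lo hi p \<and> box lo hi q \<longrightarrow> (\<forall>v\<in>f. \<bar>fang p f v - fang q f v\<bar> \<le> L * (\<Sum>w\<in>V. \<bar>p w - q w\<bar>))"
    if f: "f \<in> T" for f
  proof -
    obtain a b c x y z where frep: "face_rep f a b c x y z" by (rule face_repr[OF f])
  note fr = face_repD[OF frep]
    obtain L1 where L1: "0 \<le> L1" "\<And>u v w u' v' w'. u \<in> {lo..hi} \<Longrightarrow> v \<in> {lo..hi} \<Longrightarrow> w \<in> {lo..hi} \<Longrightarrow>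
     u' \<in> {lo..hi} \<Longrightarrow> v' \<in> {lo..hi} \<Longrightarrow> w' \<in> {lo..hi} \<Longrightarrow>
     \<bar>th G x y z u v w - th G x y z u' v' w'\<bar> \<le> L1 * (\<bar>u - u'\<bar> + \<bar>v - v'\<bar> + \<bar>w - w'\<bar>)"
      using th_lipschitz[OF fr(8) I] by metis
    obtain L2 where L2: "0 \<le> L2" "\<And>u v w u' v' w'. u \<in> {lo..hi} \<Longrightarrow> v \<in> {lo..hi} \<Longrightarrow> w \<in> {lo..hi} \<Longrightarrow>
     u' \<in> {lo..hi} \<Longrightarrow> v' \<in> {lo..hi} \<Longrightarrow> w' \<in> {lo..hi} \<Longrightarrow>
     \<bar>th G y x z u v w - th G y x z u' v' w'\<bar> \<le> L2 * (\<bar>u - u'\<bar> + \<bar>v - v'\<bar> + \<bar>w - w'\<bar>)"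
      using th_lipschitz[OF C1t_perms(2)[OF fr(8)] I] by metis
    obtain L3 where L3: "0 \<le> L3" "\<And>u v w u' v' w'. u \<in> {lo..hi} \<Longrightarrow> v \<in> {lo..hi} \<Longrightarrow> w \<in> {lo..hi} \<Longrightarrow>
     u' \<in> {lo..hi} \<Longrightarrow> v' \<in> {lo..hi} \<Longrightarrow> w' \<in> {lo..hi} \<Longrightarrow>
     \<bar>th G z x y u v w - th G z x y u' v' w'\<bar> \<le> L3 * (\<bar>u - u'\<bar> + \<bar>v - v'\<bar> + \<bar>w - w'\<bar>)"
      using th_lipschitz[OF C1t_perms(3)[OF fr(8)] I] by metis
    define L where "L = L1 + L2 + L3"
    show ?thesis
    proof (intro exI[of _ L] conjI allI impI ballI)
      show "0 \<le> L" using L1(1) L2(1) L3(1) by (simp add: L_def)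
      fix p q v assume pq: "box lo hi p \<and> box lo hi q" and v: "v \<in> f"
      have r: "p a \<in> {lo..hi}" "p b \<in> {lo..hi}" "p c \<in> {lo..hi}" "q a \<in> {lo..hi}" "q b \<in> {lo..hi}" "q c \<in> {lo..hi}"
        using pq fr by (auto simp: box_def)
      define s where "s = \<bar>p a - q a\<bar> + \<bar>p b - q b\<bar> + \<bar>p c - q c\<bar>"
      have s0: "0 \<le> s" by (simp add: s_def)
      have "s = (\<Sum>w\<in>{a, b, c}. \<bar>p w - q w\<bar>)" unfolding s_def using fr(2-4) by simp
      also have "\<dots> \<le> (\<Sum>w\<in>V. \<bar>p w - q w\<bar>)" using fr(5-7) surf(5) by (intro sum_mono2) auto
      finally have s1: "s \<le> (\<Sum>w\<in>V. \<bar>p w - q w\<bar>)" .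
      have "\<bar>fang p f a - fang q f a\<bar> \<le> L1 * s" "\<bar>fang p f b - fang q f b\<bar> \<le> L2 * s" "\<bar>fang p f c - fang q f c\<bar> \<le> L3 * s"
        using L1(2)[OF r] L2(2)[OF r(2,1,3,5,4,6)] L3(2)[OF r(3,1,2,6,4,5)] unfolding fr(9-11) s_def by (simp_all add: add_ac)
      moreover have "L1 * s \<le> L * s" "L2 * s \<le> L * s" "L3 * s \<le> L * s"
        using L1(1) L2(1) L3(1) s0 by (auto simp: L_def intro!: mult_right_mono)
      ultimately have "\<bar>fang p f v - fang q f v\<bar> \<le> L * s" using v fr(1) by fastforce
      also have "\<dots> \<le> L * (\<Sum>w\<in>V. \<bar>p w - q w\<bar>)"
        using s1 L1(1) L2(1) L3(1) by (intro mult_left_mono) (auto simp: L_def)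
      finally show "\<bar>fang p f v - fang q f v\<bar> \<le> L * (\<Sum>w\<in>V. \<bar>p w - q w\<bar>)" .
    qed
  qed
  have "\<exists>L\<ge>0. \<forall>f\<in>T. \<forall>p q. box lo hi p \<and> box lo hi q \<longrightarrow> (\<forall>v\<in>f. \<bar>fang p f v - fang q f v\<bar> \<le> L * (\<Sum>w\<in>V. \<bar>p w - q w\<bar>))"
  proof (rule finite_uniform_bound[OF surf(1) ex], assumption, intro allI impI ballI)
    fix f L L' p q v
    assume h: "\<forall>p q. box lo hi p \<and> box lo hi q \<longrightarrow> (\<forall>v\<in>f. \<bar>fang p f v - fang q f v\<bar> \<le> L * (\<Sum>w\<in>V. \<bar>p w - q w\<bar>))"
      "L \<le> L'" "box lo hi p \<and> box lo hi q" "v \<in> f"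
    have "\<bar>fang p f v - fang q f v\<bar> \<le> L * (\<Sum>w\<in>V. \<bar>p w - q w\<bar>)" using h by blast
    also have "\<dots> \<le> L' * (\<Sum>w\<in>V. \<bar>p w - q w\<bar>)" using h(2) by (intro mult_right_mono sum_nonneg) auto
    finally show "\<bar>fang p f v - fang q f v\<bar> \<le> L' * (\<Sum>w\<in>V. \<bar>p w - q w\<bar>)" .
  qed
  then obtain L where L: "0 \<le> L" "\<And>f p q v. f \<in> T \<Longrightarrow> box lo hi p \<Longrightarrow> box lo hi q \<Longrightarrow> v \<in> f \<Longrightarrow>
     \<bar>fang p f v - fang q f v\<bar> \<le> L * (\<Sum>w\<in>V. \<bar>p w - q w\<bar>)" by blast
  show ?thesis
  proof (intro exI[of _ "card T * L"] conjI ballI allI impI)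
    show "0 \<le> card T * L" using L by simp
    fix v p q assume v: "v \<in> V" and pq: "box lo hi p \<and> box lo hi q"
    have "\<bar>F p v - F q v\<bar> = \<bar>\<Sum>f\<in>{f \<in> T. v \<in> f}. fang p f v - fang q f v\<bar>"
      unfolding F_def by (simp add: sum_subtractf)
    also have "\<dots> \<le> (\<Sum>f\<in>{f \<in> T. v \<in> f}. \<bar>fang p f v - fang q f v\<bar>)" by (rule sum_abs)
    also have "\<dots> \<le> (\<Sum>f\<in>{f \<in> T. v \<in> f}. L * (\<Sum>w\<in>V. \<bar>p w - q w\<bar>))"
      using L(2) pq by (intro sum_mono) auto
    also have "\<dots> \<le> (\<Sum>f\<in>T. L * (\<Sum>w\<in>V. \<bar>p w - q w\<bar>))"
      using L(1) surf(1) by (intro sum_mono2) (auto intro!: mult_nonneg_nonneg sum_nonneg)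
    finally show "\<bar>F p v - F q v\<bar> \<le> card T * L * (\<Sum>w\<in>V. \<bar>p w - q w\<bar>)" by (simp add: mult.assoc)
  qed
qed

lemma dqf_nonneg: "0 \<le> dqf d f"
  unfolding dqf_def by (cases G) (auto intro!: sum_nonneg divide_nonneg_nonneg)

lemma sum_diff_F:
  "(\<Sum>v\<in>V. d v * (F p v - F q v)) = (\<Sum>f\<in>T. \<Sum>v\<in>f. d v * (fang p f v - fang q f v))"
proof -
  have "(\<Sum>v\<in>V. d v * (F p v - F q v)) = (\<Sum>v\<in>V. \<Sum>f\<in>{f \<in> T. v \<in> f}. d v * (fang p f v - fang q f v))"
  proof (intro sum.cong refl)
    fix v
    have "F p v - F q v = (\<Sum>f\<in>{f \<in> T. v \<in> f}. fang p f v - fang q f v)"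
      unfolding F_def by (simp add: sum_subtractf)
    then show "d v * (F p v - F q v) = (\<Sum>f\<in>{f \<in> T. v \<in> f}. d v * (fang p f v - fang q f v))"
      by (simp only: sum_distrib_left)
  qed
  also have "\<dots> = (\<Sum>f\<in>T. \<Sum>v\<in>f \<inter> V. d v * (fang p f v - fang q f v))"
    by (rule incidence_swap[OF surf(5) surf(1)])
  also have "\<dots> = (\<Sum>f\<in>T. \<Sum>v\<in>f. d v * (fang p f v - fang q f v))"
    using surf(7) by (intro sum.cong refl) blast
  finally show ?thesis .
qed

lemma F_monotone:
  assumes "inU p" "inU q"
  shows "(\<Sum>v\<in>V. (p v - q v) * (F p v - F q v)) \<le> 0"
  unfolding sum_diff_F[of "\<lambda>v. p v - q v"]
proof (rule sum_nonpos)
  fix f assume f: "f \<in> T"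
  obtain a b c x y z where frep: "face_rep f a b c x y z" by (rule face_repr[OF f])
  note fr = face_repD[OF frep]
  have ud: "{p a, p b, p c, q a, q b, q c} \<subseteq> udom G" using assms fr(5-7) by (auto simp: inU_def)
  have "(\<Sum>v\<in>f. (p v - q v) * (fang p f v - fang q f v)) = (p a - q a) * (fang p f a - fang q f a)
     + (p b - q b) * (fang p f b - fang q f b) + (p c - q c) * (fang p f c - fang q f c)"
    unfolding fr(1) using fr(2-4) by (simp add: add.assoc)
  also have "\<dots> \<le> 0" unfolding fr(9-11) by (rule face_monotone[OF fr(8) ud])
  finally show "(\<Sum>v\<in>f. (p v - q v) * (fang p f v - fang q f v)) \<le> 0" .
qed

lemma F_dissipative:
  assumes I: "{lo..hi} \<subseteq> udom G"
  shows "\<exists>m>0. \<forall>p q. box lo hi p \<and> box lo hi q \<longrightarrow>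
    (\<Sum>v\<in>V. (p v - q v) * (F p v - F q v)) \<le> - m * (\<Sum>f\<in>T. dqf (\<lambda>v. p v - q v) f)"
proof -
  have ex: "\<exists>m>0. \<forall>p q. box lo hi p \<and> box lo hi q \<longrightarrow>
     (\<Sum>v\<in>f. (p v - q v) * (fang p f v - fang q f v)) \<le> - m * dqf (\<lambda>v. p v - q v) f" if f: "f \<in> T" for f
  proof -
    obtain a b c x y z where frep: "face_rep f a b c x y z" by (rule face_repr[OF f])
    note fr = face_repD[OF frep]
    obtain m where m: "0 < m" "\<And>u v w u' v' w'. u \<in> {lo..hi} \<Longrightarrow> v \<in> {lo..hi} \<Longrightarrow> w \<in> {lo..hi} \<Longrightarrow>
     u' \<in> {lo..hi} \<Longrightarrow> v' \<in> {lo..hi} \<Longrightarrow> w' \<in> {lo..hi} \<Longrightarrow>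
     (u - u') * (th G x y z u v w - th G x y z u' v' w')
     + (v - v') * (th G y x z v u w - th G y x z v' u' w')
     + (w - w') * (th G z x y w u v - th G z x y w' u' v')
     \<le> - m * dq G (u - u') (v - v') (w - w')"
      using face_dissip[OF fr(8) I] by blast
    show ?thesis
    proof (intro exI[of _ m] conjI m(1) allI impI)
      fix p q assume "box lo hi p \<and> box lo hi q"
      then have r: "p a \<in> {lo..hi}" "p b \<in> {lo..hi}" "p c \<in> {lo..hi}" "q a \<in> {lo..hi}" "q b \<in> {lo..hi}" "q c \<in> {lo..hi}"
        using fr(5-7) by (auto simp: box_def)
      have "(\<Sum>v\<in>f. (p v - q v) * (fang p f v - fang q f v)) = (p a - q a) * (fang p f a - fang q f a)
         + (p b - q b) * (fang p f b - fang q f b) + (p c - q c) * (fang p f c - fang q f c)"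
        unfolding fr(1) using fr(2-4) by (simp add: add.assoc)
      also have "\<dots> \<le> - m * dq G (p a - q a) (p b - q b) (p c - q c)" unfolding fr(9-11) by (rule m(2)[OF r])
      also have "dq G (p a - q a) (p b - q b) (p c - q c) = dqf (\<lambda>v. p v - q v) f"
        unfolding fr(1) by (rule dqf_eq[OF fr(2-4), symmetric])
      finally show "(\<Sum>v\<in>f. (p v - q v) * (fang p f v - fang q f v)) \<le> - m * dqf (\<lambda>v. p v - q v) f" .
    qed
  qed
  have "\<exists>m>0. \<forall>f\<in>T. \<forall>p q. box lo hi p \<and> box lo hi q \<longrightarrow>
     (\<Sum>v\<in>f. (p v - q v) * (fang p f v - fang q f v)) \<le> - m * dqf (\<lambda>v. p v - q v) f"
  proof (rule finite_uniform_pos[OF surf(1) ex], assumption, intro allI impI)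
    fix f m m' p q
    assume h: "\<forall>p q. box lo hi p \<and> box lo hi q \<longrightarrow>
      (\<Sum>v\<in>f. (p v - q v) * (fang p f v - fang q f v)) \<le> - m * dqf (\<lambda>v. p v - q v) f"
      "0 < m'" "m' \<le> m" "box lo hi p \<and> box lo hi q"
    have "(\<Sum>v\<in>f. (p v - q v) * (fang p f v - fang q f v)) \<le> - m * dqf (\<lambda>v. p v - q v) f" using h by blast
    also have "\<dots> \<le> - m' * dqf (\<lambda>v. p v - q v) f" using h(3) dqf_nonneg by (intro mult_right_mono) auto
    finally show "(\<Sum>v\<in>f. (p v - q v) * (fang p f v - fang q f v)) \<le> - m' * dqf (\<lambda>v. p v - q v) f" .
  qed
  then obtain m where m: "0 < m" "\<And>f p q. f \<in> T \<Longrightarrow> box lo hi p \<Longrightarrow> box lo hi q \<Longrightarrow>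
     (\<Sum>v\<in>f. (p v - q v) * (fang p f v - fang q f v)) \<le> - m * dqf (\<lambda>v. p v - q v) f" by blast
  show ?thesis
  proof (intro exI[of _ m] conjI m(1) allI impI)
    fix p q assume pq: "box lo hi p \<and> box lo hi q"
    have "(\<Sum>v\<in>V. (p v - q v) * (F p v - F q v)) \<le> (\<Sum>f\<in>T. - m * dqf (\<lambda>v. p v - q v) f)"
      unfolding sum_diff_F[of "\<lambda>v. p v - q v"] using m(2) pq by (intro sum_mono) auto
    then show "(\<Sum>v\<in>V. (p v - q v) * (F p v - F q v)) \<le> - m * (\<Sum>f\<in>T. dqf (\<lambda>v. p v - q v) f)"
      by (simp add: sum_distrib_left)
  qed
qed

text \<open>In the Euclidean case the face forms control only differences along edges. Connectedness
  carries this along paths, and the mean-zero condition removes the remaining constants. In the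
  hyperbolic case every vertex lies in a face whose form contains its square.\<close>

lemma poincare:
  shows "\<exists>P>0. \<forall>d. (G = Euc \<longrightarrow> (\<Sum>v\<in>V. d v) = 0) \<longrightarrow> (\<Sum>v\<in>V. (d v)\<^sup>2) \<le> P * (\<Sum>f\<in>T. dqf d f)"
proof (cases G)
  case Hyp
  have "(\<Sum>v\<in>V. (d v)\<^sup>2) \<le> (\<Sum>f\<in>T. dqf d f)" for d
  proof -
    have "(d v)\<^sup>2 \<le> (\<Sum>f\<in>{f \<in> T. v \<in> f}. (d v)\<^sup>2)" if v: "v \<in> V" for v
    proof -
      obtain f where "f \<in> {f \<in> T. v \<in> f}" using v unfolding verts_def by blast
      then show ?thesis using surf(1) by (intro member_le_sum[of f _ "\<lambda>_. (d v)\<^sup>2"]) auto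
    qed
    then have "(\<Sum>v\<in>V. (d v)\<^sup>2) \<le> (\<Sum>v\<in>V. \<Sum>f\<in>{f \<in> T. v \<in> f}. (d v)\<^sup>2)" by (rule sum_mono)
    also have "\<dots> = (\<Sum>f\<in>T. \<Sum>v\<in>f \<inter> V. (d v)\<^sup>2)" by (rule incidence_swap[OF surf(5) surf(1)])
    also have "\<dots> = (\<Sum>f\<in>T. dqf d f)"
    proof (intro sum.cong refl)
      fix f assume "f \<in> T"
      then have "f \<inter> V = f" using surf(7) by blast
      then show "(\<Sum>v\<in>f \<inter> V. (d v)\<^sup>2) = dqf d f" unfolding dqf_def unfolding Hyp by simp
    qed
    finally show ?thesis .
  qed
  then show ?thesis by (intro exI[of _ 1]) auto
next
  case Euc
  define E where "E = (\<lambda>d. \<Sum>f\<in>T. dqf d f)"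
  have E0: "0 \<le> E d" for d unfolding E_def by (intro sum_nonneg dqf_nonneg)
  have edge: "(d a - d b)\<^sup>2 \<le> 2 * E d" if ab: "(a, b) \<in> skel_adj T" for a b d
  proof -
    obtain f where f: "f \<in> T" "a \<in> f" "b \<in> f" using ab unfolding skel_adj_def edges_def by auto
    have "(d a - d b)\<^sup>2 \<le> (\<Sum>w\<in>f. (d a - d w)\<^sup>2)" using f surf(4) by (intro member_le_sum) auto
    also have "\<dots> \<le> (\<Sum>v\<in>f. \<Sum>w\<in>f. (d v - d w)\<^sup>2)"
      using f surf(4) by (intro member_le_sum[of a f "\<lambda>v. \<Sum>w\<in>f. (d v - d w)\<^sup>2"]) (auto intro: sum_nonneg)
    also have "\<dots> = 2 * dqf d f" unfolding dqf_def unfolding Euc by simp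
    also have "dqf d f \<le> E d" unfolding E_def using f surf(1) dqf_nonneg by (intro member_le_sum) auto
    finally show ?thesis by simp
  qed
  have pair: "\<exists>C\<ge>0. \<forall>d. (d a - d b)\<^sup>2 \<le> C * E d" if "(a, b) \<in> (skel_adj T)\<^sup>*" for a b
    using that
  proof (induction rule: rtrancl_induct)
    case base
    show ?case by (intro exI[of _ 0]) simp
  next
    case (step b c)
    then obtain C where C: "0 \<le> C" "\<And>d. (d a - d b)\<^sup>2 \<le> C * E d" by blast
    \<comment> \<open>From \<open>(x + y)^2 \<le> 2 x^2 + 2 y^2\<close>, with constant
      \<open>C\<close> for the path so far and 2 for the last edge.\<close>
    have "(d a - d c)\<^sup>2 \<le> (2 * C + 4) * E d" for d
    proof -
      have "(d a - d c)\<^sup>2 \<le> 2 * (d a - d b)\<^sup>2 + 2 * (d b - d c)\<^sup>2"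
      proof -
        have "2 * (d a - d b)\<^sup>2 + 2 * (d b - d c)\<^sup>2 - (d a - d c)\<^sup>2 = (d a - 2 * d b + d c)\<^sup>2"
          by (simp add: power2_eq_square algebra_simps)
        then show ?thesis by (smt (verit) zero_le_power2)
      qed
      then show ?thesis using C(2)[of d] edge[OF step.hyps(2), of d] by (simp add: algebra_simps)
    qed
    then show ?case using C by (intro exI[of _ "2 * C + 4"]) auto
  qed
  have "\<exists>C\<ge>0. \<forall>ab\<in>V \<times> V. \<forall>d. (d (fst ab) - d (snd ab))\<^sup>2 \<le> C * E d"
  proof (rule finite_uniform_bound)
    show "finite (V \<times> V)" using surf(5) by simp
    show "\<exists>C\<ge>0. \<forall>d. (d (fst ab) - d (snd ab))\<^sup>2 \<le> C * E d" if "ab \<in> V \<times> V" for ab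
      using that S by (intro pair) (auto simp: surface_triangulation_def)
    show "\<forall>d. (d (fst ab) - d (snd ab))\<^sup>2 \<le> C' * E d"
      if "\<forall>d. (d (fst ab) - d (snd ab))\<^sup>2 \<le> C * E d" "C \<le> C'" for ab :: "'v \<times> 'v" and C C' :: real
    proof
      fix d
      have "(d (fst ab) - d (snd ab))\<^sup>2 \<le> C * E d" using that(1) by blast
      also have "\<dots> \<le> C' * E d" using that(2) E0 by (intro mult_right_mono) auto
      finally show "(d (fst ab) - d (snd ab))\<^sup>2 \<le> C' * E d" .
    qed
  qed
  then obtain C where C: "0 \<le> C" "\<And>a b d. a \<in> V \<Longrightarrow> b \<in> V \<Longrightarrow> (d a - d b)\<^sup>2 \<le> C * E d" by force
  define n where "n = real (card V)"
  have n: "0 < n" unfolding n_def using surf(5,11) by (simp add: card_gt_0_iff)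
  have "(\<Sum>v\<in>V. (d v)\<^sup>2) \<le> (n * C + 1) * E d" if d0: "(\<Sum>v\<in>V. d v) = 0" for d
  proof -
    have pt: "(d a)\<^sup>2 \<le> C * E d" if a: "a \<in> V" for a
    proof -
      \<comment> \<open>Mean zero makes each value an average of differences.\<close>
      have "n * d a = (\<Sum>b\<in>V. d a - d b)" using d0 by (simp add: sum_subtractf n_def)
      then have "(n * d a)\<^sup>2 = (\<Sum>b\<in>V. d a - d b)\<^sup>2" by simp
      also have "\<dots> \<le> n * (\<Sum>b\<in>V. (d a - d b)\<^sup>2)"
        using sum_squared_le_sum_of_squares[of "\<lambda>b. d a - d b" V] by (simp add: n_def mult.commute)
      also have "\<dots> \<le> n * (\<Sum>b\<in>V. C * E d)" using n C(2)[OF a] by (intro mult_left_mono sum_mono) auto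
      also have "\<dots> = n\<^sup>2 * (C * E d)" by (simp add: n_def power2_eq_square)
      finally show ?thesis using n by (simp add: power_mult_distrib)
    qed
    have "(\<Sum>v\<in>V. (d v)\<^sup>2) \<le> (\<Sum>v\<in>V. C * E d)" using pt by (rule sum_mono)
    also have "\<dots> = n * C * E d" by (simp add: n_def)
    also have "\<dots> \<le> (n * C + 1) * E d" using E0 by (intro mult_right_mono) auto
    finally show ?thesis .
  qed
  moreover have "0 < n * C + 1" using n C(1) by (simp add: add_nonneg_pos)
  ultimately show ?thesis unfolding E_def Euc by blast
qed

lemma strong_dissipation:
  assumes I: "{lo..hi} \<subseteq> udom G"
  shows "\<exists>\<mu>>0. \<forall>p q. box lo hi p \<and> box lo hi q \<and> (G = Euc \<longrightarrow> (\<Sum>v\<in>V. p v - q v) = 0) \<longrightarrow>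
    (\<Sum>v\<in>V. (p v - q v) * (F p v - F q v)) \<le> - \<mu> * (\<Sum>v\<in>V. (p v - q v)\<^sup>2)"
proof -
  obtain m where m: "0 < m" "\<And>p q. box lo hi p \<Longrightarrow> box lo hi q \<Longrightarrow>
    (\<Sum>v\<in>V. (p v - q v) * (F p v - F q v)) \<le> - m * (\<Sum>f\<in>T. dqf (\<lambda>v. p v - q v) f)"
    using F_dissipative[OF I] by blast
  obtain P where P: "0 < P" "\<And>d. (G = Euc \<longrightarrow> (\<Sum>v\<in>V. d v) = 0) \<Longrightarrow> (\<Sum>v\<in>V. (d v)\<^sup>2) \<le> P * (\<Sum>f\<in>T. dqf d f)"
    using poincare by blast
  show ?thesis
  proof (intro exI[of _ "m / P"] conjI allI impI)
    show "0 < m / P" using m P by simp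
    fix p q assume h: "box lo hi p \<and> box lo hi q \<and> (G = Euc \<longrightarrow> (\<Sum>v\<in>V. p v - q v) = 0)"
    have "(\<Sum>v\<in>V. (p v - q v)\<^sup>2) \<le> P * (\<Sum>f\<in>T. dqf (\<lambda>v. p v - q v) f)" using P(2)[of "\<lambda>v. p v - q v"] h by blast
    then have "m / P * (\<Sum>v\<in>V. (p v - q v)\<^sup>2) \<le> m / P * (P * (\<Sum>f\<in>T. dqf (\<lambda>v. p v - q v) f))"
      using m P by (intro mult_left_mono) auto
    also have "\<dots> = m * (\<Sum>f\<in>T. dqf (\<lambda>v. p v - q v) f)" using P(1) by simp
    finally show "(\<Sum>v\<in>V. (p v - q v) * (F p v - F q v)) \<le> - (m / P) * (\<Sum>v\<in>V. (p v - q v)\<^sup>2)"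
      using m(2)[of p q] h by simp
  qed
qed

section \<open>Bounds for the vector field\<close>

lemma F_bound: "\<exists>B\<ge>0. \<forall>u v. inU u \<and> v \<in> V \<longrightarrow> \<bar>F u v\<bar> \<le> B"
proof (intro exI conjI allI impI)
  let ?B = "(\<Sum>w\<in>V. \<bar>k w\<bar>) + 2 * pi + pi * card T"
  show "0 \<le> ?B" by (auto intro!: add_nonneg_nonneg sum_nonneg)
  fix u v assume h: "inU u \<and> v \<in> V"
  have "\<bar>k v\<bar> \<le> (\<Sum>w\<in>V. \<bar>k w\<bar>)" using h surf(5) by (intro member_le_sum) auto
  moreover have "\<bar>vbase T v\<bar> \<le> 2 * pi" by (simp add: vbase_def)
  moreover have "0 \<le> (\<Sum>f\<in>{f \<in> T. v \<in> f}. fang u f v)"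
    using fang_range(1) h by (intro sum_nonneg) (auto simp: less_imp_le)
  moreover have "(\<Sum>f\<in>{f \<in> T. v \<in> f}. fang u f v) \<le> pi * card T"
  proof -
    have "(\<Sum>f\<in>{f \<in> T. v \<in> f}. fang u f v) \<le> (\<Sum>f\<in>{f \<in> T. v \<in> f}. pi)"
      using fang_range(2) h by (intro sum_mono) (auto simp: less_imp_le)
    also have "\<dots> \<le> (\<Sum>f\<in>T. pi)" using surf(1) by (intro sum_mono2) auto
    finally show ?thesis by (simp add: mult.commute)
  qed
  ultimately show "\<bar>F u v\<bar> \<le> ?B" unfolding F_def by linarith
qed

text \<open>The curvature vector condition keeps \<open>k v\<close> strictly below
  \<open>vbase T v\<close>. As \<open>u v\<close> approaches 0 the circle at \<open>v\<close> is
  large and all face angles there are small, so they cannot make up for that difference. This gives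
  an upper barrier for the hyperbolic flow.\<close>

lemma F_neg_near_0:
  assumes Hyp: "G = Hyp"
  shows "\<exists>\<beta>>0. \<forall>u v. inU u \<and> v \<in> V \<and> - \<beta> \<le> u v \<longrightarrow> F u v < 0"
proof -
  have "\<exists>\<delta>>0. \<forall>v\<in>V. \<delta> \<le> vbase T v - k v"
  proof (rule finite_uniform_pos[OF surf(5)])
    show "\<exists>m>0. m \<le> vbase T v - k v" if "v \<in> V" for v
      using K that unfolding curvature_vector_def vbase_def by (intro exI[of _ "vbase T v - k v"]) (auto simp: vbase_def)
  qed simp
  then obtain \<delta> where \<delta>: "0 < \<delta>" "\<And>v. v \<in> V \<Longrightarrow> \<delta> \<le> vbase T v - k v" by blast
  define e where "e = \<delta> / (card T + 1)"
  have e: "0 < e" using \<delta> by (simp add: e_def)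
  have ex: "\<exists>\<beta>>0. \<forall>u v. inU u \<and> v \<in> f \<and> - \<beta> \<le> u v \<longrightarrow> fang u f v < e" if f: "f \<in> T" for f
  proof -
    obtain a b c x y z where frep: "face_rep f a b c x y z" by (rule face_repr[OF f])
    note fr = face_repD[OF frep]
    obtain \<beta>1 where 1: "0 < \<beta>1" "\<And>u v w. - \<beta>1 \<le> u \<Longrightarrow> u < 0 \<Longrightarrow> v < 0 \<Longrightarrow> w < 0 \<Longrightarrow> th Hyp x y z u v w < e"
      using th_small_if_large[OF fr(8) e] by blast
    obtain \<beta>2 where 2: "0 < \<beta>2" "\<And>u v w. - \<beta>2 \<le> u \<Longrightarrow> u < 0 \<Longrightarrow> v < 0 \<Longrightarrow> w < 0 \<Longrightarrow> th Hyp y x z u v w < e"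
      using th_small_if_large[OF C1t_perms(2)[OF fr(8)] e] by blast
    obtain \<beta>3 where 3: "0 < \<beta>3" "\<And>u v w. - \<beta>3 \<le> u \<Longrightarrow> u < 0 \<Longrightarrow> v < 0 \<Longrightarrow> w < 0 \<Longrightarrow> th Hyp z x y u v w < e"
      using th_small_if_large[OF C1t_perms(3)[OF fr(8)] e] by blast
    show ?thesis
    proof (intro exI[of _ "min \<beta>1 (min \<beta>2 \<beta>3)"] conjI allI impI)
      fix u v assume h: "inU u \<and> v \<in> f \<and> - min \<beta>1 (min \<beta>2 \<beta>3) \<le> u v"
      have "u a \<in> udom G" "u b \<in> udom G" "u c \<in> udom G" using h fr(5-7) by (auto simp: inU_def)
      then have ud: "u a < 0" "u b < 0" "u c < 0" using Hyp by (auto simp: udom_def)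
      consider "v = a" | "v = b" | "v = c" using h fr(1) by auto
      then show "fang u f v < e"
      proof cases
        case a: 1
        then show ?thesis using h ud 1(2)[of "u a" "u b" "u c"] unfolding a fr(9) unfolding Hyp by auto
      next
        case b: 2
        then show ?thesis using h ud 2(2)[of "u b" "u a" "u c"] unfolding b fr(10) unfolding Hyp by auto
      next
        case c: 3
        then show ?thesis using h ud 3(2)[of "u c" "u a" "u b"] unfolding c fr(11) unfolding Hyp by auto
      qed
    qed (use 1 2 3 in simp)
  qed
  have "\<exists>\<beta>>0. \<forall>f\<in>T. \<forall>u v. inU u \<and> v \<in> f \<and> - \<beta> \<le> u v \<longrightarrow> fang u f v < e"
    by (rule finite_uniform_pos[OF surf(1) ex]) (assumption, force)
  then obtain \<beta> where \<beta>: "0 < \<beta>" "\<And>f u v. f \<in> T \<Longrightarrow> inU u \<Longrightarrow> v \<in> f \<Longrightarrow> - \<beta> \<le> u v \<Longrightarrow> fang u f v < e" by blast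
  show ?thesis
  proof (intro exI[of _ \<beta>] conjI \<beta>(1) allI impI)
    fix u v assume h: "inU u \<and> v \<in> V \<and> - \<beta> \<le> u v"
    have "(\<Sum>f\<in>{f \<in> T. v \<in> f}. fang u f v) \<le> (\<Sum>f\<in>{f \<in> T. v \<in> f}. e)"
      using \<beta>(2) h by (intro sum_mono) (auto simp: less_imp_le)
    also have "\<dots> \<le> (\<Sum>f\<in>T. e)" using surf(1) e by (intro sum_mono2) auto
    also have "\<dots> = card T * e" by simp
    also have "\<dots> < \<delta>" using \<delta>(1) by (simp add: e_def field_simps)
    finally show "F u v < 0" unfolding F_def using \<delta>(2)[of v] h by linarith
  qed
qed

section \<open>Global solutions and their limits\<close>

text \<open>The derivative is taken within \<open>{0..}\<close> even at \<open>t = N\<close>, so it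
  is two-sided at every positive time, and a solution up to some time is one up to every smaller
  time.\<close>

definition sol :: "(real \<Rightarrow> 'v \<Rightarrow> real) \<Rightarrow> real \<Rightarrow> bool" where
  "sol u N \<longleftrightarrow> (\<forall>t. 0 \<le> t \<and> t \<le> N \<longrightarrow> inU (u t) \<and>
     (\<forall>v\<in>V. ((\<lambda>s. u s v) has_real_derivative F (u t) v) (at t within {0..})))"

lemma solD:
  assumes "sol u N" "0 \<le> t" "t \<le> N"
  shows "inU (u t)" "v \<in> V \<Longrightarrow> ((\<lambda>s. u s v) has_real_derivative F (u t) v) (at t within {0..})"
  using assms unfolding sol_def by blast+

lemma sq_dist_deriv:
  assumes "sol u N" "sol w N" "0 \<le> t" "t \<le> N"
  shows "((\<lambda>s. \<Sum>v\<in>V. (u s v - w s v)\<^sup>2) has_real_derivative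
     2 * (\<Sum>v\<in>V. (u t v - w t v) * (F (u t) v - F (w t) v))) (at t within {0..})"
proof -
  have "((\<lambda>s. \<Sum>v\<in>V. (u s v - w s v)\<^sup>2) has_real_derivative
     (\<Sum>v\<in>V. 2 * (u t v - w t v) * (F (u t) v - F (w t) v))) (at t within {0..})"
  proof (rule DERIV_sum)
    fix v assume v: "v \<in> V"
    show "((\<lambda>s. (u s v - w s v)\<^sup>2) has_real_derivative 2 * (u t v - w t v) * (F (u t) v - F (w t) v)) (at t within {0..})"
      by (rule derivative_eq_intros solD(2)[OF assms(1,3,4) v] solD(2)[OF assms(2,3,4) v] refl)+ simp
  qed
  then show ?thesis by (simp only: sum_distrib_left mult.assoc)
qed

lemma sol_unique:
  assumes "sol u N" "sol w N" "\<And>v. v \<in> V \<Longrightarrow> u 0 v = w 0 v" "0 \<le> t" "t \<le> N" "v \<in> V"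
  shows "u t v = w t v"
proof -
  have "(\<Sum>v\<in>V. (u t v - w t v)\<^sup>2) \<le> (\<Sum>v\<in>V. (u 0 v - w 0 v)\<^sup>2)"
  proof (rule DERIV_within_Ici_nonincreasing[OF _ _ order_refl assms(4)])
    fix x assume x: "0 \<le> x" "x \<le> t"
    then have xN: "x \<le> N" using assms(5) by simp
    show "((\<lambda>s. \<Sum>v\<in>V. (u s v - w s v)\<^sup>2) has_real_derivative
      2 * (\<Sum>v\<in>V. (u x v - w x v) * (F (u x) v - F (w x) v))) (at x within {0..})"
      by (rule sq_dist_deriv[OF assms(1,2) x(1) xN])
    show "2 * (\<Sum>v\<in>V. (u x v - w x v) * (F (u x) v - F (w x) v)) \<le> 0"
      using F_monotone[OF solD(1)[OF assms(1) x(1) xN] solD(1)[OF assms(2) x(1) xN]] by simp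
  qed
  also have "\<dots> = 0" using assms(3) by simp
  finally have "(\<Sum>v\<in>V. (u t v - w t v)\<^sup>2) = 0" by (intro antisym sum_nonneg) auto
  then show ?thesis using surf(5) assms(6) by (simp add: sum_nonneg_eq_0_iff)
qed

lemma hyp_barrier:
  assumes "G = Hyp" "inU u0"
  obtains hi where "hi \<in> udom G" "\<And>v. v \<in> V \<Longrightarrow> u0 v \<le> hi" "\<And>u v. inU u \<Longrightarrow> v \<in> V \<Longrightarrow> hi \<le> u v \<Longrightarrow> F u v < 0"
proof -
  obtain \<beta> where \<beta>: "0 < \<beta>" "\<And>u v. inU u \<Longrightarrow> v \<in> V \<Longrightarrow> - \<beta> \<le> u v \<Longrightarrow> F u v < 0"
    using F_neg_near_0[OF assms(1)] by blast
  have "\<exists>\<gamma>>0. \<forall>v\<in>V. \<gamma> \<le> - u0 v"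
  proof (rule finite_uniform_pos[OF surf(5)])
    fix v assume "v \<in> V"
    then have "u0 v \<in> udom G" using assms(2) by (simp add: inU_def)
    then have "u0 v < 0" using assms(1) by (simp add: udom_def)
    then show "\<exists>m>0. m \<le> - u0 v" by (intro exI[of _ "- u0 v"]) simp
  qed simp
  then obtain \<gamma> where \<gamma>: "0 < \<gamma>" "\<And>v. v \<in> V \<Longrightarrow> \<gamma> \<le> - u0 v" by blast
  show ?thesis
  proof (rule that[of "- min \<beta> \<gamma>"])
    show "- min \<beta> \<gamma> \<in> udom G" using \<beta>(1) \<gamma>(1) assms(1) by (simp add: udom_def)
    show "u0 v \<le> - min \<beta> \<gamma>" if "v \<in> V" for v using \<gamma>(2)[OF that] by linarith
    show "F u v < 0" if "inU u" "v \<in> V" "- min \<beta> \<gamma> \<le> u v" for u v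
      using \<beta>(2)[OF that(1,2)] that(3) by linarith
  qed
qed

section \<open>Existence for all times\<close>

text \<open>Composing \<open>F\<close> with the projection onto a box gives a bounded field that is
  Lipschitz everywhere, so \<open>bounded_lipschitz_ode\<close> applies. The box is chosen so large
  that the solution stays inside up to time \<open>N\<close>, where the projection does
  nothing.\<close>

lemma sol_exists:
  assumes u0: "inU u0" and N: "0 \<le> N"
  shows "\<exists>u. sol u N \<and> (\<forall>v\<in>V. u 0 v = u0 v)"
proof -
  obtain B where B: "0 \<le> B" "\<And>u v. inU u \<Longrightarrow> v \<in> V \<Longrightarrow> \<bar>F u v\<bar> \<le> B" using F_bound by blast
  \<comment> \<open>A speed of at most \<open>B\<close> confines every coordinate to
    \<open>{- M..M}\<close> up to time \<open>N\<close>.\<close>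
  define M where "M = (\<Sum>v\<in>V. \<bar>u0 v\<bar>) + B * N"
  have uM: "\<bar>u0 v\<bar> + B * t \<le> M" if "v \<in> V" "t \<le> N" for v t
    unfolding M_def using that surf(5) B(1) by (intro add_mono member_le_sum mult_left_mono) auto
  obtain hi where hi: "hi \<in> udom G" "\<And>v. v \<in> V \<Longrightarrow> u0 v \<le> hi" "G = Euc \<Longrightarrow> M \<le> hi"
    "\<And>u v. G = Hyp \<Longrightarrow> inU u \<Longrightarrow> v \<in> V \<Longrightarrow> hi \<le> u v \<Longrightarrow> F u v < 0"
  proof (cases G)
    case Hyp
    then show ?thesis using hyp_barrier[OF Hyp u0] that by (metis geom.distinct(1))
  next
    case Euc
    have "u0 v \<le> M" if "v \<in> V" for v
    proof -
      have "0 \<le> B * N" using B(1) N by simp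
      then show ?thesis using uM[OF that order_refl] by linarith
    qed
    then show ?thesis using that[of M] Euc by (auto simp: udom_def)
  qed
  \<comment> \<open>Below every value reachable by time \<open>N\<close>, and strictly below
    \<open>hi\<close>, which keeps \<open>lo\<close> in the domain.\<close>
  define lo where "lo = min hi (- M) - 1"
  have lohi: "lo < hi" "lo \<le> - M" by (auto simp: lo_def)
  have "lo \<in> udom G" using hi(1) lohi(1) by (cases G) (auto simp: udom_def)
  then have I: "{lo..hi} \<subseteq> udom G" using hi(1) by (rule udom_interval)
  define cl where "cl = (\<lambda>p (v :: 'v). max lo (min hi (p v)) :: real)"
  have clb: "box lo hi (cl p)" for p using lohi by (auto simp: box_def cl_def)
  have clU: "inU (cl p)" for p by (rule box_inU[OF clb I])
  obtain L where L: "0 \<le> L" "\<And>v p q. v \<in> V \<Longrightarrow> box lo hi p \<Longrightarrow> box lo hi q \<Longrightarrow> \<bar>F p v - F q v\<bar> \<le> L * (\<Sum>w\<in>V. \<bar>p w - q w\<bar>)"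
    using F_lipschitz[OF I] by blast
  have lip: "\<bar>F (cl p) v - F (cl q) v\<bar> \<le> L * (\<Sum>w\<in>V. \<bar>p w - q w\<bar>)" if "v \<in> V" for v p q
  proof -
    have "\<bar>F (cl p) v - F (cl q) v\<bar> \<le> L * (\<Sum>w\<in>V. \<bar>cl p w - cl q w\<bar>)" by (rule L(2)[OF that clb clb])
    also have "\<dots> \<le> L * (\<Sum>w\<in>V. \<bar>p w - q w\<bar>)"
      using L(1) by (intro mult_left_mono sum_mono) (auto simp: cl_def)
    finally show ?thesis .
  qed
  obtain x where x: "\<And>v. v \<in> V \<Longrightarrow> x 0 v = u0 v"
    "\<And>t v. 0 \<le> t \<Longrightarrow> v \<in> V \<Longrightarrow> ((\<lambda>s. x s v) has_real_derivative F (cl (x t)) v) (at t within {0..})"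
    using bounded_lipschitz_ode[where F = "\<lambda>p. F (cl p)" and ?x0.0 = u0, OF surf(5) lip B(2)[OF clU] L(1) B(1)] by blast
  have up: "x t v - B * t \<le> u0 v" and dn: "u0 v \<le> x t v + B * t" if t: "0 \<le> t" and v: "v \<in> V" for t v
  proof -
    have b: "\<bar>F (cl (x s)) v\<bar> \<le> B" for s using B(2)[OF clU v] .
    have "x t v - B * t \<le> x 0 v - B * 0"
    proof (rule DERIV_within_Ici_nonincreasing[where f' = "\<lambda>s. F (cl (x s)) v - B", OF _ _ order_refl t])
      show "((\<lambda>a. x a v - B * a) has_real_derivative F (cl (x s)) v - B) (at s within {0..})" if "0 \<le> s" for s
        by (rule derivative_eq_intros x(2)[OF that v] refl)+ simp
      show "F (cl (x s)) v - B \<le> 0" for s using b[of s] by linarith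
    qed
    then show "x t v - B * t \<le> u0 v" using x(1)[OF v] by simp
    have "- x t v - B * t \<le> - x 0 v - B * 0"
    proof (rule DERIV_within_Ici_nonincreasing[where f' = "\<lambda>s. - F (cl (x s)) v - B", OF _ _ order_refl t])
      show "((\<lambda>a. - x a v - B * a) has_real_derivative - F (cl (x s)) v - B) (at s within {0..})" if "0 \<le> s" for s
        by (rule derivative_eq_intros x(2)[OF that v] refl)+ simp
      show "- F (cl (x s)) v - B \<le> 0" for s using b[of s] by linarith
    qed
    then show "u0 v \<le> x t v + B * t" using x(1)[OF v] by simp
  qed
  have ub: "x t v \<le> hi" if t: "0 \<le> t" "t \<le> N" and v: "v \<in> V" for t v
  proof (cases G)
    case Euc
    then show ?thesis using up[OF t(1) v] uM[OF v t(2)] hi(3) by linarith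
  next
    case Hyp
    \<comment> \<open>The barrier lemma for a one-element family, applied to the negated coordinate:
      above \<open>hi\<close> the clamped coordinate equals \<open>hi\<close>, where the field is
      negative.\<close>
    have "- hi \<le> - x t v"
    proof (rule min_family_barrier[where f = "\<lambda>_ t. - x t v" and f' = "\<lambda>_ t. - F (cl (x t)) v" and I = "{()}" and i = "()"])
      show "((\<lambda>t. - x t v) has_real_derivative - F (cl (x s)) v) (at s within {0..})" if "0 \<le> s" for s
        by (rule derivative_eq_intros x(2)[OF that v] refl)+
      show "- hi \<le> - x 0 v" using x(1)[OF v] hi(2)[OF v] by simp
      show "0 < - F (cl (x s)) v" if "- x s v < - hi" for s
      proof -
        have "hi \<le> cl (x s) v" using that lohi by (simp add: cl_def)
        then show ?thesis using hi(4)[OF Hyp clU v] by simp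
      qed
    qed (use t in auto)
    then show ?thesis by simp
  qed
  have cleq: "cl (x t) v = x t v" if "0 \<le> t" "t \<le> N" "v \<in> V" for t v
  proof -
    have "lo \<le> x t v" using dn[OF that(1,3)] uM[OF that(3,2)] lohi(2) by linarith
    then show ?thesis using ub[OF that] by (simp add: cl_def)
  qed
  have "sol x N"
    unfolding sol_def
  proof (intro allI impI conjI ballI)
    fix t assume t: "0 \<le> t \<and> t \<le> N"
    then show "inU (x t)" using cleq clU[of "x t"] by (auto simp: inU_def)
    fix v assume v: "v \<in> V"
    have "F (cl (x t)) v = F (x t) v" using cleq t v by (intro F_cong) auto
    then show "((\<lambda>s. x s v) has_real_derivative F (x t) v) (at t within {0..})" using x(2)[of t v] t v by simp
  qed
  then show ?thesis using x(1) by blast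
qed

text \<open>Uniqueness makes the solutions up to the times \<open>n\<close> agree where both are
  defined, so they can be glued.\<close>

lemma global_sol_exists:
  assumes u0: "inU u0"
  shows "\<exists>u. (\<forall>N. sol u N) \<and> (\<forall>v\<in>V. u 0 v = u0 v)"
proof -
  have "\<forall>n::nat. \<exists>u. sol u (real n) \<and> (\<forall>v\<in>V. u 0 v = u0 v)" using sol_exists[OF u0] by simp
  then obtain x where x: "\<And>n. sol (x n) (real n)" "\<And>n v. v \<in> V \<Longrightarrow> x n 0 v = u0 v" by metis
  define U where "U = (\<lambda>t. x (nat \<lceil>t\<rceil> + 1) t)"
  have mono: "sol u N" if "sol u M" "N \<le> M" for u N M using that unfolding sol_def by auto
  have agree: "x n t v = x m t v" if "0 \<le> t" "t \<le> real n" "t \<le> real m" "v \<in> V" for n m t v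
    using sol_unique[of "x n" t "x m" t v] mono[OF x(1)[of n] that(2)] mono[OF x(1)[of m] that(3)] x(2) that by simp
  have UM: "U t v = x m t v" if "0 \<le> t" "t \<le> real m" "v \<in> V" for t m v
    unfolding U_def using that by (intro agree) linarith+
  have "sol U N" for N
    unfolding sol_def
  proof (intro allI impI conjI ballI)
    fix t assume t: "0 \<le> t \<and> t \<le> N"
    define m where "m = nat \<lceil>t\<rceil> + 1"
    \<comment> \<open>The extra unit of time makes \<open>U\<close> agree with one single solution
      on a neighbourhood of \<open>t\<close>, as the derivative requires.\<close>
    have t1: "t + 1 \<le> real (m + 1)" unfolding m_def by linarith
    have U: "U s v = x (m + 1) s v" if "0 \<le> s" "s \<le> t + 1" "v \<in> V" for s v using that t1 by (intro UM) auto
    have "inU (x (m + 1) t)" using solD(1)[OF x(1)[of "m + 1"]] t t1 by simp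
    then show "inU (U t)" using U t by (auto simp: inU_def)
    fix v assume v: "v \<in> V"
    have "((\<lambda>s. x (m + 1) s v) has_real_derivative F (x (m + 1) t) v) (at t within {0..})"
      using solD(2)[OF x(1)[of "m + 1"] _ _ v] t t1 by simp
    also have "F (x (m + 1) t) v = F (U t) v" using U t v by (intro F_cong) auto
    finally show "((\<lambda>s. U s v) has_real_derivative F (U t) v) (at t within {0..})"
      by (rule has_field_derivative_transform_within[where d = 1]) (use t v U in \<open>auto simp: dist_real_def\<close>)
  qed
  moreover have "U 0 v = u0 v" if "v \<in> V" for v unfolding U_def using x(2)[OF that] by simp
  ultimately show ?thesis by blast
qed

section \<open>A priori bounds under attainability\<close>

lemma sum_const_Euc:
  assumes "G = Euc" "\<And>N. sol u N" "0 \<le> t"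
  shows "(\<Sum>v\<in>V. u t v) = (\<Sum>v\<in>V. u 0 v)"
proof -
  have d: "((\<lambda>s. \<Sum>v\<in>V. u s v) has_real_derivative 0) (at s within {0..})" if s: "0 \<le> s" for s
  proof -
    have "((\<lambda>s. \<Sum>v\<in>V. u s v) has_real_derivative (\<Sum>v\<in>V. F (u s) v)) (at s within {0..})"
      by (rule DERIV_sum) (rule solD(2)[OF assms(2) s order_refl])
    then show ?thesis using sum_F_Euc[OF assms(1) solD(1)[OF assms(2) s order_refl]] by simp
  qed
  have "(\<Sum>v\<in>V. u t v) \<le> (\<Sum>v\<in>V. u 0 v)"
    by (rule DERIV_within_Ici_nonincreasing[where f' = "\<lambda>_. 0", OF d _ order_refl assms(3)]) auto
  moreover have "- (\<Sum>v\<in>V. u t v) \<le> - (\<Sum>v\<in>V. u 0 v)"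
    by (rule DERIV_within_Ici_nonincreasing[where f' = "\<lambda>_. 0", OF _ _ order_refl assms(3)])
      (use DERIV_minus[OF d] in auto)
  ultimately show ?thesis by simp
qed

text \<open>If \<open>A\<close> minimizes \<open>(\<Sum>v\<in>A. u v) + c (card A)\<close> for this strictly concave \<open>c\<close>, comparison with
  \<open>A - {a}\<close> and \<open>insert b A\<close> separates the values of \<open>u\<close> on \<open>A\<close> from the others by a gap \<open>D\<close>,
  so that attainability makes the minimum grow.\<close>

lemma attainable_lower_bound:
  assumes at: "attainable T \<Theta> k" and u: "\<And>N. sol u N"
  obtains lo where "\<And>t v. 0 \<le> t \<Longrightarrow> v \<in> V \<Longrightarrow> lo \<le> u t v"
proof -
  obtain D0 where D0: "\<And>A p. A \<subseteq> V \<Longrightarrow> A \<noteq> {} \<Longrightarrow> (G = Euc \<longrightarrow> A \<noteq> V) \<Longrightarrow> inU p \<Longrightarrow> gap D0 A p \<Longrightarrow> 0 < (\<Sum>v\<in>A. F p v)"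
    using gap_sum_pos[OF at] by blast
  define D where "D = max D0 0"
  define n where "n = card V"
  \<comment> \<open>The increments \<open>D * n\<close>, \<open>D * (n - 1)\<close>, ... fall by
    \<open>D\<close> at each step. Removing a vertex of a minimal set and adding one to it therefore
    give bounds on \<open>u\<close> that are \<open>D\<close> apart.\<close>
  define c where "c = (\<lambda>m. D * (\<Sum>j<m. real (n - j)))"
  have cS: "c (Suc m) = c m + D * real (n - m)" for m
    by (simp add: c_def algebra_simps)
  define f where "f = (\<lambda>A t. (\<Sum>v\<in>A. u t v) + c (card A))"
  define b where "b = Min ((\<lambda>A. f A 0) ` Pow V)"
  have finP: "finite (Pow V)" using surf(5) by simp
  have init: "b \<le> f A 0" if "A \<in> Pow V" for A unfolding b_def using finP that by (intro Min_le) auto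
  have lower: "b \<le> f A t" if A: "A \<in> Pow V" and t: "0 \<le> t" for A t
  proof (rule min_family_barrier[where f = f and f' = "\<lambda>A t. \<Sum>v\<in>A. F (u t) v" and c = b
      and I = "Pow V" and i = A, OF finP A _ init _ t])
    fix A s assume A: "A \<in> Pow V" and s: "(0::real) \<le> s"
    have "((\<lambda>s. \<Sum>v\<in>A. u s v) has_real_derivative (\<Sum>v\<in>A. F (u s) v)) (at s within {0..})"
    proof (rule DERIV_sum)
      fix v assume "v \<in> A"
      then have "v \<in> V" using A by auto
      then show "((\<lambda>s. u s v) has_real_derivative F (u s) v) (at s within {0..})"
        by (rule solD(2)[OF u s order_refl])
    qed
    from DERIV_add[OF this DERIV_const[of "c (card A)"]]
    show "(f A has_real_derivative (\<Sum>v\<in>A. F (u s) v)) (at s within {0..})"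
      by (simp add: f_def)
    assume lt: "f A s < b" and min: "\<And>j. j \<in> Pow V \<Longrightarrow> f A s \<le> f j s"
    \<comment> \<open>A minimal set with value below \<open>b\<close> is neither empty nor, in the
      Euclidean case, all of \<open>V\<close>: for these two sets \<open>f\<close> is constant in
      time, hence still at least \<open>b\<close>.\<close>
    have ne: "A \<noteq> {}" using lt init[of "{}"] by (auto simp: f_def)
    have nV: "G = Euc \<longrightarrow> A \<noteq> V"
      using lt init[of V] sum_const_Euc[OF _ u s] by (auto simp: f_def)
    have finA: "finite A" using A surf(5) finite_subset by auto
    obtain m where m: "card A = Suc m" using ne finA by (metis card_eq_0_iff not0_implies_Suc)
    have mn: "Suc m \<le> n" unfolding n_def m[symmetric] using A surf(5) by (intro card_mono) auto
    have a: "u s a \<le> - D * real (n - m)" if aA: "a \<in> A" for a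
    proof -
      have "f A s \<le> f (A - {a}) s" using A by (intro min) auto
      moreover have "(\<Sum>v\<in>A. u s v) = u s a + (\<Sum>v\<in>A - {a}. u s v)" using finA aA by (simp add: sum.remove)
      moreover have "card (A - {a}) = m" using finA aA m by simp
      ultimately show ?thesis by (simp add: f_def m cS)
    qed
    have b: "- D * real (n - Suc m) \<le> u s w" if w: "w \<in> V - A" for w
    proof -
      have "f A s \<le> f (insert w A) s" using A w by (intro min) auto
      then show ?thesis using finA w by (simp add: f_def m cS)
    qed
    have nm: "real (n - m) = real (n - Suc m) + 1" using mn by linarith
    have D: "0 \<le> D" "D0 \<le> D" by (auto simp: D_def)
    have "gap D0 A (u s)"
      unfolding gap_def
    proof (intro conjI ballI impI)
      fix x w assume x: "x \<in> A" and w: "w \<in> V - A"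
      show "u s x \<le> u s w - D0" using a[OF x] b[OF w] D(2) unfolding nm by (simp add: algebra_simps)
    next
      fix x assume x: "x \<in> A"
      \<comment> \<open>The last increment of \<open>c\<close> is still at least \<open>D\<close>,
        which supplies the absolute smallness that \<open>gap\<close> asks for in hyperbolic
        geometry.\<close>
      have "0 \<le> D * real (n - Suc m)" using D(1) by simp
      then show "u s x \<le> - D0" using a[OF x] D(2) unfolding nm by (simp add: algebra_simps)
    qed
    then show "0 < (\<Sum>v\<in>A. F (u s) v)" using A ne nV solD(1)[OF u s order_refl] by (intro D0) auto
  qed
  \<comment> \<open>Singletons belong to the family, so its lower bound is one for each
    coordinate.\<close>
  show ?thesis
  proof (rule that[of "b - c 1"])
    fix t v assume "(0::real) \<le> t" "v \<in> V"
    then show "b - c 1 \<le> u t v" using lower[of "{v}" t] by (simp add: f_def)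
  qed
qed

lemma attainable_bounded:
  assumes at: "attainable T \<Theta> k" and u: "\<And>N. sol u N"
  obtains lo hi where "{lo..hi} \<subseteq> udom G" "\<And>t. 0 \<le> t \<Longrightarrow> box lo hi (u t)"
proof -
  obtain lo where lo: "\<And>t v. 0 \<le> t \<Longrightarrow> v \<in> V \<Longrightarrow> lo \<le> u t v" using attainable_lower_bound[OF assms] by blast
  obtain hi where hi: "hi \<in> udom G" "\<And>t v. 0 \<le> t \<Longrightarrow> v \<in> V \<Longrightarrow> u t v \<le> hi"
  proof (cases G)
    case Hyp
    obtain hi where h: "hi \<in> udom G" "\<And>v. v \<in> V \<Longrightarrow> u 0 v \<le> hi" "\<And>p v. inU p \<Longrightarrow> v \<in> V \<Longrightarrow> hi \<le> p v \<Longrightarrow> F p v < 0"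
      using hyp_barrier[OF Hyp solD(1)[OF u order_refl order_refl]] by metis
    have "u t v \<le> hi" if t: "0 \<le> t" and v: "v \<in> V" for t v
    proof -
      have "- hi \<le> - u t v"
      proof (rule min_family_barrier[where f = "\<lambda>_ t. - u t v" and f' = "\<lambda>_ t. - F (u t) v" and I = "{()}" and i = "()"])
        show "((\<lambda>t. - u t v) has_real_derivative - F (u s) v) (at s within {0..})" if "0 \<le> s" for s
          by (rule derivative_eq_intros solD(2)[OF u that order_refl v] refl)+
        show "- hi \<le> - u 0 v" using h(2)[OF v] by simp
        show "0 < - F (u s) v" if "0 \<le> s" "- u s v < - hi" for s
          using h(3)[OF solD(1)[OF u that(1) order_refl] v] that(2) by simp
      qed (use t in auto)
      then show ?thesis by simp
    qed
    then show ?thesis using that h(1) by blast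
  next
    case Euc
    have "u t v \<le> (\<Sum>w\<in>V. u 0 w) - (\<Sum>w\<in>V - {v}. lo)" if t: "0 \<le> t" and v: "v \<in> V" for t v
    proof -
      have "u t v + (\<Sum>w\<in>V - {v}. u t w) = (\<Sum>w\<in>V. u 0 w)"
        using sum_const_Euc[OF Euc u t] sum.remove[OF surf(5) v, of "u t"] by simp
      moreover have "(\<Sum>w\<in>V - {v}. lo) \<le> (\<Sum>w\<in>V - {v}. u t w)" using lo[OF t] by (intro sum_mono) auto
      ultimately show ?thesis by linarith
    qed
    then have "u t v \<le> (\<Sum>w\<in>V. u 0 w) - real (card V - 1) * lo" if "0 \<le> t" "v \<in> V" for t v
      using that surf(5) by (simp add: card_Diff_singleton)
    then show ?thesis using that[of "(\<Sum>w\<in>V. u 0 w) - real (card V - 1) * lo"] Euc by (simp add: udom_def)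
  qed
  obtain v where v: "v \<in> V" using surf(11) by blast
  have "lo \<le> hi" using lo[OF order_refl v] hi(2)[OF order_refl v] by simp
  then have "lo \<in> udom G" using hi(1) by (cases G) (auto simp: udom_def)
  then have "{lo..hi} \<subseteq> udom G" using hi(1) by (rule udom_interval)
  then show ?thesis using that lo hi(2) by (auto simp: box_def)
qed

section \<open>Convergence of bounded solutions\<close>

lemma sol_shift:
  assumes u: "\<And>N. sol u N" and h: "0 \<le> h"
  shows "sol (\<lambda>t. u (t + h)) N"
  unfolding sol_def
proof (intro allI impI conjI ballI)
  fix t assume t: "0 \<le> t \<and> t \<le> N"
  then have th: "0 \<le> t + h" using h by simp
  show "inU (u (t + h))" by (rule solD(1)[OF u th order_refl])
  fix v assume v: "v \<in> V"
  note d = solD(2)[OF u th order_refl v]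
  show "((\<lambda>s. u (s + h) v) has_real_derivative F (u (t + h)) v) (at t within {0..})"
  \<comment> \<open>At time 0 the derivative is one-sided; for positive \<open>h\<close> the shifted
    time is interior and the two-sided derivative can be translated.\<close>
  proof (cases "h = 0")
    case True
    then show ?thesis using d by simp
  next
    case False
    then have "((\<lambda>s. u s v) has_real_derivative F (u (t + h)) v) (at (t + h))"
      using d h t by (simp add: at_within_interior[of "t + h" "{0..}"])
    then have "((\<lambda>s. u (s + h) v) has_real_derivative F (u (t + h)) v) (at t)" by (simp add: DERIV_shift)
    then show ?thesis by (rule has_field_derivative_at_within)
  qed
qed

lemma F_tendsto:
  assumes l: "inU l" and lim: "\<And>w. w \<in> V \<Longrightarrow> ((\<lambda>t. u t w) \<longlongrightarrow> l w) at_top" and v: "v \<in> V"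
  shows "((\<lambda>t::real. F (u t) v) \<longlongrightarrow> F l v) at_top"
proof -
  have fin: "finite (l ` V)" "l ` V \<noteq> {}" using surf(5,11) by auto
  define m where "m = Max (l ` V)"
  have m: "m \<in> udom G" using Max_in[OF fin] l by (auto simp: m_def[symmetric] inU_def)
  have mge: "l w \<le> m" if "w \<in> V" for w
    using Max_ge[OF fin(1) imageI[OF that]] by (simp add: m_def)
  \<comment> \<open>A box around the limit must still fit into the domain: for negative
    \<open>m\<close> the value \<open>m / 2\<close> lies strictly between \<open>m\<close> and
    0.\<close>
  define hi where "hi = (case G of Hyp \<Rightarrow> m / 2 | Euc \<Rightarrow> m + 1)"
  have hi: "hi \<in> udom G" "m < hi" using m by (cases G; simp add: hi_def udom_def)+
  define lo where "lo = Min (l ` V) - 1"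
  have lo: "lo < l w" if "w \<in> V" for w
    using Min_le[OF fin(1) imageI[OF that]] unfolding lo_def by linarith
  have "lo \<in> udom G" using hi(1) lo[OF v] mge[OF v] hi(2) by (cases G) (auto simp: udom_def)
  then have I: "{lo..hi} \<subseteq> udom G" using hi(1) by (rule udom_interval)
  obtain L where L: "0 \<le> L" "\<And>v p q. v \<in> V \<Longrightarrow> box lo hi p \<Longrightarrow> box lo hi q \<Longrightarrow> \<bar>F p v - F q v\<bar> \<le> L * (\<Sum>w\<in>V. \<bar>p w - q w\<bar>)"
    using F_lipschitz[OF I] by blast
  have bl: "box lo hi l" unfolding box_def
  proof
    fix w assume "w \<in> V"
    then show "l w \<in> {lo..hi}" using lo[of w] mge[of w] hi(2) by simp
  qed
  have "\<forall>\<^sub>F t in at_top. \<forall>w\<in>V. lo < u t w \<and> u t w < hi"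
  proof (intro eventually_ball_finite surf(5) ballI eventually_conj)
    fix w assume w: "w \<in> V"
    show "\<forall>\<^sub>F t in at_top. lo < u t w" using lim[OF w] lo[OF w] by (rule order_tendstoD(1))
    show "\<forall>\<^sub>F t in at_top. u t w < hi" 
      using lim[OF w] le_less_trans[OF mge[OF w] hi(2)] by (rule order_tendstoD(2))
  qed
  then have ev: "\<forall>\<^sub>F t in at_top. norm (F (u t) v - F l v) \<le> L * (\<Sum>w\<in>V. \<bar>u t w - l w\<bar>)"
  proof eventually_elim
    case (elim t)
    then have "box lo hi (u t)" by (auto simp: box_def less_imp_le)
    then show ?case using L(2)[OF v _ bl] by simp
  qed
  have "((\<lambda>t. L * (\<Sum>w\<in>V. \<bar>u t w - l w\<bar>)) \<longlongrightarrow> L * (\<Sum>w\<in>V. \<bar>l w - l w\<bar>)) at_top"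
    using lim by (intro tendsto_intros)
  then have "((\<lambda>t. L * (\<Sum>w\<in>V. \<bar>u t w - l w\<bar>)) \<longlongrightarrow> 0) at_top" by simp
  from Lim_null_comparison[OF ev this] show ?thesis by (simp add: LIM_zero_iff)
qed

lemma limit_is_zero:
  assumes u: "\<And>N. sol u N" and l: "inU l" and lim: "\<And>w. w \<in> V \<Longrightarrow> ((\<lambda>t. u t w) \<longlongrightarrow> l w) at_top" and v: "v \<in> V"
  shows "F l v = 0"
  by (rule derivative_limit_zero[of "\<lambda>t. u t v" "\<lambda>t. F (u t) v", OF _ lim[OF v] F_tendsto[OF l lim v]])
    (rule solD(2)[OF u _ order_refl v])

text \<open>\<open>strong_dissipation\<close> is applied to the solution and its translate by
  \<open>h\<close>; in the Euclidean case their difference has sum 0 by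
  \<open>sum_const_Euc\<close>. Squared distances decay at rate \<open>2 * \<mu>\<close>, hence
  distances at rate \<open>\<mu>\<close>.\<close>

lemma bounded_converges:
  assumes u: "\<And>N. sol u N" and I: "{lo..hi} \<subseteq> udom G" and b: "\<And>t. 0 \<le> t \<Longrightarrow> box lo hi (u t)"
  obtains l K lm where "box lo hi l" "0 < lm" "0 \<le> K"
    "\<And>w. w \<in> V \<Longrightarrow> ((\<lambda>t. u t w) \<longlongrightarrow> l w) at_top"
    "\<And>t w. 0 \<le> t \<Longrightarrow> w \<in> V \<Longrightarrow> \<bar>u t w - l w\<bar> \<le> K * exp (- lm * t)"
proof -
  obtain \<mu> where \<mu>: "0 < \<mu>" "\<And>p q. box lo hi p \<Longrightarrow> box lo hi q \<Longrightarrow> (G = Euc \<longrightarrow> (\<Sum>v\<in>V. p v - q v) = 0) \<Longrightarrow>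
    (\<Sum>v\<in>V. (p v - q v) * (F p v - F q v)) \<le> - \<mu> * (\<Sum>v\<in>V. (p v - q v)\<^sup>2)"
    using strong_dissipation[OF I] by blast
  \<comment> \<open>A bound for the distance between any two points of the box, and therefore
    independent of \<open>h\<close>.\<close>
  define K where "K = sqrt (card V * (hi - lo)\<^sup>2)"
  have step: "\<bar>u (t + h) w - u t w\<bar> \<le> K * exp (- \<mu> * t)" if t: "0 \<le> t" and h: "0 \<le> h" and w: "w \<in> V" for t h w
  proof -
    define y where "y = (\<lambda>t. \<Sum>v\<in>V. (u (t + h) v - u t v)\<^sup>2)"
    have "y t \<le> exp (- (2 * \<mu>) * t) * y 0"
    proof (rule exp_decay[OF _ _ t])
      fix s :: real assume s: "0 \<le> s"
      show "(y has_real_derivative 2 * (\<Sum>v\<in>V. (u (s + h) v - u s v) * (F (u (s + h)) v - F (u s) v))) (at s within {0..})"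
        unfolding y_def by (rule sq_dist_deriv[OF sol_shift[OF u h] u s order_refl])
      have "(\<Sum>v\<in>V. u (s + h) v - u s v) = 0" if "G = Euc"
        using sum_const_Euc[OF that u s] sum_const_Euc[OF that u, of "s + h"] s h by (simp add: sum_subtractf)
      then show "2 * (\<Sum>v\<in>V. (u (s + h) v - u s v) * (F (u (s + h)) v - F (u s) v)) \<le> - (2 * \<mu>) * y s"
        using \<mu>(2)[OF b b, of "s + h" s] s h by (simp add: y_def)
    qed
    moreover have "y 0 \<le> card V * (hi - lo)\<^sup>2"
    proof -
      have "(u (0 + h) v - u 0 v)\<^sup>2 \<le> (hi - lo)\<^sup>2" if "v \<in> V" for v
        using b[of h] b[of 0] h that by (intro power2_le_iff_abs_le[THEN iffD2]) (auto simp: box_def abs_le_iff, force+)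
      then have "y 0 \<le> (\<Sum>v\<in>V. (hi - lo)\<^sup>2)" unfolding y_def by (intro sum_mono)
      then show ?thesis by simp
    qed
    moreover have "(u (t + h) w - u t w)\<^sup>2 \<le> y t" unfolding y_def using w surf(5) by (intro member_le_sum) auto
    ultimately have "(u (t + h) w - u t w)\<^sup>2 \<le> exp (- (2 * \<mu>) * t) * (card V * (hi - lo)\<^sup>2)"
      by (smt (verit) exp_ge_zero mult_left_mono)
    also have "\<dots> = (K * exp (- \<mu> * t))\<^sup>2"
      by (simp add: K_def power_mult_distrib exp_double[symmetric] mult_ac)
    finally show ?thesis by (simp add: K_def power2_le_iff_abs_le)
  qed
  have "\<exists>l. ((\<lambda>t. u t w) \<longlongrightarrow> l) at_top \<and> (\<forall>t\<ge>0. \<bar>u t w - l\<bar> \<le> K * exp (- \<mu> * t))" if w: "w \<in> V" for w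
    using cauchy_exp_limit[of "\<lambda>t. u t w" K \<mu>, OF step[OF _ _ w] \<mu>(1)] by metis
  then obtain l where l: "\<And>w. w \<in> V \<Longrightarrow> ((\<lambda>t. u t w) \<longlongrightarrow> l w) at_top"
    "\<And>t w. 0 \<le> t \<Longrightarrow> w \<in> V \<Longrightarrow> \<bar>u t w - l w\<bar> \<le> K * exp (- \<mu> * t)" by metis
  have "l w \<in> {lo..hi}" if w: "w \<in> V" for w
    by (rule Lim_in_closed_set[OF closed_atLeastAtMost _ _ l(1)[OF w]])
      (use b w in \<open>auto simp: box_def intro!: eventually_at_top_linorderI[of 0]\<close>)
  then have "box lo hi l" by (simp add: box_def)
  then show ?thesis using that[of l \<mu> K] \<mu>(1) l by (simp add: K_def)
qed

section \<open>Transfer between logarithmic coordinates and radii\<close>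

lemma flow_of_sol:
  assumes u: "\<And>N. sol u N" and i: "\<And>v. v \<in> V \<Longrightarrow> rad G (u 0 v) = r0 v"
  shows "flow_solution G T \<Theta> k r0 (\<lambda>t v. rad G (u t v))"
  unfolding flow_solution_def
proof (intro conjI ballI allI impI)
  show "rad G (u 0 v) = r0 v" if "v \<in> V" for v by (rule i[OF that])
  fix t v assume t: "(0::real) \<le> t" and v: "v \<in> V"
  have U: "u t w \<in> udom G" if "w \<in> V" for w using solD(1)[OF u t order_refl] that by (simp add: inU_def)
  show "0 < rad G (u t v)" by (rule lgr_rad(1)[OF U[OF v]])
  have "k v - curv G T \<Theta> (\<lambda>w. rad G (u t w)) v = F (\<lambda>w. lgr G (rad G (u t w))) v"
    using lgr_rad(1)[OF U] v by (intro curv_eq_F)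
  also have "\<dots> = F (u t) v" using lgr_rad(2)[OF U] v by (intro F_cong) auto
  finally have c: "k v - curv G T \<Theta> (\<lambda>w. rad G (u t w)) v = F (u t) v" .
  show "((\<lambda>s. rad G (u s v)) has_real_derivative
      (k v - curv G T \<Theta> (\<lambda>w. rad G (u t w)) v) * flow_factor G (rad G (u t v))) (at t within {0..})"
    unfolding c using DERIV_chain2[OF lgr_rad(3)[OF U[OF v]] solD(2)[OF u t order_refl v]] by (simp add: mult.commute)
qed

lemma sol_of_flow:
  assumes r: "flow_solution G T \<Theta> k r0 r"
  shows "sol (\<lambda>t v. lgr G (r t v)) N"
  unfolding sol_def
proof (intro conjI ballI allI impI)
  fix t assume t: "0 \<le> t \<and> t \<le> N"
  then have pos: "0 < r t v" if "v \<in> V" for v using r that unfolding flow_solution_def by blast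
  then show "inU (\<lambda>v. lgr G (r t v))" using rad_lgr(1) by (auto simp: inU_def)
  fix v assume v: "v \<in> V"
  have "((\<lambda>s. r s v) has_real_derivative (k v - curv G T \<Theta> (r t) v) * flow_factor G (r t v)) (at t within {0..})"
    using r t v unfolding flow_solution_def by blast
  then have d: "((\<lambda>s. r s v) has_real_derivative F (\<lambda>w. lgr G (r t w)) v * flow_factor G (r t v)) (at t within {0..})"
    using curv_eq_F[of "r t" v, OF pos v] by simp
  show "((\<lambda>s. lgr G (r s v)) has_real_derivative F (\<lambda>w. lgr G (r t w)) v) (at t within {0..})"
  proof -
    have "1 / c * (e * c) = e" if "0 < c" for c e :: real using that by simp
    from this[OF rad_lgr(3)[OF pos[OF v], of G]] show ?thesis
      using DERIV_chain2[OF rad_lgr(4)[OF pos[OF v], of G] d] by (simp only:)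
  qed
qed

text \<open>Carries the exponential rate from the logarithmic coordinates over to the radii.\<close>

lemma rad_lipschitz:
  assumes I: "{lo..hi} \<subseteq> udom G"
  obtains L where "0 \<le> L" "\<And>x y. x \<in> {lo..hi} \<Longrightarrow> y \<in> {lo..hi} \<Longrightarrow> \<bar>rad G x - rad G y\<bar> \<le> L * \<bar>x - y\<bar>"
proof -
  have cr: "continuous_on {lo..hi} (rad G)"
    using I by (intro continuous_at_imp_continuous_on ballI DERIV_isCont[OF lgr_rad(3)]) auto
  have "continuous_on {lo..hi} (\<lambda>x. flow_factor G (rad G x))"
    using cr by (cases G) (auto simp: flow_factor_def intro!: continuous_intros)
  then have "bounded ((\<lambda>x. flow_factor G (rad G x)) ` {lo..hi})"
    by (intro compact_imp_bounded compact_continuous_image compact_Icc)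
  then obtain L where "\<forall>x\<in>{lo..hi}. \<bar>flow_factor G (rad G x)\<bar> \<le> L" unfolding bounded_iff by auto
  then have L: "\<bar>flow_factor G (rad G x)\<bar> \<le> L" if "x \<in> {lo..hi}" for x using that by blast
  show ?thesis
  proof (rule that[of "max L 0"])
    fix x y assume xy: "x \<in> {lo..hi}" "y \<in> {lo..hi}"
    have "norm (rad G x - rad G y) \<le> max L 0 * norm (x - y)"
    proof (rule field_differentiable_bound[OF convex_real_interval(5) _ _ xy])
      fix z assume z: "z \<in> {lo..hi}"
      then have "z \<in> udom G" using I by blast
      then show "(rad G has_real_derivative flow_factor G (rad G z)) (at z within {lo..hi})"
        by (rule has_field_derivative_at_within[OF lgr_rad(3)])
      show "norm (flow_factor G (rad G z)) \<le> max L 0" using L[OF z] by simp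
    qed
    then show "\<bar>rad G x - rad G y\<bar> \<le> max L 0 * \<bar>x - y\<bar>" by simp
  qed simp
qed

lemma flow_main:
  assumes r0: "\<forall>v\<in>V. r0 v > 0"
  shows "\<exists>r. flow_solution G T \<Theta> k r0 r
           \<and> (\<forall>r'. flow_solution G T \<Theta> k r0 r' \<longrightarrow> (\<forall>t\<ge>0. \<forall>v\<in>verts T. r' t v = r t v))
           \<and> (flow_converges T r \<longleftrightarrow> attainable T \<Theta> k)
           \<and> (flow_converges T r \<longrightarrow>
                (\<exists>rs. (\<forall>v\<in>verts T. rs v > 0)
                   \<and> (\<exists>C lam. C > 0 \<and> lam > 0 \<and>
                        (\<forall>t\<ge>0. \<forall>v\<in>verts T. \<bar>r t v - rs v\<bar> \<le> C * exp (- lam * t)))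
                   \<and> realizable G T \<Theta> rs
                   \<and> (\<forall>v\<in>verts T. curv G T \<Theta> rs v = k v)
                   \<and> circle_pattern G T \<Theta> rs))"
proof -
  define u0 where "u0 = (\<lambda>v. lgr G (r0 v))"
  have "inU u0" using r0 rad_lgr(1) by (auto simp: inU_def u0_def)
  then obtain u where u: "\<And>N. sol u N" "\<And>v. v \<in> V \<Longrightarrow> u 0 v = u0 v" using global_sol_exists by blast
  define r where "r = (\<lambda>t v. rad G (u t v))"
  have flow: "flow_solution G T \<Theta> k r0 r"
    unfolding r_def using u r0 rad_lgr(2) by (intro flow_of_sol) (auto simp: u0_def)
  have ud: "u t v \<in> udom G" if "0 \<le> t" "v \<in> V" for t v
    using solD(1)[OF u(1) that(1) order_refl] that(2) by (simp add: inU_def)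
  have uniq: "r' t v = r t v" if r': "flow_solution G T \<Theta> k r0 r'" and t: "0 \<le> t" and v: "v \<in> V" for r' t v
  proof -
    have "lgr G (r' t v) = u t v"
      by (rule sol_unique[OF sol_of_flow[OF r'] u(1) _ t order_refl v])
        (use r' u(2) in \<open>auto simp: flow_solution_def u0_def\<close>)
    moreover have "0 < r' t v" using r' t v unfolding flow_solution_def by blast
    ultimately show ?thesis using rad_lgr(2)[of "r' t v" G] by (simp add: r_def)
  qed
  have necessary: "attainable T \<Theta> k" if conv: "flow_converges T r"
  proof -
    obtain rs where rs: "\<And>v. v \<in> V \<Longrightarrow> 0 < rs v" "\<And>v. v \<in> V \<Longrightarrow> ((\<lambda>t. r t v) \<longlongrightarrow> rs v) at_top"
      using conv unfolding flow_converges_def by blast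
    define l where "l = (\<lambda>v. lgr G (rs v))"
    have l: "inU l" using rs(1) rad_lgr(1) by (auto simp: inU_def l_def)
    have lim: "((\<lambda>t. u t v) \<longlongrightarrow> l v) at_top" if v: "v \<in> V" for v
    proof -
      have "((\<lambda>t. lgr G (r t v)) \<longlongrightarrow> l v) at_top"
        unfolding l_def by (rule isCont_tendsto_compose[OF DERIV_isCont[OF rad_lgr(4)[OF rs(1)[OF v]]] rs(2)[OF v]])
      then show ?thesis
      proof (rule Lim_transform_eventually)
        show "\<forall>\<^sub>F t in at_top. lgr G (r t v) = u t v"
          using lgr_rad(2)[OF ud] v by (intro eventually_at_top_linorderI[of 0]) (simp add: r_def)
      qed
    qed
    show ?thesis by (rule attainable_if_zero[OF l limit_is_zero[OF u(1) l lim]])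
  qed
  have sufficient: "\<exists>rs. (\<forall>v\<in>V. rs v > 0) \<and> (\<forall>v\<in>V. ((\<lambda>t. r t v) \<longlongrightarrow> rs v) at_top)
      \<and> (\<exists>C lam. C > 0 \<and> lam > 0 \<and> (\<forall>t\<ge>0. \<forall>v\<in>V. \<bar>r t v - rs v\<bar> \<le> C * exp (- lam * t)))
      \<and> (\<forall>v\<in>V. curv G T \<Theta> rs v = k v)" if at: "attainable T \<Theta> k"
  proof -
    obtain lo hi where I: "{lo..hi} \<subseteq> udom G" and b: "\<And>t. 0 \<le> t \<Longrightarrow> box lo hi (u t)"
      using attainable_bounded[OF at u(1)] by metis
    obtain l K lm where l: "box lo hi l" "0 < lm" "0 \<le> K"
      "\<And>w. w \<in> V \<Longrightarrow> ((\<lambda>t. u t w) \<longlongrightarrow> l w) at_top"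
      "\<And>t w. 0 \<le> t \<Longrightarrow> w \<in> V \<Longrightarrow> \<bar>u t w - l w\<bar> \<le> K * exp (- lm * t)"
      using bounded_converges[OF u(1) I b] by metis
    have lU: "inU l" by (rule box_inU[OF l(1) I])
    then have lud: "l v \<in> udom G" if "v \<in> V" for v using that by (simp add: inU_def)
    obtain L where L: "0 \<le> L" "\<And>x y. x \<in> {lo..hi} \<Longrightarrow> y \<in> {lo..hi} \<Longrightarrow> \<bar>rad G x - rad G y\<bar> \<le> L * \<bar>x - y\<bar>"
      using rad_lipschitz[OF I] by blast
    define rs where "rs = (\<lambda>v. rad G (l v))"
    have pos: "0 < rs v" if "v \<in> V" for v unfolding rs_def by (rule lgr_rad(1)[OF lud[OF that]])
    have lim: "((\<lambda>t. r t v) \<longlongrightarrow> rs v) at_top" if v: "v \<in> V" for v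
      unfolding r_def rs_def by (rule isCont_tendsto_compose[OF DERIV_isCont[OF lgr_rad(3)[OF lud[OF v]]] l(4)[OF v]])
    \<comment> \<open>The summand 1 keeps the constant positive even if
      \<open>L * K = 0\<close>.\<close>
    have est: "\<bar>r t v - rs v\<bar> \<le> (L * K + 1) * exp (- lm * t)" if t: "0 \<le> t" and v: "v \<in> V" for t v
    proof -
      have "\<bar>r t v - rs v\<bar> \<le> L * \<bar>u t v - l v\<bar>"
        unfolding r_def rs_def using b[OF t] l(1) v by (intro L(2)) (auto simp: box_def)
      also have "\<dots> \<le> L * (K * exp (- lm * t))" using l(5)[OF t v] L(1) by (rule mult_left_mono)
      also have "\<dots> \<le> (L * K + 1) * exp (- lm * t)" by (simp add: algebra_simps)
      finally show ?thesis .
    qed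
    have cv: "curv G T \<Theta> rs v = k v" if v: "v \<in> V" for v
    proof -
      have "k v - curv G T \<Theta> rs v = F (\<lambda>w. lgr G (rs w)) v" using pos v by (intro curv_eq_F)
      also have "\<dots> = F l v" using lgr_rad(2)[OF lud] v by (intro F_cong) (auto simp: rs_def)
      also have "\<dots> = 0" by (rule limit_is_zero[OF u(1) lU l(4) v])
      finally show ?thesis by simp
    qed
    have "0 < L * K + 1" using L(1) l(3) by (simp add: add_nonneg_pos)
    then show ?thesis using pos lim est cv l(2) by blast
  qed
  have iff: "flow_converges T r \<longleftrightarrow> attainable T \<Theta> k"
  proof
    show "attainable T \<Theta> k" if "flow_converges T r" by (rule necessary[OF that])
    assume "attainable T \<Theta> k"
    from sufficient[OF this] obtain rs where "\<forall>v\<in>V. rs v > 0" "\<forall>v\<in>V. ((\<lambda>t. r t v) \<longlongrightarrow> rs v) at_top"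
      by (elim exE conjE)
    then show "flow_converges T r" unfolding flow_converges_def by (intro exI[of _ rs]) simp
  qed
  show ?thesis
  proof (intro exI[of _ r] conjI impI allI ballI)
    show "flow_solution G T \<Theta> k r0 r" by (rule flow)
    show "r' t v = r t v" if "flow_solution G T \<Theta> k r0 r'" "0 \<le> t" "v \<in> V" for r' t v by (rule uniq[OF that])
    show "flow_converges T r \<longleftrightarrow> attainable T \<Theta> k" by (rule iff)
    assume "flow_converges T r"
    then have "attainable T \<Theta> k" by (simp only: iff)
    from sufficient[OF this] obtain rs where *: "(\<forall>v\<in>V. rs v > 0) \<and> (\<forall>v\<in>V. ((\<lambda>t. r t v) \<longlongrightarrow> rs v) at_top)
      \<and> (\<exists>C lam. C > 0 \<and> lam > 0 \<and> (\<forall>t\<ge>0. \<forall>v\<in>V. \<bar>r t v - rs v\<bar> \<le> C * exp (- lam * t)))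
      \<and> (\<forall>v\<in>V. curv G T \<Theta> rs v = k v)" by (rule exE)
    note rs = conjunct1[OF *] conjunct1[OF conjunct2[OF conjunct2[OF *]]] conjunct2[OF conjunct2[OF conjunct2[OF *]]]
    have "realizable G T \<Theta> rs" "circle_pattern G T \<Theta> rs"
      using realizable_if_pos circle_pattern_if_pos rs(1) by simp_all
    with rs show "\<exists>rs. (\<forall>v\<in>verts T. rs v > 0)
                   \<and> (\<exists>C lam. C > 0 \<and> lam > 0 \<and>
                        (\<forall>t\<ge>0. \<forall>v\<in>verts T. \<bar>r t v - rs v\<bar> \<le> C * exp (- lam * t)))
                   \<and> realizable G T \<Theta> rs
                   \<and> (\<forall>v\<in>verts T. curv G T \<Theta> rs v = k v)
                   \<and> circle_pattern G T \<Theta> rs"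
      by (intro exI[of _ rs] conjI)
  qed
qed

end

theorem theorem4p1:
  fixes G :: geom and T :: "'v set set" and \<Theta> :: "'v set \<Rightarrow> real"
    and k :: "'v \<Rightarrow> real" and r0 :: "'v \<Rightarrow> real"
  assumes "surface_triangulation T"
    and "\<forall>e\<in>edges T. 0 \<le> \<Theta> e \<and> \<Theta> e < pi"
    and "C1 T \<Theta>"
    and "curvature_vector G T k"
    and "\<forall>v\<in>verts T. r0 v > 0"
  shows "\<exists>r. flow_solution G T \<Theta> k r0 r
           \<and> (\<forall>r'. flow_solution G T \<Theta> k r0 r' \<longrightarrow> (\<forall>t\<ge>0. \<forall>v\<in>verts T. r' t v = r t v))
           \<and> (flow_converges T r \<longleftrightarrow> attainable T \<Theta> k)
           \<and> (flow_converges T r \<longrightarrow>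
                (\<exists>rs. (\<forall>v\<in>verts T. rs v > 0)
                   \<and> (\<exists>C lam. C > 0 \<and> lam > 0 \<and>
                        (\<forall>t\<ge>0. \<forall>v\<in>verts T. \<bar>r t v - rs v\<bar> \<le> C * exp (- lam * t)))
                   \<and> realizable G T \<Theta> rs
                   \<and> (\<forall>v\<in>verts T. curv G T \<Theta> rs v = k v)
                   \<and> circle_pattern G T \<Theta> rs))"
proof -
  interpret circle_data G T \<Theta> k using assms(1-4) by unfold_locales
  show ?thesis by (rule flow_main[OF assms(5)])
qed

end
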